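(* Let $\chi_1,\chi_2$ be primitive Dirichlet characters of conductors $q_1,q_2$ respectively, with $q_1,q_2>1$ and $\chi_1\chi_2(-1)=1$. For $\gamma=\begin{pmatrix} a & b\\ cq_1q_2 & d\end{pmatrix}\in\Gamma_0(q_1q_2)$ let $\gamma'=\begin{pmatrix} d & -c\\ -bq_1q_2 & a\end{pmatrix}\in\Gamma_0(q_1q_2)$. If $\chi_1$ and $\chi_2$ are even, then $S_{\chi_1,\chi_2}(\gamma)=S_{\chi_2,\chi_1}(\gamma')$. If $\chi_1$ and $\chi_2$ are odd, then \[ S_{\chi_1,\chi_2}(\gamma)=-S_{\chi_2,\chi_1}(\gamma')+(1-\psi(\gamma))\frac{\tau(\overline{\chi_1})\tau(\overline{\chi_2})}{(\pi i)^2}L(1,\chi_1)L(1,\chi_2). \]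
   Context: Write $e(x)=\exp(2\pi i x)$, $\mathbb{H}$ for the upper half-plane, and $\tau(\chi)=\sum_{n \bmod q}\chi(n)e(n/q)$ for the Gauss sum of a character $\chi$ modulo $q$; $L(s,\chi)$ is the Dirichlet $L$-function. For an ordered pair $(\eta_1,\eta_2)$ of primitive characters of conductors $r_1,r_2>1$ with $\eta_1\eta_2(-1)=1$, set $\psi_{\eta_1,\eta_2}=\eta_1\overline{\eta_2}$, with $\psi_{\eta_1,\eta_2}(\gamma)=\psi_{\eta_1,\eta_2}(d)$ for $\gamma=\begin{pmatrix} a & b\\ c & d\end{pmatrix}\in\Gamma_0(r_1r_2)$, and define the holomorphic function $f_{\eta_1,\eta_2}(z)=\sum_{k\ge1}\sum_{l\ge1}\frac{\eta_1(l)\overline{\eta_2}(k)}{l}e(klz)$ on $\mathbb{H}$. The quantity $\phi_{\eta_1,\eta_2}(\gamma)=f_{\eta_1,\eta_2}(\gamma z)-\psi_{\eta_1,\eta_2}(\gamma)f_{\eta_1,\eta_2}(z)$ is independent of $z\in\mathbb{H}$, and $S_{\eta_1,\eta_2}(\gamma)=\frac{\tau(\overline{\eta_1})}{\pi i}\phi_{\eta_1,\eta_2}(\gamma)$. In the claim, $\psi=\psi_{\chi_1,\chi_2}=\chi_1\overline{\chi_2}$, so $\psi(\gamma)=\chi_1\overline{\chi_2}(d)$. *)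

theory Defs
  imports "HOL-Analysis.Analysis"
begin

text \<open>
  Dirichlet characters are functions on all of the integers, extended by zero off the residues
  coprime to the modulus.
\<close>

definition dirichlet_char :: "nat \<Rightarrow> (int \<Rightarrow> complex) \<Rightarrow> bool" where
  "dirichlet_char q \<eta> \<longleftrightarrow> q > 0 \<and>
     (\<forall>m n. \<eta> (m * n) = \<eta> m * \<eta> n) \<and>
     (\<forall>n. \<eta> (n + int q) = \<eta> n) \<and>
     (\<forall>n. \<eta> n \<noteq> 0 \<longleftrightarrow> coprime n (int q))"

text \<open>
  The set under \<open>LEAST\<close> contains \<open>q\<close> itself; \<open>r = 0\<close> is excluded by \<open>dirichlet_char r \<eta>'\<close>.
\<close>

definition conductor :: "nat \<Rightarrow> (int \<Rightarrow> complex) \<Rightarrow> nat" where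
  "conductor q \<eta> = (LEAST r. r dvd q \<and>
     (\<exists>\<eta>'. dirichlet_char r \<eta>' \<and> (\<forall>n. coprime n (int q) \<longrightarrow> \<eta> n = \<eta>' n)))"

definition primitive_dirichlet_char :: "nat \<Rightarrow> (int \<Rightarrow> complex) \<Rightarrow> bool" where
  "primitive_dirichlet_char q \<eta> \<longleftrightarrow> dirichlet_char q \<eta> \<and> conductor q \<eta> = q"

definition even_char :: "(int \<Rightarrow> complex) \<Rightarrow> bool" where
  "even_char \<eta> \<longleftrightarrow> \<eta> (-1) = 1"

definition odd_char :: "(int \<Rightarrow> complex) \<Rightarrow> bool" where
  "odd_char \<eta> \<longleftrightarrow> \<eta> (-1) = -1"

definition conj_char :: "(int \<Rightarrow> complex) \<Rightarrow> int \<Rightarrow> complex" where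
  "conj_char \<eta> = (\<lambda>n. cnj (\<eta> n))"

definition e :: "complex \<Rightarrow> complex" where
  "e x = exp (2 * of_real pi * \<i> * x)"

definition gauss_sum :: "nat \<Rightarrow> (int \<Rightarrow> complex) \<Rightarrow> complex" where
  "gauss_sum q \<eta> = (\<Sum>n<q. \<eta> (int n) * e (of_nat n / of_nat q))"

text \<open>
  For a non-principal character the Dirichlet series converges, in general only conditionally
  when \<open>Re s \<le> 1\<close>, for every \<open>s\<close> with \<open>Re s > 0\<close>, and there it is the value of the \<open>L\<close>-function.
  Only this range is intended.  The sum must be an ordered one (\<open>suminf\<close>), not \<open>infsum\<close>.
\<close>

definition dirichlet_L :: "complex \<Rightarrow> (int \<Rightarrow> complex) \<Rightarrow> complex" where
  "dirichlet_L s \<eta> = (\<Sum>n. \<eta> (int (Suc n)) / of_nat (Suc n) powr s)"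

definition mat2 :: "int \<Rightarrow> int \<Rightarrow> int \<Rightarrow> int \<Rightarrow> int^2^2" where
  "mat2 a b c d = vector [vector [a, b], vector [c, d]]"

definition Gamma0 :: "nat \<Rightarrow> (int^2^2) set" where
  "Gamma0 N = {\<gamma>. det \<gamma> = 1 \<and> int N dvd \<gamma> $ 2 $ 1}"

definition moebius_action :: "int^2^2 \<Rightarrow> complex \<Rightarrow> complex" where
  "moebius_action \<gamma> z =
     (of_int (\<gamma> $ 1 $ 1) * z + of_int (\<gamma> $ 1 $ 2)) / (of_int (\<gamma> $ 2 $ 1) * z + of_int (\<gamma> $ 2 $ 2))"

definition psi_char :: "(int \<Rightarrow> complex) \<Rightarrow> (int \<Rightarrow> complex) \<Rightarrow> int^2^2 \<Rightarrow> complex" where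
  "psi_char \<eta>1 \<eta>2 \<gamma> = \<eta>1 (\<gamma> $ 2 $ 2) * conj_char \<eta>2 (\<gamma> $ 2 $ 2)"

definition eis_f :: "(int \<Rightarrow> complex) \<Rightarrow> (int \<Rightarrow> complex) \<Rightarrow> complex \<Rightarrow> complex" where
  "eis_f \<eta>1 \<eta>2 z =
     (\<Sum>\<^sub>\<infinity>k\<in>{1::nat..}. \<Sum>\<^sub>\<infinity>l\<in>{1::nat..}.
        \<eta>1 (int l) * conj_char \<eta>2 (int k) / of_nat l * e (of_nat k * of_nat l * z))"

text \<open>
  The constant value, on the upper half-plane, of the function
  \<open>z \<mapsto> f (\<gamma> z) - \<psi> \<gamma> * f z\<close>.
\<close>

definition eis_phi :: "(int \<Rightarrow> complex) \<Rightarrow> (int \<Rightarrow> complex) \<Rightarrow> int^2^2 \<Rightarrow> complex" where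
  "eis_phi \<eta>1 \<eta>2 \<gamma> = (THE w. \<forall>z. Im z > 0 \<longrightarrow>
     eis_f \<eta>1 \<eta>2 (moebius_action \<gamma> z) - psi_char \<eta>1 \<eta>2 \<gamma> * eis_f \<eta>1 \<eta>2 z = w)"

text \<open>
  The modulus \<open>r1\<close> of \<open>\<eta>1\<close>, needed for the Gauss sum, is an explicit argument because it cannot be
  read off from the type of \<open>\<eta>1\<close>.
\<close>

definition dedekind_S ::
  "nat \<Rightarrow> (int \<Rightarrow> complex) \<Rightarrow> (int \<Rightarrow> complex) \<Rightarrow> int^2^2 \<Rightarrow> complex" where
  "dedekind_S r1 \<eta>1 \<eta>2 \<gamma> =
     gauss_sum r1 (conj_char \<eta>1) / (of_real pi * \<i>) * eis_phi \<eta>1 \<eta>2 \<gamma>"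

end

theory Submission
  imports Defs "HOL-Number_Theory.Number_Theory"
begin

text \<open>
  Write \<open>f\<close> for \<open>eis_f \<eta>1 \<eta>2\<close>. Summing the inner series over \<open>k\<close> with the help of the Gauss sum turns it into a multiple of
  \<open>\<Sum>b. \<eta>2 b * cot (pi * (l * z + b / q2))\<close>, and the partial fractions of the cotangent give
  \<open>f z - f z' = const * (z' - z) * \<Sum>(l, m). \<eta>1 l * \<eta>2 m / ((q2 * l * z + m) * (q2 * l * z' + m))\<close>,
  a sum over the lattice \<open>\<int>\<^sup>2\<close>. It converges only conditionally, but as the characters
  sum to zero over a period it can be rearranged into an absolutely convergent one, and is then seen
  to be invariant under unimodular substitutions of \<open>(l, m)\<close>. The substitution coming from
  \<open>\<gamma>\<close> shows that \<open>f (\<gamma> z) - \<psi> \<gamma> * f z\<close> is constant; the one coming from the Fricke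
  involution \<open>W z = -1 / (q1 * q2 * z)\<close> shows that \<open>f (W z)\<close> is, up to an additive constant, a
  multiple of \<open>eis_f \<eta>2 \<eta>1 z\<close>. Letting \<open>z\<close> tend to infinity along the imaginary axis, Abel
  summation identifies that constant, which is zero for even characters and a product of two
  \<open>L\<close>-values for odd ones. Since \<open>\<gamma> \<circ> W = W \<circ> \<gamma>'\<close>, the reciprocity law follows.
\<close>

section \<open>Dirichlet characters and Gauss sums\<close>

text \<open>Differences are expanded because the series for \<open>f z\<close> alone would have
  terms \<open>\<eta>1 l * \<eta>2 m / (l * (q2 * l * z + m))\<close>: the bare \<open>l\<close>
  singles out one coordinate, and a substitution mixing \<open>l\<close> and \<open>m\<close> does
  not respect it. In a difference it cancels against \<open>q2 * l * (z' - z)\<close>, and a product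
  of two linear forms remains. A unimodular substitution gives these forms automorphy factors that
  cancel the ones acquired by \<open>z' - z\<close>, so only character values survive. The price is
  that \<open>f\<close> is known up to a constant; \<open>eis_phi\<close> is such a constant by
  nature, but the one in the Fricke relation must be read off at the cusps. The obstacle is that
  inverse-square decay in dimension two diverges logarithmically. Translation by a fixed vector
  gains one power of the height, which is just enough; therefore each coset of N Z^2, with N = q1
  q2, is compared with N Z^2 itself. Equal parity of the characters makes the rows \<open>l\<close>
  and \<open>- l\<close> equal, so the series over \<open>l \<ge> 1\<close> is half of a sum over
  all integers.\<close>

lemma periodic_mod:
  fixes f :: "int \<Rightarrow> 'a"
  assumes per: "\<And>n. f (n + N) = f n"
  shows "f (n mod N) = f n"
proof -
  have *: "f (m + int k * N) = f m" for m k
  proof (induction k)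
    case (Suc k)
    have "f (m + int (Suc k) * N) = f ((m + int k * N) + N)" by (simp add: algebra_simps)
    also have "\<dots> = f (m + int k * N)" by (rule per)
    finally show ?case using Suc by simp
  qed simp
  show ?thesis
  proof (cases "n div N \<ge> 0")
    case True
    then have "n mod N + int (nat (n div N)) * N = n" by simp
    then show ?thesis using *[of "n mod N" "nat (n div N)"] by simp
  next
    case False
    then have "n + int (nat (- (n div N))) * N = n mod N"
      by (simp add: minus_div_mult_eq_mod[symmetric])
    then show ?thesis using *[of n "nat (- (n div N))"] by simp
  qed
qed

text \<open>An injective self-map of the finite residue system is a permutation, so injectivity of
  \<open>g\<close> modulo \<open>N\<close> suffices. The uses are the shift \<open>b + 1\<close>,
  multiplication by a unit, and \<open>- b\<close>.\<close>

lemma sum_periodic_reindex: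
  fixes f :: "int \<Rightarrow> 'a::comm_monoid_add"
  assumes "N > 0" and per: "\<And>n. f (n mod N) = f n"
    and inj: "\<And>x y. [g x = g y] (mod N) \<Longrightarrow> [x = y] (mod N)"
  shows "(\<Sum>x\<in>{0..<N}. f (g x)) = (\<Sum>x\<in>{0..<N}. f x)"
proof -
  have inj': "inj_on (\<lambda>x. g x mod N) {0..<N}"
  proof (rule inj_onI)
    fix x y assume xy: "x \<in> {0..<N}" "y \<in> {0..<N}" "g x mod N = g y mod N"
    have "[x = y] (mod N)" by (rule inj) (use xy(3) in \<open>simp only: cong_def\<close>)
    then show "x = y" using xy(1,2) cong_less_imp_eq_int[of x N y] by simp
  qed
  have "(\<lambda>x. g x mod N) ` {0..<N} = {0..<N}"
  proof (rule card_subset_eq)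
    show "(\<lambda>x. g x mod N) ` {0..<N} \<subseteq> {0..<N}" using \<open>N > 0\<close> by auto
    show "card ((\<lambda>x. g x mod N) ` {0..<N}) = card {0..<N}" by (rule card_image[OF inj'])
  qed simp
  then have "bij_betw (\<lambda>x. g x mod N) {0..<N} {0..<N}"
    using inj' by (simp add: bij_betw_def)
  from sum.reindex_bij_betw[OF this, of f] show ?thesis by (simp only: per)
qed

section \<open>The exponential and the additive characters modulo q\<close>

lemma e_add: "e (x + y) = e x * e y"
  by (simp add: e_def ring_distribs exp_add)

lemma e_of_int [simp]: "e (of_int k) = 1"
  unfolding e_def using exp_integer_2pi[of "of_int k"] by (simp add: mult_ac)

lemma norm_e: "norm (e z) = exp (- 2 * pi * Im z)"
  by (simp add: e_def)

lemma e_of_nat_mult: "e (of_nat n * z) = e z ^ n"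
proof -
  have "2 * of_real pi * \<i> * (of_nat n * z) = of_nat n * (2 * of_real pi * \<i> * z)" by simp
  then show ?thesis by (simp only: e_def exp_of_nat_mult)
qed

lemma e_eq_1_iff: "e z = 1 \<longleftrightarrow> z \<in> \<int>"
proof
  assume "e z = 1"
  then have "Im z = 0 \<and> (\<exists>n::int. 2 * pi * Re z = real_of_int (2 * n) * pi)"
    by (simp add: e_def exp_eq_1)
  then obtain n :: int where "Im z = 0" "2 * pi * Re z = real_of_int (2 * n) * pi" by blast
  then have "Re z = of_int n" "Im z = 0" by simp_all
  then have "z = of_int n" by (simp add: complex_eq_iff)
  then show "z \<in> \<int>" by simp
qed (auto elim!: Ints_cases)

definition add_char :: "nat \<Rightarrow> int \<Rightarrow> complex" where
  "add_char q k = e (of_int k / of_nat q)"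

lemma add_char_add: "add_char q (j + k) = add_char q j * add_char q k"
  by (simp add: add_char_def add_divide_distrib e_add)

lemma add_char_cong:
  assumes "q > 0" "[j = k] (mod int q)"
  shows "add_char q j = add_char q k"
proof -
  obtain t where "j = k + int q * t"
    using assms(2) by (metis cong_iff_lin cong_sym)
  then show ?thesis
    using \<open>q > 0\<close> by (simp add: add_char_def add_divide_distrib e_add)
qed

text \<open>The shift \<open>b + 1\<close> permutes the residues and multiplies the sum by
  \<open>add_char q k\<close>, which differs from 1 unless \<open>q\<close> divides
  \<open>k\<close>.\<close>

lemma sum_add_char:
  assumes "q > 0"
  shows "(\<Sum>b\<in>{0..<int q}. add_char q (b * k)) = (if int q dvd k then of_nat q else 0)"
proof (cases "int q dvd k")
  case True
  then have "add_char q (b * k) = 1" for b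
    using add_char_cong[OF assms, of "b * k" 0] by (simp add: cong_0_iff add_char_def e_def)
  then show ?thesis using True by simp
next
  case False
  have "of_int k / of_nat q \<notin> (\<int>::complex set)"
  proof
    assume "of_int k / of_nat q \<in> (\<int>::complex set)"
    then obtain t where "of_int k / of_nat q = (of_int t :: complex)" by (auto elim: Ints_cases)
    then have "(of_int k :: complex) = of_int (t * int q)"
      using assms by (simp add: field_simps)
    then show False using False by (simp only: of_int_eq_iff) simp
  qed
  then have ne: "add_char q k \<noteq> 1" by (simp add: add_char_def e_eq_1_iff)
  have "(\<Sum>b\<in>{0..<int q}. add_char q ((b + 1) * k)) = (\<Sum>b\<in>{0..<int q}. add_char q (b * k))"
  proof (rule sum_periodic_reindex[where g = "\<lambda>b. b + 1" and f = "\<lambda>b. add_char q (b * k)"])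
    show "add_char q (n mod int q * k) = add_char q (n * k)" for n
      by (rule add_char_cong) (use assms in \<open>auto simp: cong_def mod_mult_left_eq\<close>)
  qed (use assms cong_add_rcancel in auto)
  then have "add_char q k * (\<Sum>b\<in>{0..<int q}. add_char q (b * k)) = (\<Sum>b\<in>{0..<int q}. add_char q (b * k))"
    by (simp add: ring_distribs add_char_add sum_distrib_left mult_ac)
  then show ?thesis using ne False by simp
qed

section \<open>Elementary properties of Dirichlet characters\<close>

lemma dirichlet_charD:
  assumes "dirichlet_char q \<eta>"
  shows "q > 0" "\<eta> (m * n) = \<eta> m * \<eta> n" "\<eta> (n + int q) = \<eta> n" "\<eta> n \<noteq> 0 \<longleftrightarrow> coprime n (int q)"
  using assms by (auto simp: dirichlet_char_def)

lemma dirichlet_char_mod: "dirichlet_char q \<eta> \<Longrightarrow> \<eta> (n mod int q) = \<eta> n"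
  by (rule periodic_mod) (rule dirichlet_charD(3))

lemma dirichlet_char_cong:
  "dirichlet_char q \<eta> \<Longrightarrow> [m = n] (mod int q) \<Longrightarrow> \<eta> m = \<eta> n"
  by (metis dirichlet_char_mod cong_def)

lemma dirichlet_char_1: assumes "dirichlet_char q \<eta>" shows "\<eta> 1 = 1"
proof -
  have "\<eta> 1 \<noteq> 0" "\<eta> 1 = \<eta> 1 * \<eta> 1"
    using dirichlet_charD(4)[OF assms, of 1] dirichlet_charD(2)[OF assms, of 1 1] by auto
  then show ?thesis by simp
qed

lemma dirichlet_char_0: "dirichlet_char q \<eta> \<Longrightarrow> q > 1 \<Longrightarrow> \<eta> 0 = 0"
  using dirichlet_charD(4)[of q \<eta> 0] by auto

lemma dirichlet_char_power: "dirichlet_char q \<eta> \<Longrightarrow> \<eta> (n ^ k) = \<eta> n ^ k"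
  by (induction k) (auto simp: dirichlet_char_1 dirichlet_charD)

text \<open>Periodicity leaves finitely many values, so all of them are bounded by some
  \<open>B\<close>; a value of norm above 1 would have unbounded powers, which are again
  values.\<close>

lemma dirichlet_char_norm_le_1:
  assumes "dirichlet_char q \<eta>" shows "norm (\<eta> n) \<le> 1"
proof (rule ccontr)
  assume "\<not> norm (\<eta> n) \<le> 1"
  then have gt: "norm (\<eta> n) > 1" by simp
  define B where "B = (\<Sum>b\<in>{0..<int q}. norm (\<eta> b))"
  have "norm (\<eta> m) \<le> B" for m
  proof -
    have "norm (\<eta> (m mod int q)) \<le> B"
      unfolding B_def by (rule member_le_sum) (use dirichlet_charD(1)[OF assms] in auto)
    then show ?thesis by (simp add: dirichlet_char_mod[OF assms])
  qed
  then have "norm (\<eta> n) ^ k \<le> B" for k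
    by (simp flip: dirichlet_char_power[OF assms] norm_power)
  moreover obtain k where "norm (\<eta> n) ^ k > B"
    using real_arch_pow[OF gt] by blast
  ultimately show False by (meson not_less)
qed

lemma dirichlet_char_norm:
  assumes "dirichlet_char q \<eta>" "coprime n (int q)" shows "norm (\<eta> n) = 1"
proof -
  obtain m where "[n * m = 1] (mod int q)"
    using cong_solve_coprime_int[OF assms(2)] by blast
  then have "\<eta> n * \<eta> m = 1"
    using dirichlet_char_cong[OF assms(1)] dirichlet_charD(2)[OF assms(1)] dirichlet_char_1[OF assms(1)]
    by metis
  then have "norm (\<eta> n) * norm (\<eta> m) = 1" by (simp flip: norm_mult)
  moreover have "norm (\<eta> n) * norm (\<eta> m) \<le> norm (\<eta> n)"
    using dirichlet_char_norm_le_1[OF assms(1)] by (simp add: mult_left_le)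
  ultimately show ?thesis
    using dirichlet_char_norm_le_1[OF assms(1), of n] by linarith
qed

text \<open>Values at units lie on the unit circle, where inverse and conjugate coincide. This is
  how conjugate values at the matrix entry \<open>d\<close> become values at the entry
  \<open>a\<close>.\<close>

lemma dirichlet_char_inverse:
  assumes D: "dirichlet_char q \<eta>" and mn: "[m * n = 1] (mod int q)"
  shows "\<eta> m = cnj (\<eta> n)"
proof -
  have "\<eta> (m * n) = \<eta> 1" by (rule dirichlet_char_cong[OF D mn])
  then have 1: "\<eta> m * \<eta> n = 1" by (simp only: dirichlet_charD(2)[OF D] dirichlet_char_1[OF D])
  then have "\<eta> n \<noteq> 0" by auto
  then have "coprime n (int q)" by (simp only: dirichlet_charD(4)[OF D])
  then have "norm (\<eta> n) = 1" by (rule dirichlet_char_norm[OF D])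
  then have n1: "\<eta> n * cnj (\<eta> n) = 1" by (simp add: complex_norm_square[symmetric])
  have "\<eta> m = \<eta> m * (\<eta> n * cnj (\<eta> n))" by (simp only: n1 mult_1_right)
  also have "\<dots> = (\<eta> m * \<eta> n) * cnj (\<eta> n)" by (simp only: mult.assoc)
  also have "\<dots> = cnj (\<eta> n)" by (simp only: 1 mult_1)
  finally show ?thesis .
qed

section \<open>Primitivity and Gauss sums\<close>

lemma coprime_lift:
  fixes n :: int and r q :: nat
  assumes "q > 0" "r dvd q" "coprime n (int r)"
  shows "\<exists>m. coprime m (int q) \<and> [m = n] (mod int r)"
proof -
  \<comment> \<open>The lift is \<open>n + r * t\<close>. A prime divisor \<open>p\<close> of
    \<open>q\<close> that divides \<open>n\<close> divides neither \<open>r\<close> nor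
    \<open>t\<close>; one that does not divide \<open>n\<close> divides \<open>t\<close>. In both
    cases exactly one of the two summands is divisible by \<open>p\<close>.\<close>
  define t where "t = \<Prod>{p. prime p \<and> p dvd q \<and> \<not> int p dvd n}"
  have fin: "finite {p. prime p \<and> p dvd q \<and> \<not> int p dvd n}"
    by (rule finite_subset[OF _ finite_divisors_nat[OF \<open>q > 0\<close>]]) auto
  have dvd_t: "p dvd t \<longleftrightarrow> \<not> int p dvd n" if "prime p" "p dvd q" for p
  proof
    assume "p dvd t"
    then obtain p' where p': "prime p'" "p dvd p'" "\<not> int p' dvd n"
      unfolding t_def prime_dvd_prod_iff[OF fin \<open>prime p\<close>] by blast
    then have "p = p'" using that by (simp add: primes_dvd_imp_eq)
    with p' show "\<not> int p dvd n" by simp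
  next
    assume "\<not> int p dvd n"
    then show "p dvd t" using that unfolding t_def by (intro dvd_prodI fin) auto
  qed
  have "coprime (n + int r * int t) (int q)"
  proof (rule ccontr)
    assume "\<not> ?thesis"
    then have "nat (gcd (n + int r * int t) (int q)) \<noteq> 1"
      by (simp add: coprime_iff_gcd_eq_1 nat_eq_iff)
    then obtain p where "prime p" "p dvd nat (gcd (n + int r * int t) (int q))"
      using prime_factor_nat by blast
    then have p: "prime p" "int p dvd n + int (r * t)" "p dvd q"
      by (auto simp: int_dvd_int_iff[symmetric] simp del: int_dvd_int_iff)
    show False
    proof (cases "int p dvd n")
      case True
      then have "int p dvd int (r * t)" using p(2) by (simp add: dvd_add_right_iff)
      then have "p dvd r * t" by (simp only: int_dvd_int_iff)
      then have "p dvd r"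
        using dvd_t[OF p(1,3)] True p(1) by (simp add: prime_dvd_mult_iff)
      then show False using True assms(3) p(1)
        by (metis coprime_common_divisor int_dvd_int_iff not_prime_unit prime_nat_int_transfer)
    next
      case False
      then have "int p dvd int (r * t)"
        using dvd_t[OF p(1,3)] by (simp only: int_dvd_int_iff) simp
      then show False using False p(2) by (simp add: dvd_add_left_iff)
    qed
  qed
  moreover have "[n + int r * int t = n] (mod int r)" by (simp add: cong_def)
  ultimately show ?thesis by blast
qed

text \<open>If \<open>\<eta>\<close> were trivial on the residues that are 1 modulo \<open>r\<close>, it would descend to modulus \<open>r\<close>.\<close>

lemma primitive_char_nontrivial:
  assumes "primitive_dirichlet_char q \<eta>" "r dvd q" "r < q"
  shows "\<exists>c. coprime c (int q) \<and> [c = 1] (mod int r) \<and> \<eta> c \<noteq> 1"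
proof (rule ccontr)
  assume contra: "\<not> ?thesis"
  have D: "dirichlet_char q \<eta>" and cond: "conductor q \<eta> = q"
    using assms(1) by (auto simp: primitive_dirichlet_char_def)
  have "r > 0" "q > 0" using assms(2) dirichlet_charD(1)[OF D] by (auto intro: Nat.gr0I)
  have eq: "\<eta> m = \<eta> n"
    if m: "coprime m (int q)" and n: "coprime n (int q)" and mn: "[m = n] (mod int r)" for m n
  proof -
    obtain n' where n': "[n * n' = 1] (mod int q)"
      using cong_solve_coprime_int[OF n] by blast
    then have cop: "coprime n' (int q)"
      by (metis coprime_iff_invertible_int mult.commute)
    have "[n * n' = 1] (mod int r)"
      using n' assms(2) by (meson cong_dvd_modulus int_dvd_int_iff)
    moreover have "[m * n' = n * n'] (mod int r)" using mn by (rule cong_scalar_right)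
    ultimately have "[m * n' = 1] (mod int r)" using cong_trans by blast
    moreover have "coprime (m * n') (int q)" using cop m by simp
    ultimately have "\<eta> (m * n') = 1" using contra by blast
    moreover have "\<eta> (n * n') = 1" using dirichlet_char_cong[OF D n'] dirichlet_char_1[OF D] by simp
    moreover have "\<eta> n' \<noteq> 0" using cop dirichlet_charD(4)[OF D] by simp
    ultimately show ?thesis
      using mult_right_cancel[of "\<eta> n'" "\<eta> m" "\<eta> n"] by (simp add: dirichlet_charD(2)[OF D])
  qed
  \<comment> \<open>A chosen unit modulo \<open>q\<close> above each unit modulo \<open>r\<close>.
    By \<open>eq\<close> the value of \<open>\<eta>\<close> is independent of the choice, and this
    makes \<open>\<theta>\<close> multiplicative and periodic.\<close>
  define lft where "lft n = (SOME m. coprime m (int q) \<and> [m = n] (mod int r))" for n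
  have lft: "coprime (lft n) (int q)" "[lft n = n] (mod int r)" if "coprime n (int r)" for n
    unfolding lft_def using someI_ex[OF coprime_lift[OF \<open>q > 0\<close> assms(2) that]] by auto
  define \<theta> where "\<theta> n = (if coprime n (int r) then \<eta> (lft n) else 0)" for n
  have "dirichlet_char r \<theta>"
    unfolding dirichlet_char_def
  proof (intro conjI allI)
    show "\<theta> (m * n) = \<theta> m * \<theta> n" for m n
    proof (cases "coprime m (int r) \<and> coprime n (int r)")
      case True
      then have c: "coprime (m * n) (int r)" by simp
      have "\<eta> (lft (m * n)) = \<eta> (lft m * lft n)"
      proof (rule eq)
        show "[lft (m * n) = lft m * lft n] (mod int r)"
          using lft(2)[OF c] lft(2)[of m] lft(2)[of n] True by (meson cong_mult cong_sym cong_trans)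
      qed (use True lft(1) c in auto)
      then show ?thesis using True c by (simp add: \<theta>_def dirichlet_charD(2)[OF D])
    qed (auto simp: \<theta>_def)
    show "\<theta> (n + int r) = \<theta> n" for n
    proof (cases "coprime n (int r)")
      case True
      have c: "coprime (n + int r) (int r)"
        using True by (simp add: coprime_iff_gcd_eq_1)
      have "\<eta> (lft (n + int r)) = \<eta> (lft n)"
      proof (rule eq)
        have "[n + int r = n] (mod int r)" by (simp add: cong_def)
        then show "[lft (n + int r) = lft n] (mod int r)"
          using lft(2)[OF c] lft(2)[OF True] by (meson cong_sym cong_trans)
      qed (use True lft(1) c in auto)
      then show ?thesis using True c by (simp add: \<theta>_def)
    qed (simp add: \<theta>_def coprime_iff_gcd_eq_1)
    show "\<theta> n \<noteq> 0 \<longleftrightarrow> coprime n (int r)" for n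
      using lft(1)[of n] dirichlet_charD(4)[OF D] by (auto simp: \<theta>_def)
  qed (use \<open>r > 0\<close> in auto)
  moreover have "\<eta> n = \<theta> n" if "coprime n (int q)" for n
  proof -
    have c: "coprime n (int r)" using that assms(2) by (meson coprime_divisors dvd_refl int_dvd_int_iff)
    show ?thesis using eq[OF lft(1)[OF c] that lft(2)[OF c]] c by (simp add: \<theta>_def)
  qed
  ultimately have "conductor q \<eta> \<le> r"
    unfolding conductor_def by (intro Least_le) (use assms(2) in blast)
  then show False using cond assms(3) by simp
qed

lemma gauss_sum_alt: "gauss_sum q \<eta> = (\<Sum>b\<in>{0..<int q}. \<eta> b * add_char q b)"
  unfolding gauss_sum_def
  by (rule sum.reindex_bij_witness[of _ nat int]) (auto simp: add_char_def)

text \<open>For \<open>k\<close> coprime to \<open>q\<close> this is the substitution of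
  \<open>k * b\<close> for \<open>b\<close>. Otherwise both sides vanish, and here primitivity
  enters: with \<open>g = gcd k q\<close> there is a unit \<open>c\<close>, congruent to 1 modulo
  \<open>q / g\<close>, with \<open>\<eta> c \<noteq> 1\<close>. As \<open>c * k\<close> and
  \<open>k\<close> agree modulo \<open>q\<close>, the substitution of \<open>c * b\<close> for
  \<open>b\<close> multiplies the sum by \<open>\<eta> c\<close> without changing it.\<close>

lemma gauss_sum_separable:
  assumes "primitive_dirichlet_char q \<eta>"
  shows "(\<Sum>b\<in>{0..<int q}. \<eta> b * add_char q (b * k)) = cnj (\<eta> k) * gauss_sum q \<eta>"
proof -
  have D: "dirichlet_char q \<eta>" using assms by (auto simp: primitive_dirichlet_char_def)
  note q [simp] = dirichlet_charD(1)[OF D]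
  have mult: "(\<Sum>b\<in>{0..<int q}. f (c * b)) = (\<Sum>b\<in>{0..<int q}. f b)"
    if c: "coprime c (int q)" and f: "\<And>m n. [m = n] (mod int q) \<Longrightarrow> f m = f n"
      for c and f :: "int \<Rightarrow> complex"
  proof (rule sum_periodic_reindex)
    show "f (n mod int q) = f n" for n by (rule f) (simp add: cong_def)
    show "[x = y] (mod int q)" if "[c * x = c * y] (mod int q)" for x y
      using that c by (simp add: cong_mult_lcancel)
  qed simp
  show ?thesis
  proof (cases "coprime k (int q)")
    case True
    then obtain k' where k': "[k * k' = 1] (mod int q)"
      using cong_solve_coprime_int by blast
    have *: "\<eta> k' * \<eta> (k * b) = \<eta> b" for b
    proof -
      have "\<eta> k' * \<eta> (k * b) = \<eta> (k * k') * \<eta> b" by (simp add: dirichlet_charD(2)[OF D])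
      also have "\<eta> (k * k') = 1" using dirichlet_char_cong[OF D k'] dirichlet_char_1[OF D] by simp
      finally show ?thesis by simp
    qed
    have "(\<Sum>b\<in>{0..<int q}. \<eta> b * add_char q (b * k)) =
        \<eta> k' * (\<Sum>b\<in>{0..<int q}. \<eta> (k * b) * add_char q (k * b))"
      by (simp add: sum_distrib_left mult.assoc[symmetric] *) (simp add: mult.commute)
    also have "(\<Sum>b\<in>{0..<int q}. \<eta> (k * b) * add_char q (k * b)) = gauss_sum q \<eta>"
      unfolding gauss_sum_alt
      by (rule mult[where f = "\<lambda>b. \<eta> b * add_char q b", OF True])
         (simp add: add_char_cong[OF q] dirichlet_char_cong[OF D])
    also have "\<eta> k' = cnj (\<eta> k)"
      using dirichlet_char_inverse[OF D, of k' k] k' by (simp add: mult.commute)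
    finally show ?thesis .
  next
    case False
    define r where "r = nat (int q div gcd k (int q))"
    define g where "g = gcd k (int q)"
    have "g > 0" "g \<noteq> 1"
      using False q by (simp_all add: g_def coprime_iff_gcd_eq_1 del: q)
    then have "g > 1" by linarith
    moreover have "g dvd int q" "g dvd k" by (simp_all add: g_def)
    ultimately have g: "g > 1" "g dvd int q" "g dvd k" by blast+
    have r: "int q = g * int r" using g by (simp add: r_def g_def[symmetric] pos_imp_zdiv_nonneg_iff)
    have "r dvd q" using r by (metis dvd_triv_right int_dvd_int_iff)
    moreover have "r < q"
    proof -
      have "int r > 0" using r g dirichlet_charD(1)[OF D] by (cases "r = 0") auto
      then have "int r < int q" unfolding r using g(1) by simp
      then show ?thesis by simp
    qed
    ultimately obtain c where c: "coprime c (int q)" "[c = 1] (mod int r)" "\<eta> c \<noteq> 1"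
      using primitive_char_nontrivial[OF assms] by blast
    have ck: "[c * k = k] (mod int q)"
    proof -
      have "int r dvd c - 1" using c(2) by (simp add: cong_iff_dvd_diff)
      with g(3) have "g * int r dvd k * (c - 1)" by (rule mult_dvd_mono)
      then show ?thesis by (simp add: cong_iff_dvd_diff r algebra_simps)
    qed
    let ?S = "\<Sum>b\<in>{0..<int q}. \<eta> b * add_char q (b * k)"
    have "(\<Sum>b\<in>{0..<int q}. \<eta> (c * b) * add_char q (c * b * k)) = ?S"
      by (rule mult[where f = "\<lambda>b. \<eta> b * add_char q (b * k)", OF c(1)])
         (simp add: add_char_cong[OF q] cong_scalar_right dirichlet_char_cong[OF D])
    moreover have "add_char q (c * b * k) = add_char q (b * k)" for b
    proof (rule add_char_cong[OF q])
      have "[b * (c * k) = b * k] (mod int q)" using ck by (rule cong_scalar_left)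
      then show "[c * b * k = b * k] (mod int q)" by (simp only: mult.left_commute mult.assoc)
    qed
    ultimately have "\<eta> c * ?S = ?S"
      by (simp add: dirichlet_charD(2)[OF D] sum_distrib_left mult_ac)
    then have "?S = 0" using c(3) by simp
    moreover have "\<eta> k = 0" using False dirichlet_charD(4)[OF D] by blast
    ultimately show ?thesis by simp
  qed
qed

text \<open>Separability at \<open>k = 0\<close>, where \<open>\<eta> 0 = 0\<close> because
  \<open>q > 1\<close>.\<close>

lemma sum_primitive_char:
  assumes "primitive_dirichlet_char q \<eta>" "q > 1"
  shows "(\<Sum>b\<in>{0..<int q}. \<eta> b) = 0"
proof -
  have "\<eta> 0 = 0" using assms dirichlet_char_0 by (auto simp: primitive_dirichlet_char_def)
  then show ?thesis
    using gauss_sum_separable[OF assms(1), of 0] by (simp add: add_char_def e_def)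
qed

text \<open>Separability turns the product into a double sum over \<open>b\<close> and
  \<open>k\<close>; the sum over \<open>k\<close> is a full sum of additive characters at
  \<open>b + 1\<close>, so only the residue \<open>b = q - 1\<close> of -1 survives.\<close>

lemma gauss_sum_mult_conj:
  assumes "primitive_dirichlet_char q \<eta>"
  shows "gauss_sum q \<eta> * gauss_sum q (conj_char \<eta>) = \<eta> (-1) * of_nat q"
proof -
  have D: "dirichlet_char q \<eta>" using assms by (auto simp: primitive_dirichlet_char_def)
  have q: "q > 0" by (rule dirichlet_charD(1)[OF D])
  have "gauss_sum q \<eta> * gauss_sum q (conj_char \<eta>) =
      (\<Sum>k\<in>{0..<int q}. (cnj (\<eta> k) * gauss_sum q \<eta>) * add_char q k)"
    unfolding gauss_sum_alt[of q "conj_char \<eta>"] sum_distrib_left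
    by (intro sum.cong refl) (simp add: conj_char_def)
  also have "\<dots> = (\<Sum>k\<in>{0..<int q}. \<Sum>b\<in>{0..<int q}. \<eta> b * add_char q (b * k) * add_char q k)"
    by (simp add: gauss_sum_separable[OF assms, symmetric] sum_distrib_right)
  also have "\<dots> = (\<Sum>b\<in>{0..<int q}. \<Sum>k\<in>{0..<int q}. \<eta> b * add_char q (k * (b + 1)))"
    by (subst sum.swap) (simp add: ring_distribs add_char_add mult_ac)
  also have "\<dots> = (\<Sum>b\<in>{0..<int q}. if b = int q - 1 then \<eta> b * of_nat q else 0)"
  proof (rule sum.cong)
    fix b assume b: "b \<in> {0..<int q}"
    then have "int q dvd b + 1 \<longleftrightarrow> b = int q - 1"
      using zdvd_imp_le[of "int q" "b + 1"] by auto
    then show "(\<Sum>k\<in>{0..<int q}. \<eta> b * add_char q (k * (b + 1))) = (if b = int q - 1 then \<eta> b * of_nat q else 0)"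
      by (simp add: sum_distrib_left[symmetric] sum_add_char[OF q])
  qed auto
  also have "\<dots> = \<eta> (int q - 1) * of_nat q"
    using q by simp
  also have "\<eta> (int q - 1) = \<eta> (-1)"
    by (rule dirichlet_char_cong[OF D]) (simp add: cong_iff_dvd_diff)
  finally show ?thesis .
qed

lemma dirichlet_char_minus_1: assumes "dirichlet_char q \<eta>" shows "\<eta> (-1) * \<eta> (-1) = 1"
  using dirichlet_charD(2)[OF assms, of "-1" "-1"] dirichlet_char_1[OF assms] by simp

lemma gauss_sum_nonzero:
  assumes "primitive_dirichlet_char q \<eta>"
  shows "gauss_sum q \<eta> \<noteq> 0" "gauss_sum q (conj_char \<eta>) \<noteq> 0"
proof -
  have D: "dirichlet_char q \<eta>" using assms by (auto simp: primitive_dirichlet_char_def)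
  have "\<eta> (-1) * of_nat q \<noteq> 0"
    using dirichlet_char_minus_1[OF D] dirichlet_charD(1)[OF D] by auto
  then show "gauss_sum q \<eta> \<noteq> 0" "gauss_sum q (conj_char \<eta>) \<noteq> 0"
    using gauss_sum_mult_conj[OF assms] by auto
qed

section \<open>Twisted lattice sums\<close>

lemma infsum_diff:
  fixes f g :: "'a \<Rightarrow> 'b::{topological_ab_group_add, t2_space}"
  assumes "f summable_on A" "g summable_on A"
  shows "infsum (\<lambda>x. f x - g x) A = infsum f A - infsum g A"
  using infsum_add[of f A "\<lambda>x. - g x"] assms by (simp add: infsum_uminus summable_on_uminus)

lemma summable_on_diff:
  fixes f g :: "'a \<Rightarrow> 'b::topological_ab_group_add"
  assumes "f summable_on A" "g summable_on A"
  shows "(\<lambda>x. f x - g x) summable_on A"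
  using summable_on_add[of f A "\<lambda>x. - g x"] assms by (simp add: summable_on_uminus)

lemma summable_on_compose_inj:
  fixes f :: "'b \<Rightarrow> 'a::{uniform_topological_group_add, topological_comm_monoid_add, ab_group_add, complete_uniform_space}"
  assumes "f summable_on UNIV" "inj g"
  shows "(\<lambda>x. f (g x)) summable_on UNIV"
  using summable_on_subset[OF assms(1), of "range g"] summable_on_reindex[OF assms(2), of f]
  by (simp add: o_def)

lemma summable_on_norm_bound:
  fixes f :: "'a \<Rightarrow> complex"
  assumes "g summable_on A" "\<And>x. x \<in> A \<Longrightarrow> norm (f x) \<le> g x"
  shows "f summable_on A"
  unfolding summable_on_iff_abs_summable_on_complex
  by (rule Infinite_Sum.abs_summable_on_comparison_test'[OF assms])

lemma has_sum_sum:
  fixes f :: "'i \<Rightarrow> 'a \<Rightarrow> 'b::topological_comm_monoid_add"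
  assumes "finite I" "\<And>i. i \<in> I \<Longrightarrow> (f i has_sum s i) A"
  shows "((\<lambda>x. \<Sum>i\<in>I. f i x) has_sum (\<Sum>i\<in>I. s i)) A"
  using assms by (induction I rule: finite_induct) (auto intro!: has_sum_add)

lemma bij_div_mod:
  assumes "N > (0::int)"
  shows "bij_betw (\<lambda>(L, i). N * L + i) (UNIV \<times> {0..<N}) UNIV"
  by (rule bij_betw_byWitness[where f' = "\<lambda>n. (n div N, n mod N)"]) (use assms in auto)

lemma has_sum_blocks:
  fixes f :: "int \<Rightarrow> complex"
  assumes "(f has_sum S) UNIV" "N > 0"
  shows "((\<lambda>L. \<Sum>i\<in>{0..<N}. f (N * L + i)) has_sum S) UNIV"
proof -
  have "((\<lambda>(L, i). f (N * L + i)) has_sum S) (UNIV \<times> {0..<N})"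
    using has_sum_reindex_bij_betw[OF bij_div_mod[OF assms(2)], of f S] assms(1)
    by (simp add: case_prod_unfold)
  then show ?thesis
    by (rule has_sum_Sigma') (auto intro: has_sum_finiteI)
qed

section \<open>Regularised sums over cosets in the integer lattice\<close>

definition scale :: "int \<Rightarrow> int \<times> int \<Rightarrow> int \<times> int" where
  "scale N v = (N * fst v, N * snd v)"

text \<open>
  Kernels that decay like the inverse square of the height are not summable over \<open>\<int>\<^sup>2\<close>; what they
  satisfy is the following.
\<close>

definition tame :: "(int \<times> int \<Rightarrow> complex) \<Rightarrow> bool" where
  "tame h \<longleftrightarrow> (\<forall>w. (\<lambda>v. h (v + w) - h v) summable_on UNIV) \<and>
     (\<forall>m. (\<lambda>l. h (l, m)) summable_on UNIV) \<and> (\<forall>l. (\<lambda>m. h (l, m)) summable_on UNIV)"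

text \<open>Formally the sum of \<open>h\<close> over the coset of \<open>v\<close> modulo
  \<open>N\<close>, minus the sum over the coset of 0. Each of the two may diverge; for a
  \<open>tame\<close> function the termwise difference is absolutely summable.\<close>

definition coset_sum :: "int \<Rightarrow> (int \<times> int \<Rightarrow> complex) \<Rightarrow> int \<times> int \<Rightarrow> complex" where
  "coset_sum N h v = (\<Sum>\<^sub>\<infinity>u\<in>UNIV. h (scale N u + v) - h (scale N u))"

lemma inj_scale: "N \<noteq> 0 \<Longrightarrow> inj (scale N)"
  by (auto simp: inj_def scale_def)

lemma coset_diff_summable:
  assumes "tame h" "N > 0"
  shows "(\<lambda>u. h (scale N u + v) - h (scale N u + w)) summable_on UNIV"
proof -
  have *: "(\<lambda>u. h (scale N u + v) - h (scale N u)) summable_on UNIV" for v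
  proof (rule summable_on_compose_inj[of "\<lambda>x. h (x + v) - h x" "scale N"])
    show "(\<lambda>x. h (x + v) - h x) summable_on UNIV" using assms(1) unfolding tame_def by blast
  qed (use assms in \<open>simp add: inj_scale\<close>)
  show ?thesis using summable_on_diff[OF *[of v] *[of w]] by simp
qed

lemma infsum_shift_diff_int:
  fixes k :: "int \<Rightarrow> complex"
  assumes "k summable_on UNIV"
  shows "(\<Sum>\<^sub>\<infinity>n\<in>UNIV. k (n + 1) - k n) = 0"
proof -
  have bij: "bij (\<lambda>n::int. n + 1)" by (rule bij_plus_right)
  have "(\<Sum>\<^sub>\<infinity>n\<in>UNIV. k (n + 1)) = infsum k UNIV"
    by (rule infsum_reindex_bij_betw[OF bij])
  moreover have "(\<lambda>n. k (n + 1)) summable_on UNIV"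
    using summable_on_reindex_bij_betw[OF bij, of k] assms by simp
  ultimately show ?thesis using assms by (simp add: infsum_diff)
qed

text \<open>
  The difference of the two sides is a sum over \<open>\<int>\<^sup>2\<close> of absolutely summable terms; summed first
  along the direction of the shift, it telescopes.
\<close>

lemma coset_sum_periodic:
  assumes h: "tame h" and N: "N > 0"
  shows "coset_sum N h (l + N, m) = coset_sum N h (l, m)"
    and "coset_sum N h (l, m + N) = coset_sum N h (l, m)"
proof -
  have diff: "coset_sum N h v - coset_sum N h w = (\<Sum>\<^sub>\<infinity>u\<in>UNIV. h (scale N u + v) - h (scale N u + w))" for v w
  proof -
    have s: "(\<lambda>u. h (scale N u + v) - h (scale N u)) summable_on UNIV" for v
      using coset_diff_summable[OF h N, of v 0] by simp
    show ?thesis unfolding coset_sum_def by (subst infsum_diff[OF s s, symmetric]) simp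
  qed
  have sumb: "(\<lambda>u. h (scale N u + v) - h (scale N u + w)) summable_on UNIV \<times> UNIV" for v w
    using coset_diff_summable[OF h N, of v w] by simp
  have row: "(\<lambda>L. h (N * L + l, b)) summable_on UNIV" for b
  proof (rule summable_on_compose_inj[of "\<lambda>x. h (x, b)" "\<lambda>L. N * L + l"])
    show "(\<lambda>x. h (x, b)) summable_on UNIV" using h unfolding tame_def by blast
  qed (use N in \<open>simp add: inj_def\<close>)
  have col: "(\<lambda>M. h (b, N * M + m)) summable_on UNIV" for b
  proof (rule summable_on_compose_inj[of "\<lambda>x. h (b, x)" "\<lambda>M. N * M + m"])
    show "(\<lambda>x. h (b, x)) summable_on UNIV" using h unfolding tame_def by blast
  qed (use N in \<open>simp add: inj_def\<close>)
  have "coset_sum N h (l, m + N) - coset_sum N h (l, m) =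
      (\<Sum>\<^sub>\<infinity>L\<in>UNIV. \<Sum>\<^sub>\<infinity>M\<in>UNIV. h (scale N (L, M) + (l, m + N)) - h (scale N (L, M) + (l, m)))"
    unfolding diff using infsum_Sigma_banach[OF sumb[of "(l, m + N)" "(l, m)"]] by simp
  also have "\<dots> = (\<Sum>\<^sub>\<infinity>L\<in>(UNIV::int set). 0)"
  proof (rule infsum_cong)
    fix L :: int
    show "(\<Sum>\<^sub>\<infinity>M\<in>UNIV. h (scale N (L, M) + (l, m + N)) - h (scale N (L, M) + (l, m))) = 0"
      using infsum_shift_diff_int[OF col[of "N * L + l"]] by (simp add: scale_def algebra_simps)
  qed
  finally show "coset_sum N h (l, m + N) = coset_sum N h (l, m)" by simp
  have sumb': "(\<lambda>(L, M). h (scale N (L, M) + (l + N, m)) - h (scale N (L, M) + (l, m))) summable_on UNIV \<times> UNIV"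
    using sumb[of "(l + N, m)" "(l, m)"] by (simp add: case_prod_unfold)
  have "coset_sum N h (l + N, m) - coset_sum N h (l, m) =
      (\<Sum>\<^sub>\<infinity>L\<in>UNIV. \<Sum>\<^sub>\<infinity>M\<in>UNIV. h (scale N (L, M) + (l + N, m)) - h (scale N (L, M) + (l, m)))"
    unfolding diff using infsum_Sigma_banach[OF sumb[of "(l + N, m)" "(l, m)"]] by simp
  \<comment> \<open>The shift is now in the first coordinate, so the order of summation is exchanged
    before telescoping; absolute summability of the differences permits it.\<close>
  also have "\<dots> = (\<Sum>\<^sub>\<infinity>M\<in>UNIV. \<Sum>\<^sub>\<infinity>L\<in>UNIV. h (scale N (L, M) + (l + N, m)) - h (scale N (L, M) + (l, m)))"
    by (rule infsum_swap_banach[OF sumb'])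
  also have "\<dots> = (\<Sum>\<^sub>\<infinity>M\<in>(UNIV::int set). 0)"
  proof (rule infsum_cong)
    fix M :: int
    show "(\<Sum>\<^sub>\<infinity>L\<in>UNIV. h (scale N (L, M) + (l + N, m)) - h (scale N (L, M) + (l, m))) = 0"
      using infsum_shift_diff_int[OF row[of "N * M + m"]] by (simp add: scale_def algebra_simps)
  qed
  finally show "coset_sum N h (l + N, m) = coset_sum N h (l, m)" by simp
qed

text \<open>
  When \<open>X\<close> is periodic modulo \<open>N\<close> with mean zero, the subtracted terms in \<open>coset_sum\<close> cancel, and
  this is an absolutely convergent rearrangement of the sum of \<open>X v * h v\<close> over \<open>\<int>\<^sup>2\<close>.
\<close>

definition twisted_sum :: "int \<Rightarrow> (int \<times> int \<Rightarrow> complex) \<Rightarrow> (int \<times> int \<Rightarrow> complex) \<Rightarrow> complex" where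
  "twisted_sum N X h = (\<Sum>v\<in>{0..<N} \<times> {0..<N}. X v * coset_sum N h v)"

definition lin2 :: "int \<Rightarrow> int \<Rightarrow> int \<Rightarrow> int \<Rightarrow> int \<times> int \<Rightarrow> int \<times> int" where
  "lin2 a b c d v = (a * fst v + b * snd v, c * fst v + d * snd v)"

lemma lin2_inverse:
  assumes "a * d - b * c = 1"
  shows "lin2 d (-b) (-c) a (lin2 a b c d v) = v"
proof -
  have "d * (a * x + b * y) + (-b) * (c * x + d * y) = (a * d - b * c) * x"
       "(-c) * (a * x + b * y) + a * (c * x + d * y) = (a * d - b * c) * y" for x y
    by (simp_all add: algebra_simps)
  then show ?thesis by (simp add: lin2_def assms)
qed

lemma bij_lin2:
  assumes "a * d - b * c = 1"
  shows "bij (lin2 a b c d)"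
proof (rule bij_betw_byWitness[where f' = "lin2 d (-b) (-c) a"])
  have "d * a - (- b) * (- c) = 1" using assms by (simp add: mult.commute)
  from lin2_inverse[OF this] show "\<forall>v\<in>UNIV. lin2 a b c d (lin2 d (-b) (-c) a v) = v" by simp
qed (use lin2_inverse[OF assms] in auto)

text \<open>A unimodular matrix permutes the pairs of residues: reduction \<open>red\<close> is
  compatible with integral linear maps, so the integral inverse descends to an inverse on
  residues.\<close>

lemma sum_periodic_lin2:
  fixes F :: "int \<times> int \<Rightarrow> 'a::comm_monoid_add"
  assumes det: "a * d - b * c = 1" and N: "N > 0"
    and per: "\<And>l m. F (l + N, m) = F (l, m)" "\<And>l m. F (l, m + N) = F (l, m)"
  shows "(\<Sum>v\<in>{0..<N} \<times> {0..<N}. F (lin2 a b c d v)) = (\<Sum>v\<in>{0..<N} \<times> {0..<N}. F v)"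
proof -
  define red where "red v = (fst v mod N, snd v mod N)" for v :: "int \<times> int"
  have F_red: "F (red v) = F v" for v
    using periodic_mod[of "\<lambda>l. F (l, snd v mod N)" N "fst v"] per(1)
      periodic_mod[of "\<lambda>m. F (fst v, m)" N "snd v"] per(2) by (simp add: red_def)
  have red_lin2: "red (lin2 a' b' c' d' (red v)) = red (lin2 a' b' c' d' v)" for a' b' c' d' v
    by (simp add: red_def lin2_def) (intro conjI mod_add_cong; simp add: mod_mult_right_eq)
  let ?S = "{0..<N} \<times> {0..<N}"
  have red_id: "red v = v" if "v \<in> ?S" for v
    using that by (auto simp: red_def)
  have red_mem: "red v \<in> ?S" for v using N by (auto simp: red_def)
  have "inj_on (\<lambda>v. red (lin2 a b c d v)) ?S"
  proof (rule inj_on_inverseI)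
    fix v assume v: "v \<in> ?S"
    show "red (lin2 d (-b) (-c) a (red (lin2 a b c d v))) = v"
      by (simp only: red_lin2 lin2_inverse[OF det] red_id[OF v])
  qed
  moreover from this have "(\<lambda>v. red (lin2 a b c d v)) ` ?S = ?S"
    by (intro card_subset_eq image_subsetI red_mem) (simp_all add: card_image)
  ultimately have "bij_betw (\<lambda>v. red (lin2 a b c d v)) ?S ?S"
    by (simp only: bij_betw_def)
  from sum.reindex_bij_betw[OF this, of F] show ?thesis by (simp only: F_red)
qed

text \<open>A linear map commutes with \<open>scale N\<close>. A unimodular one therefore preserves
  the reference coset of 0 and carries the coset of \<open>v\<close> to that of its image, so the
  subtracted terms are matched correctly.\<close>

lemma coset_sum_lin2:
  assumes det: "a * d - b * c = 1"
    and h: "\<And>v. h1 v = \<kappa> * h2 (lin2 a b c d v)"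
  shows "coset_sum N h1 v = \<kappa> * coset_sum N h2 (lin2 a b c d v)"
proof -
  let ?T = "lin2 a b c d"
  have T: "?T (scale N u + v) = scale N (?T u) + ?T v" "?T (scale N u) = scale N (?T u)" for u
    by (simp_all add: lin2_def scale_def algebra_simps)
  have "coset_sum N h1 v = (\<Sum>\<^sub>\<infinity>u\<in>UNIV. \<kappa> * (h2 (scale N (?T u) + ?T v) - h2 (scale N (?T u))))"
    by (simp only: coset_sum_def h T right_diff_distrib)
  also have "\<dots> = \<kappa> * (\<Sum>\<^sub>\<infinity>u\<in>UNIV. h2 (scale N (?T u) + ?T v) - h2 (scale N (?T u)))"
    by (rule infsum_cmult_right')
  also have "(\<Sum>\<^sub>\<infinity>u\<in>UNIV. h2 (scale N (?T u) + ?T v) - h2 (scale N (?T u))) =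
      coset_sum N h2 (?T v)"
    unfolding coset_sum_def
    by (rule infsum_reindex_bij_betw[OF bij_lin2[OF det], of "\<lambda>u. h2 (scale N u + ?T v) - h2 (scale N u)"])
  finally show ?thesis .
qed

text \<open>Applied with \<open>\<kappa>\<close> a product of automorphy factors and
  \<open>\<epsilon>\<close> the value of \<open>psi_char\<close> for a matrix of
  \<open>Gamma0\<close>, and with \<open>\<epsilon> = \<eta>1 (-1)\<close> for the Fricke
  involution. Lattice points are permuted inside \<open>coset_sum\<close> and residues outside it;
  the latter relies on the periodicity of \<open>coset_sum\<close>.\<close>

lemma twisted_sum_lin2:
  assumes det: "a * d - b * c = 1" and N: "N > 0" and tame: "tame h2"
    and h: "\<And>v. h1 v = \<kappa> * h2 (lin2 a b c d v)"
    and X: "\<And>v. X1 v = \<epsilon> * X2 (lin2 a b c d v)"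
    and per: "\<And>l m. X2 (l + N, m) = X2 (l, m)" "\<And>l m. X2 (l, m + N) = X2 (l, m)"
  shows "twisted_sum N X1 h1 = \<epsilon> * \<kappa> * twisted_sum N X2 h2"
proof -
  let ?T = "lin2 a b c d"
  have "twisted_sum N X1 h1 =
      (\<Sum>v\<in>{0..<N} \<times> {0..<N}. (\<epsilon> * \<kappa>) * (X2 (?T v) * coset_sum N h2 (?T v)))"
    unfolding twisted_sum_def
    by (intro sum.cong refl) (simp add: X coset_sum_lin2[where ?h1.0 = h1 and ?h2.0 = h2, OF det h])
  also have "\<dots> = \<epsilon> * \<kappa> * (\<Sum>v\<in>{0..<N} \<times> {0..<N}. X2 (?T v) * coset_sum N h2 (?T v))"
    by (rule sum_distrib_left[symmetric])
  also have "(\<Sum>v\<in>{0..<N} \<times> {0..<N}. X2 (?T v) * coset_sum N h2 (?T v)) = twisted_sum N X2 h2"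
    unfolding twisted_sum_def
    by (rule sum_periodic_lin2[OF det N, where F = "\<lambda>v. X2 v * coset_sum N h2 v"])
       (simp_all add: per coset_sum_periodic[OF tame N])
  finally show ?thesis .
qed

text \<open>Connects the rearranged sum with the row-by-row sum in which the Eisenstein function
  appears. In each block of N by N points the mean zero of \<open>\<beta>\<close> removes the
  reference term; the block sums are summable over all blocks and may be summed by rows of blocks.
  Grouping the rows of the iterated sum by blocks keeps its value, once it is known to
  converge.\<close>

lemma twisted_sum_iterated:
  fixes \<alpha> \<beta> :: "int \<Rightarrow> complex"
  assumes tame: "tame h" and N: "N > 0"
    and per: "\<And>n. \<alpha> (n + N) = \<alpha> n" "\<And>n. \<beta> (n + N) = \<beta> n"
    and bound: "\<And>n. norm (\<beta> n) \<le> 1"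
    and zero: "(\<Sum>j\<in>{0..<N}. \<beta> j) = 0"
    and sum: "((\<lambda>l. \<alpha> l * (\<Sum>\<^sub>\<infinity>m\<in>UNIV. \<beta> m * h (l, m))) has_sum S) UNIV"
  shows "twisted_sum N (\<lambda>v. \<alpha> (fst v) * \<beta> (snd v)) h = S"
proof -
  have per': "\<alpha> (N * L + i) = \<alpha> i" "\<beta> (N * L + i) = \<beta> i" for L i
    using periodic_mod[of \<alpha> N "N * L + i"] periodic_mod[of \<alpha> N i]
      periodic_mod[of \<beta> N "N * L + i"] periodic_mod[of \<beta> N i] per by simp_all
  let ?X = "\<lambda>v. \<alpha> (fst v) * \<beta> (snd v)" and ?S = "{0..<N} \<times> {0..<N}"
  define B where "B u = (\<Sum>v\<in>?S. ?X v * h (scale N u + v))" for u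
  have X0: "(\<Sum>v\<in>?S. ?X v) = 0"
    using zero by (simp add: sum.cartesian_product' sum_distrib_left[symmetric])
  have "((\<lambda>u. \<Sum>v\<in>?S. ?X v * (h (scale N u + v) - h (scale N u))) has_sum twisted_sum N ?X h) UNIV"
    unfolding twisted_sum_def
  proof (rule has_sum_sum)
    fix v
    show "((\<lambda>u. ?X v * (h (scale N u + v) - h (scale N u))) has_sum ?X v * coset_sum N h v) UNIV"
      unfolding coset_sum_def
      using coset_diff_summable[OF tame N, of v 0] by (intro has_sum_cmult_right has_sum_infsum) simp
  qed simp
  also have "(\<lambda>u. \<Sum>v\<in>?S. ?X v * (h (scale N u + v) - h (scale N u))) = B"
  proof
    fix u
    have "(\<Sum>v\<in>?S. ?X v * (h (scale N u + v) - h (scale N u))) = B u - (\<Sum>v\<in>?S. ?X v) * h (scale N u)"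
      unfolding B_def sum_distrib_right sum_subtractf[symmetric]
      by (intro sum.cong refl) (rule right_diff_distrib)
    then show "(\<Sum>v\<in>?S. ?X v * (h (scale N u + v) - h (scale N u))) = B u" by (simp only: X0) simp
  qed
  finally have B: "(B has_sum twisted_sum N ?X h) (UNIV \<times> UNIV)" by simp
  have row: "((\<lambda>m. \<beta> m * h (l, m)) has_sum (\<Sum>\<^sub>\<infinity>m\<in>UNIV. \<beta> m * h (l, m))) UNIV" for l
  proof (rule has_sum_infsum, rule summable_on_norm_bound)
    show "(\<lambda>m. norm (h (l, m))) summable_on UNIV"
      using tame by (simp add: tame_def flip: summable_on_iff_abs_summable_on_complex)
    show "norm (\<beta> m * h (l, m)) \<le> norm (h (l, m))" for m
      using mult_right_mono[OF bound[of m] norm_ge_zero[of "h (l, m)"]] by (simp add: norm_mult)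
  qed
  \<comment> \<open>Iterated summation is applied to the block sums \<open>B\<close>: tameness gives
    their absolute summability over the lattice, and does not give that of the single terms.\<close>
  have "((\<lambda>L. \<Sum>i\<in>{0..<N}. \<alpha> (N * L + i) * (\<Sum>\<^sub>\<infinity>m\<in>UNIV. \<beta> m * h (N * L + i, m))) has_sum twisted_sum N ?X h) UNIV"
  proof (rule has_sum_Sigma'[OF B])
    fix L :: int
    have "((\<lambda>M. \<Sum>i\<in>{0..<N}. \<alpha> (N * L + i) * (\<Sum>j\<in>{0..<N}. \<beta> (N * M + j) * h (N * L + i, N * M + j)))
        has_sum (\<Sum>i\<in>{0..<N}. \<alpha> (N * L + i) * (\<Sum>\<^sub>\<infinity>m\<in>UNIV. \<beta> m * h (N * L + i, m)))) UNIV"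
      by (intro has_sum_sum has_sum_cmult_right has_sum_blocks row N) simp
    also have "(\<lambda>M. \<Sum>i\<in>{0..<N}. \<alpha> (N * L + i) * (\<Sum>j\<in>{0..<N}. \<beta> (N * M + j) * h (N * L + i, N * M + j)))
        = (\<lambda>M. B (L, M))"
      by (simp add: B_def per' scale_def sum.cartesian_product' sum_distrib_left mult.assoc)
    finally show "((\<lambda>M. B (L, M)) has_sum (\<Sum>i\<in>{0..<N}. \<alpha> (N * L + i) * (\<Sum>\<^sub>\<infinity>m\<in>UNIV. \<beta> m * h (N * L + i, m)))) UNIV" .
  qed
  moreover have "((\<lambda>L. \<Sum>i\<in>{0..<N}. \<alpha> (N * L + i) * (\<Sum>\<^sub>\<infinity>m\<in>UNIV. \<beta> m * h (N * L + i, m))) has_sum S) UNIV"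
    by (rule has_sum_blocks[OF sum N])
  ultimately show ?thesis by (rule has_sum_unique)
qed

section \<open>Decay of the lattice kernel\<close>

lemma summable_on_int_powr:
  "(\<lambda>l::int. (1 + \<bar>real_of_int l\<bar>) powr (-3/2)) summable_on UNIV" (is "?g summable_on _")
proof -
  have "summable (\<lambda>n::nat. real n powr (-3/2))" by (simp add: summable_real_powr_iff)
  then have "summable (\<lambda>n::nat. real (Suc n) powr (-3/2))" by (subst summable_Suc_iff)
  then have nat: "(\<lambda>n::nat. (1 + real n) powr (-3/2)) summable_on UNIV"
    by (subst summable_on_UNIV_nonneg_real_iff) simp_all
  have "?g summable_on range int"
    by (subst summable_on_reindex) (use nat in \<open>simp_all add: o_def\<close>)
  moreover have "?g summable_on range (\<lambda>n. - int n)"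
    by (subst summable_on_reindex) (use nat in \<open>simp_all add: o_def inj_def\<close>)
  moreover have "range int \<union> range (\<lambda>n. - int n) = (UNIV::int set)"
  proof -
    have "x \<in> range int \<union> range (\<lambda>n. - int n)" for x :: int
      by (cases x rule: int_cases2) auto
    then show ?thesis by blast
  qed
  ultimately show ?thesis using summable_on_union by metis
qed

text \<open>The exponent 3/2 is half of 3: an inverse cube of the height is distributed evenly over
  the two coordinates, and each factor remains summable over the integers.\<close>

lemma summable_on_int_pair_powr:
  "(\<lambda>v::int \<times> int. (1 + \<bar>real_of_int (fst v)\<bar>) powr (-3/2) * (1 + \<bar>real_of_int (snd v)\<bar>) powr (-3/2))
     summable_on UNIV"
proof -
  define g where "g l = (1 + \<bar>real_of_int l\<bar>) powr (-3/2)" for l :: int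
  have g: "(g has_sum infsum g UNIV) UNIV"
    unfolding g_def by (rule has_sum_infsum[OF summable_on_int_powr])
  have "(\<lambda>v. g (fst v) * g (snd v)) summable_on (UNIV \<times> UNIV)"
  proof (rule summable_on_SigmaI[where g = "\<lambda>l. g l * infsum g UNIV"])
    show "((\<lambda>m. g (fst (l, m)) * g (snd (l, m))) has_sum g l * infsum g UNIV) UNIV" for l
      using has_sum_cmult_right[OF g, of "g l"] by simp
    show "(\<lambda>l. g l * infsum g UNIV) summable_on UNIV"
      by (rule summable_on_cmult_left[OF has_sum_imp_summable[OF g]])
  qed (simp add: g_def)
  then show ?thesis by (simp add: g_def)
qed

definition height :: "int \<times> int \<Rightarrow> real" where
  "height v = \<bar>real_of_int (fst v)\<bar> + \<bar>real_of_int (snd v)\<bar>"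

lemma finite_height: "finite {v. height v \<le> R}"
proof (rule finite_subset)
  show "{v. height v \<le> R} \<subseteq> {-\<lceil>R\<rceil>..\<lceil>R\<rceil>} \<times> {-\<lceil>R\<rceil>..\<lceil>R\<rceil>}"
    by (auto simp: height_def) linarith+
qed simp

text \<open>Both \<open>1 + \<bar>l\<bar>\<close> and \<open>1 + \<bar>m\<bar>\<close> are at most
  twice the height, so their product to the power 3/2 is at most the cube of twice the height; this
  is the origin of the 8.\<close>

lemma powr_height_bound:
  assumes "height v \<ge> 1"
  shows "1 / height v ^ 3 \<le>
    8 * ((1 + \<bar>real_of_int (fst v)\<bar>) powr (-3/2) * (1 + \<bar>real_of_int (snd v)\<bar>) powr (-3/2))"
proof -
  let ?r = "height v" and ?x = "1 + \<bar>real_of_int (fst v)\<bar>" and ?y = "1 + \<bar>real_of_int (snd v)\<bar>"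
  have "?x \<le> 2 * ?r" "?y \<le> 2 * ?r" using assms by (auto simp: height_def)
  then have le: "?x * ?y \<le> (2 * ?r) * (2 * ?r)"
    by (intro mult_mono) auto
  have "(2 * ?r) ^ 3 = ((2 * ?r) powr 2) powr (3/2)"
    using assms by (subst powr_powr) (simp add: powr_numeral)
  also have "(2 * ?r) powr 2 = (2 * ?r) * (2 * ?r)"
    using assms by (simp add: powr_numeral power2_eq_square)
  finally have "(2 * ?r) ^ 3 = ((2 * ?r) * (2 * ?r)) powr (3/2)" .
  moreover have "(?x * ?y) powr (3/2) \<le> ((2 * ?r) * (2 * ?r)) powr (3/2)"
    by (rule powr_mono2) (use le in auto)
  ultimately have "(?x * ?y) powr (3/2) \<le> (2 * ?r) ^ 3" by simp
  moreover have "(?x * ?y) powr (3/2) > 0" by auto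
  ultimately have "1 / (2 * ?r) ^ 3 \<le> 1 / (?x * ?y) powr (3/2)"
    by (intro divide_left_mono mult_pos_pos) (use assms in auto)
  also have "\<dots> = ?x powr (-3/2) * ?y powr (-3/2)"
    by (simp add: powr_mult powr_minus_divide)
  finally show ?thesis by (simp add: power_mult_distrib)
qed

definition linear_form :: "complex \<Rightarrow> int \<times> int \<Rightarrow> complex" where
  "linear_form w v = w * of_int (fst v) + of_int (snd v)"

text \<open>At the origin the value is \<open>1 / 0 = 0\<close>.\<close>

definition lattice_kernel :: "complex \<Rightarrow> complex \<Rightarrow> int \<times> int \<Rightarrow> complex" where
  "lattice_kernel w w' v = 1 / (linear_form w v * linear_form w' v)"

lemma linear_form_add: "linear_form w (u + v) = linear_form w u + linear_form w v"
  by (simp add: linear_form_def algebra_simps)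

text \<open>For non-real \<open>w\<close> the imaginary part of the form controls the first
  coordinate, and the second is then recovered by subtraction.\<close>

lemma linear_form_lower:
  assumes "Im w \<noteq> 0"
  shows "\<exists>c>0. \<forall>v. height v \<le> c * norm (linear_form w v)"
proof (intro exI conjI allI)
  let ?c = "1 + (1 + norm w) / \<bar>Im w\<bar>"
  show "?c > 0" by (intro add_pos_nonneg divide_nonneg_nonneg) auto
  show "height v \<le> ?c * norm (linear_form w v)" for v
  proof -
    let ?l = "real_of_int (fst v)" and ?m = "real_of_int (snd v)" and ?f = "linear_form w v"
    have "\<bar>Im w\<bar> * \<bar>?l\<bar> = \<bar>Im ?f\<bar>" by (simp add: linear_form_def abs_mult)
    also have "\<dots> \<le> norm ?f" by (rule abs_Im_le_cmod)
    finally have l: "\<bar>?l\<bar> \<le> norm ?f / \<bar>Im w\<bar>" using assms by (simp add: field_simps)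
    have "(of_int (snd v)::complex) = ?f - w * of_int (fst v)" by (simp add: linear_form_def)
    then have "norm (of_int (snd v)::complex) \<le> norm ?f + norm (w * of_int (fst v))"
      by (simp only: norm_triangle_ineq4)
    then have "\<bar>?m\<bar> \<le> norm ?f + norm w * \<bar>?l\<bar>" by (simp add: norm_mult)
    also have "\<dots> \<le> norm ?f + norm w * (norm ?f / \<bar>Im w\<bar>)"
      using l by (intro add_left_mono mult_left_mono) auto
    finally show ?thesis using l by (simp add: height_def ring_distribs add_divide_distrib)
  qed
qed

lemma linear_form_upper: "norm (linear_form w v) \<le> (1 + norm w) * height v"
proof -
  have "norm (linear_form w v) \<le> norm w * \<bar>real_of_int (fst v)\<bar> + \<bar>real_of_int (snd v)\<bar>"
    unfolding linear_form_def by (rule order_trans[OF norm_triangle_ineq]) (simp add: norm_mult)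
  also have "\<dots> \<le> (1 + norm w) * \<bar>real_of_int (fst v)\<bar> + (1 + norm w) * \<bar>real_of_int (snd v)\<bar>"
    by (intro add_mono) (simp_all add: distrib_right)
  finally show ?thesis by (simp add: height_def distrib_left)
qed

lemma height_add: "height (u + v) \<ge> height u - height v"
  by (simp add: height_def)

text \<open>Over the common denominator, of order \<open>r ^ 4\<close>, the leading terms cancel and
  the numerator \<open>x * s' + s * x' + s * s'\<close> has order \<open>r * D\<close>, so one power
  of \<open>r\<close> is gained. The 12 is 3 * 4: three numerator terms, each at most
  \<open>B * r * D\<close>, and a factor 2 lost in each of the two shifted forms.\<close>

lemma inverse_product_diff_bound:
  fixes x x' s s' :: complex
  assumes r: "r > 0" and c: "c > 0"
    and x: "r \<le> c * norm x" "r \<le> c * norm x'" "r \<le> 2 * c * norm (x + s)" "r \<le> 2 * c * norm (x' + s')"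
    and up: "norm x \<le> B * r" "norm x' \<le> B * r" and s: "norm s \<le> D" "norm s' \<le> D" "D \<le> B * r"
  shows "norm (1 / ((x + s) * (x' + s')) - 1 / (x * x')) \<le> 12 * c ^ 4 * B * D / r ^ 3"
proof -
  let ?d = "(x + s) * (x' + s') * (x * x')"
  have D: "D \<ge> 0" using s(1) norm_ge_zero order_trans by blast
  have nz: "x \<noteq> 0" "x' \<noteq> 0" "x + s \<noteq> 0" "x' + s' \<noteq> 0"
    using x r by (metis mult_zero_right norm_zero not_le)+
  have lower: "(r / (2 * c)) * (r / (2 * c)) * ((r / c) * (r / c)) \<le> norm ?d"
  proof -
    have l: "r / c \<le> norm x" "r / c \<le> norm x'" "r / (2 * c) \<le> norm (x + s)" "r / (2 * c) \<le> norm (x' + s')"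
      using x c by (simp_all add: pos_divide_le_eq mult.commute)
    have "r / c \<ge> 0" "r / (2 * c) \<ge> 0" using r c by simp_all
    then show ?thesis unfolding norm_mult
      by (intro mult_mono l mult_nonneg_nonneg norm_ge_zero)
  qed
  have "norm (x * s' + s * x' + s * s') \<le> norm x * norm s' + norm s * norm x' + norm s * norm s'"
    by (rule order_trans[OF norm_triangle_ineq]) (intro add_mono order_trans[OF norm_triangle_ineq], simp_all add: norm_mult)
  also have "\<dots> \<le> (B * r) * D + D * (B * r) + D * (B * r)"
    by (intro add_mono mult_mono) (use up s D in auto)
  finally have upper: "norm (x * s' + s * x' + s * s') \<le> 3 * B * r * D" by (simp add: mult_ac)
  have "1 / ((x + s) * (x' + s')) - 1 / (x * x') = - (x * s' + s * x' + s * s') / ?d"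
    using nz by (simp add: divide_simps) (simp add: algebra_simps)
  then have "norm (1 / ((x + s) * (x' + s')) - 1 / (x * x')) = norm (x * s' + s * x' + s * s') / norm ?d"
    by (simp only: norm_divide norm_minus_cancel)
  also have "\<dots> \<le> (3 * B * r * D) / ((r / (2 * c)) * (r / (2 * c)) * ((r / c) * (r / c)))"
    by (rule frac_le) (use upper lower r c order_trans[OF norm_ge_zero upper] in auto)
  also have "\<dots> = 12 * c ^ 4 * B * D / r ^ 3"
    using r c by (simp add: field_simps power4_eq_xxxx power3_eq_cube)
  finally show ?thesis .
qed

text \<open>Off a finite ball a shift turns inverse-square decay into inverse-cube decay, which is
  summable in the plane. On a horizontal or vertical line the inverse square is summable by
  itself.\<close>

lemma tame_lattice_kernel:
  assumes "Im w \<noteq> 0" "Im w' \<noteq> 0"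
  shows "tame (lattice_kernel w w')"
proof -
  obtain c1 where c1: "c1 > 0" "\<And>v. height v \<le> c1 * norm (linear_form w v)"
    using linear_form_lower[OF assms(1)] by blast
  obtain c2 where c2: "c2 > 0" "\<And>v. height v \<le> c2 * norm (linear_form w' v)"
    using linear_form_lower[OF assms(2)] by blast
  define c where "c = max c1 c2"
  have c: "c > 0" "\<And>v. height v \<le> c * norm (linear_form w v)" "\<And>v. height v \<le> c * norm (linear_form w' v)"
  proof -
    have le: "c1 \<le> c" "c2 \<le> c" by (simp_all add: c_def)
    then show "c > 0" using c1(1) by linarith
    show "height v \<le> c * norm (linear_form w v)" for v
      by (rule order_trans[OF c1(2) mult_right_mono[OF le(1) norm_ge_zero]])
    show "height v \<le> c * norm (linear_form w' v)" for v
      by (rule order_trans[OF c2(2) mult_right_mono[OF le(2) norm_ge_zero]])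
  qed
  define B where "B = 1 + norm w + norm w'"
  have B: "B \<ge> 1" "norm (linear_form w v) \<le> B * height v" "norm (linear_form w' v) \<le> B * height v" for v
  proof -
    have le: "1 + norm w \<le> B" "1 + norm w' \<le> B" by (simp_all add: B_def)
    have height: "height v \<ge> 0" by (simp add: height_def)
    show "B \<ge> 1" by (simp add: B_def)
    show "norm (linear_form w v) \<le> B * height v"
      by (rule order_trans[OF linear_form_upper mult_right_mono[OF le(1) height]])
    show "norm (linear_form w' v) \<le> B * height v"
      by (rule order_trans[OF linear_form_upper mult_right_mono[OF le(2) height]])
  qed
  let ?h = "lattice_kernel w w'"
  have shift: "(\<lambda>v. ?h (v + s) - ?h v) summable_on UNIV" for s
  proof -
    \<comment> \<open>Beyond twice the height of \<open>s\<close>, translation by \<open>s\<close>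
      at most halves the height; the additional 1 secures height at least 1 for
      \<open>powr_height_bound\<close>.\<close>
    define R where "R = 2 * height s + 1"
    let ?G = "\<lambda>v::int \<times> int. (1 + \<bar>real_of_int (fst v)\<bar>) powr (-3/2) * (1 + \<bar>real_of_int (snd v)\<bar>) powr (-3/2)"
    define K where "K = 12 * c ^ 4 * B * (B * height s)"
    have K: "K \<ge> 0" using c B by (auto simp: K_def height_def)
    have "(\<lambda>v. ?h (v + s) - ?h v) summable_on (- {v. height v \<le> R})"
    proof (rule summable_on_norm_bound)
      show "(\<lambda>v. (K * 8) * ?G v) summable_on (- {v. height v \<le> R})"
        by (rule summable_on_subset[OF summable_on_cmult_right[OF summable_on_int_pair_powr]]) simp
      fix v assume "v \<in> - {v. height v \<le> R}"
      then have r: "height v > R" by simp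
      have s0: "height s \<ge> 0" by (simp add: height_def)
      have half: "height v \<le> 2 * height (v + s)"
        using height_add[of v s] r s0 by (simp add: R_def)
      have "norm (?h (v + s) - ?h v) \<le> K / height v ^ 3"
        unfolding lattice_kernel_def linear_form_add K_def
      proof (rule inverse_product_diff_bound)
        show "height v \<le> 2 * c * norm (linear_form w v + linear_form w s)"
          using half c(2)[of "v + s"] by (simp add: linear_form_add)
        show "height v \<le> 2 * c * norm (linear_form w' v + linear_form w' s)"
          using half c(3)[of "v + s"] by (simp add: linear_form_add)
        show "B * height s \<le> B * height v" using B r s0 by (intro mult_left_mono) (auto simp: R_def)
      qed (use c B r s0 in \<open>auto simp: R_def\<close>)
      also have "\<dots> = K * (1 / height v ^ 3)" by simp
      also have "\<dots> \<le> K * (8 * ?G v)"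
        using r s0 by (intro mult_left_mono K powr_height_bound) (simp add: R_def)
      finally show "norm (?h (v + s) - ?h v) \<le> (K * 8) * ?G v" by (simp add: mult.assoc)
    qed
    then have "(\<lambda>v. ?h (v + s) - ?h v) summable_on (- {v. height v \<le> R} \<union> {v. height v \<le> R})"
      by (rule summable_on_union) (intro summable_on_finite finite_height)
    then show ?thesis by simp
  qed
  have line: "(\<lambda>n. ?h (u n)) summable_on UNIV" if u: "\<And>n. height (u n) \<ge> \<bar>real_of_int n\<bar>" for u
  proof (rule summable_on_norm_bound)
    let ?g = "\<lambda>l::int. (1 + \<bar>real_of_int l\<bar>) powr (-3/2)"
    \<comment> \<open>The first summand serves \<open>n \<noteq> 0\<close>, with 4 coming from
      \<open>1 + \<bar>n\<bar> \<le> 2 * \<bar>n\<bar>\<close>; the second covers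
      \<open>n = 0\<close>, where \<open>u 0\<close> may be the origin.\<close>
    define K where "K = 4 * c ^ 2 + norm (?h (u 0))"
    have K: "K \<ge> 0" "K \<ge> 4 * c ^ 2" "K \<ge> norm (?h (u 0))" by (simp_all add: K_def)
    show "(\<lambda>n. K * ?g n) summable_on UNIV" by (rule summable_on_cmult_right[OF summable_on_int_powr])
    show "norm (?h (u n)) \<le> K * ?g n" for n
    proof (cases "n = 0")
      case True
      then show ?thesis using K by simp
    next
      case False
      let ?n = "\<bar>real_of_int n\<bar>"
      have n: "?n \<ge> 1" using False by linarith
      have le: "?n / c \<le> norm (linear_form w (u n))" "?n / c \<le> norm (linear_form w' (u n))"
        using order_trans[OF u c(2)] order_trans[OF u c(3)] c(1) by (simp_all add: field_simps)
      have "norm (?h (u n)) = 1 / (norm (linear_form w (u n)) * norm (linear_form w' (u n)))"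
        by (simp add: lattice_kernel_def norm_divide norm_mult)
      also have "\<dots> \<le> 1 / ((?n / c) * (?n / c))"
      proof (intro divide_left_mono mult_mono mult_pos_pos le)
        show pos: "?n / c > 0" "?n / c > 0" using n c by simp_all
        show "norm (linear_form w (u n)) > 0" "norm (linear_form w' (u n)) > 0"
          using order.strict_trans2[OF pos(1) le(1)] order.strict_trans2[OF pos(1) le(2)] .
      qed (use n c in auto)
      also have "\<dots> = c ^ 2 * (1 / ?n ^ 2)" using c n by (simp add: power2_eq_square)
      also have "\<dots> \<le> c ^ 2 * (4 * ?g n)"
      proof (intro mult_left_mono)
        have "1 / (2 * ?n) ^ 2 \<le> 1 / (1 + ?n) ^ 2"
          using n by (intro divide_left_mono power_mono mult_pos_pos) auto
        also have "\<dots> = (1 + ?n) powr (-2)" by (simp add: powr_minus_divide powr_numeral)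
        also have "\<dots> \<le> ?g n" by (intro powr_mono) auto
        finally show "1 / ?n ^ 2 \<le> 4 * ?g n" by (simp add: power_mult_distrib)
      qed simp
      also have "\<dots> \<le> K * ?g n" using K by (simp add: mult_right_mono flip: mult.assoc)
      finally show ?thesis .
    qed
  qed
  show ?thesis unfolding tame_def
    by (intro conjI allI shift line) (auto simp: height_def)
qed

section \<open>Cotangent sums and the Eisenstein function\<close>

lemma sum_blocks:
  fixes f :: "int \<Rightarrow> 'a::comm_monoid_add"
  assumes q: "q > 0"
  shows "(\<Sum>n\<in>{A..<B}. \<Sum>b\<in>{0..<q}. f (q * n + b)) = (\<Sum>m\<in>{q * A..<q * B}. f m)"
proof -
  have "(\<Sum>n\<in>{A..<B}. \<Sum>b\<in>{0..<q}. f (q * n + b)) = (\<Sum>(n, b)\<in>{A..<B} \<times> {0..<q}. f (q * n + b))"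
    by (rule sum.cartesian_product)
  also have "\<dots> = (\<Sum>m\<in>{q * A..<q * B}. f m)"
  proof (rule sum.reindex_bij_witness[of _ "\<lambda>m. (m div q, m mod q)" "\<lambda>(n, b). q * n + b"])
    fix m assume m: "m \<in> {q * A..<q * B}"
    have "q * A div q \<le> m div q" by (rule zdiv_mono1) (use m q in auto)
    then have "A \<le> m div q" using q by simp
    moreover have "m div q < B"
    proof (rule ccontr)
      assume "\<not> m div q < B"
      then have "q * B \<le> q * (m div q)" using q by simp
      moreover have "q * (m div q) + m mod q = m" by (rule mult_div_mod_eq)
      moreover have "m mod q \<ge> 0" using q by simp
      ultimately show False using m unfolding atLeastLessThan_iff by linarith
    qed
    ultimately show "(m div q, m mod q) \<in> {A..<B} \<times> {0..<q}" using q by simp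
  next
    fix x assume x: "x \<in> {A..<B} \<times> {0..<q}"
    obtain n b where nb: "x = (n, b)" "A \<le> n" "n + 1 \<le> B" "0 \<le> b" "b < q" using x by auto
    have "q * A \<le> q * n" by (rule mult_left_mono) (use nb q in auto)
    moreover have "q * (n + 1) \<le> q * B" by (rule mult_left_mono) (use nb q in auto)
    then have "q * n + q \<le> q * B" by (simp add: distrib_left)
    ultimately have "q * A \<le> q * n + b" "q * n + b < q * B" using nb by linarith+
    then show "(case x of (n, b) \<Rightarrow> q * n + b) \<in> {q * A..<q * B}" by (simp add: nb)
  qed (use q in auto)
  finally show ?thesis .
qed

text \<open>The logarithmic derivative of the reflection formula, by which
  \<open>rGamma z * rGamma (1 - z)\<close> equals \<open>sin (pi * z) / pi\<close>.\<close>

lemma Digamma_reflection: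
  fixes z :: complex
  assumes "z \<notin> \<int>"
  shows "Digamma (1 - z) - Digamma z = of_real pi * cot (of_real pi * z)"
proof -
  have nz: "z \<notin> \<int>\<^sub>\<le>\<^sub>0" "1 - z \<notin> \<int>\<^sub>\<le>\<^sub>0"
    using assms nonpos_Ints_subset_Ints Ints_diff[of 1 "1 - z"] by auto
  have "((\<lambda>z. rGamma z * rGamma (1 - z)) has_field_derivative
      (- rGamma z * Digamma z) * rGamma (1 - z) + (- rGamma (1 - z) * Digamma (1 - z) * (0 - 1)) * rGamma z) (at z)"
    by (rule DERIV_mult[OF has_field_derivative_rGamma_no_nonpos_int[OF nz(1)]
          DERIV_chain'[OF DERIV_diff[OF DERIV_const DERIV_ident] has_field_derivative_rGamma_no_nonpos_int[OF nz(2)]]])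
  moreover have "((\<lambda>z. rGamma z * rGamma (1 - z)) has_field_derivative cos (of_real pi * z)) (at z)"
    unfolding rGamma_reflection_complex by (auto intro!: derivative_eq_intros)
  ultimately have "(- rGamma z * Digamma z) * rGamma (1 - z) + (- rGamma (1 - z) * Digamma (1 - z) * (0 - 1)) * rGamma z
      = cos (of_real pi * z)"
    by (rule DERIV_unique)
  then have "(rGamma z * rGamma (1 - z)) * (Digamma (1 - z) - Digamma z) = cos (of_real pi * z)"
    by (simp add: algebra_simps)
  then have eq: "sin (of_real pi * z) / of_real pi * (Digamma (1 - z) - Digamma z) = cos (of_real pi * z)"
    by (simp only: rGamma_reflection_complex)
  have "rGamma z \<noteq> 0" "rGamma (1 - z) \<noteq> 0" using nz by (simp_all add: rGamma_eq_zero_iff)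
  then have "sin (of_real pi * z) \<noteq> 0" using rGamma_reflection_complex[of z] by auto
  then show ?thesis using eq by (simp add: cot_def field_simps)
qed

text \<open>In the difference of the limit formulas for the two \<open>Digamma\<close> values the
  logarithms cancel. The term of index \<open>n\<close> at \<open>1 - z\<close> belongs to the
  integer \<open>- n - 1\<close>, hence the half-open window from \<open>- M\<close> to
  \<open>M - 1\<close>.\<close>

lemma cot_partial_fractions:
  fixes z :: complex
  assumes "z \<notin> \<int>"
  shows "(\<lambda>M. \<Sum>n\<in>{-int M..<int M}. 1 / (z + of_int n)) \<longlonglongrightarrow> of_real pi * cot (of_real pi * z)"
proof -
  have nz: "z \<noteq> 0" "1 - z \<noteq> 0" using assms by auto
  have "(\<lambda>M. (of_real (ln (real M)) - (\<Sum>n<M. inverse (1 - z + of_nat n)))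
      - (of_real (ln (real M)) - (\<Sum>n<M. inverse (z + of_nat n)))) \<longlonglongrightarrow> Digamma (1 - z) - Digamma z"
    by (intro tendsto_diff Digamma_LIMSEQ nz)
  also have "(\<lambda>M. (of_real (ln (real M)) - (\<Sum>n<M. inverse (1 - z + of_nat n)))
      - (of_real (ln (real M)) - (\<Sum>n<M. inverse (z + of_nat n)))) =
      (\<lambda>M. \<Sum>n\<in>{-int M..<int M}. 1 / (z + of_int n))"
  proof
    fix M :: nat
    have "(\<Sum>n\<in>{-int M..<int M}. 1 / (z + of_int n)) =
        (\<Sum>n\<in>{0..<int M}. 1 / (z + of_int n)) + (\<Sum>n\<in>{-int M..<0}. 1 / (z + of_int n))"
      by (subst sum.union_disjoint[symmetric]) (auto intro!: sum.cong)
    also have "(\<Sum>n\<in>{0..<int M}. 1 / (z + of_int n)) = (\<Sum>n<M. inverse (z + of_nat n))"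
      by (rule sum.reindex_bij_witness[of _ int nat]) (auto simp: inverse_eq_divide)
    also have "(\<Sum>n\<in>{-int M..<0}. 1 / (z + of_int n)) = (\<Sum>n<M. - inverse (1 - z + of_nat n))"
    proof (rule sum.reindex_bij_witness[of _ "\<lambda>n. - int n - 1" "\<lambda>n. nat (- n - 1)"])
      fix n assume n: "n \<in> {-int M..<0}"
      have "1 - z + of_nat (nat (- n - 1)) = - (z + of_int n)"
        using n by (simp add: of_nat_nat)
      then show "- inverse (1 - z + of_nat (nat (- n - 1))) = 1 / (z + of_int n)"
        by (simp only: inverse_minus_eq minus_minus inverse_eq_divide divide_minus_right)
    qed auto
    finally show "(of_real (ln (real M)) - (\<Sum>n<M. inverse (1 - z + of_nat n)))
      - (of_real (ln (real M)) - (\<Sum>n<M. inverse (z + of_nat n))) =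
      (\<Sum>n\<in>{-int M..<int M}. 1 / (z + of_int n))"
      by (simp add: sum_negf)
  qed
  finally show ?thesis by (simp only: Digamma_reflection[OF assms])
qed

text \<open>
  At \<open>w = 0\<close> the term \<open>b = 0\<close> contains the junk value \<open>cot 0 = 0\<close>, but its coefficient \<open>\<eta> 0\<close>
  vanishes as soon as \<open>q > 1\<close>.
\<close>

definition char_cot :: "nat \<Rightarrow> (int \<Rightarrow> complex) \<Rightarrow> complex \<Rightarrow> complex" where
  "char_cot q \<eta> w = (\<Sum>b\<in>{0..<int q}. \<eta> b * cot (of_real pi * (w + of_int b / of_nat q)))"

text \<open>Split \<open>m = q * n + b\<close>. Poles are excluded only at residues with
  \<open>\<eta> b \<noteq> 0\<close>, so that the formula also applies at \<open>w = 0\<close>,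
  where it yields a value of the L-function.\<close>

lemma char_cot_partial_fractions:
  assumes D: "dirichlet_char q \<eta>"
    and w: "\<And>b. b \<in> {0..<int q} \<Longrightarrow> \<eta> b \<noteq> 0 \<Longrightarrow> w + of_int b / of_nat q \<notin> \<int>"
  shows "(\<lambda>M. \<Sum>m\<in>{int q * (-int M)..<int q * int M}. \<eta> m * (1 / (of_nat q * w + of_int m)))
    \<longlonglongrightarrow> of_real pi / of_nat q * char_cot q \<eta> w"
proof -
  have q: "q > 0" by (rule dirichlet_charD(1)[OF D])
  have "(\<lambda>M. \<Sum>b\<in>{0..<int q}. \<eta> b / of_nat q * (\<Sum>n\<in>{-int M..<int M}. 1 / ((w + of_int b / of_nat q) + of_int n)))
      \<longlonglongrightarrow> (\<Sum>b\<in>{0..<int q}. \<eta> b / of_nat q * (of_real pi * cot (of_real pi * (w + of_int b / of_nat q))))"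
  proof (rule tendsto_sum)
    fix b assume b: "b \<in> {0..<int q}"
    show "(\<lambda>M. \<eta> b / of_nat q * (\<Sum>n\<in>{-int M..<int M}. 1 / ((w + of_int b / of_nat q) + of_int n)))
      \<longlonglongrightarrow> \<eta> b / of_nat q * (of_real pi * cot (of_real pi * (w + of_int b / of_nat q)))"
    proof (cases "\<eta> b = 0")
      case False
      then show ?thesis by (intro tendsto_mult_left cot_partial_fractions w b)
    qed simp
  qed
  also have "(\<Sum>b\<in>{0..<int q}. \<eta> b / of_nat q * (of_real pi * cot (of_real pi * (w + of_int b / of_nat q)))) =
      of_real pi / of_nat q * char_cot q \<eta> w"
    unfolding char_cot_def sum_distrib_left by (intro sum.cong refl) simp
  also have "(\<lambda>M. \<Sum>b\<in>{0..<int q}. \<eta> b / of_nat q * (\<Sum>n\<in>{-int M..<int M}. 1 / ((w + of_int b / of_nat q) + of_int n))) =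
      (\<lambda>M. \<Sum>m\<in>{int q * (-int M)..<int q * int M}. \<eta> m * (1 / (of_nat q * w + of_int m)))"
  proof
    fix M :: nat
    have summand: "\<eta> (int q * n + b) * (1 / (of_nat q * w + of_int (int q * n + b))) =
        \<eta> b / of_nat q * (1 / ((w + of_int b / of_nat q) + of_int n))" for n b
    proof -
      have "\<eta> (int q * n + b) = \<eta> b" by (rule dirichlet_char_cong[OF D]) (simp add: cong_def)
      moreover have "of_nat q * w + of_int (int q * n + b) = of_nat q * ((w + of_int b / of_nat q) + of_int n)"
        using q by (simp add: field_simps)
      ultimately show ?thesis by simp
    qed
    have "(\<Sum>m\<in>{int q * (-int M)..<int q * int M}. \<eta> m * (1 / (of_nat q * w + of_int m))) =
      (\<Sum>n\<in>{-int M..<int M}. \<Sum>b\<in>{0..<int q}. \<eta> b / of_nat q * (1 / ((w + of_int b / of_nat q) + of_int n)))"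
      using sum_blocks[of "int q" "\<lambda>m. \<eta> m * (1 / (of_nat q * w + of_int m))" "-int M" "int M"] q
      by (simp only: summand)
    then show "(\<Sum>b\<in>{0..<int q}. \<eta> b / of_nat q * (\<Sum>n\<in>{-int M..<int M}. 1 / ((w + of_int b / of_nat q) + of_int n))) =
      (\<Sum>m\<in>{int q * (-int M)..<int q * int M}. \<eta> m * (1 / (of_nat q * w + of_int m)))"
      by (simp only: sum_distrib_left) (rule sum.swap)
  qed
  finally show ?thesis .
qed

text \<open>The windows eventually contain every finite set of integers, so the limit over finite
  subsets can be computed along them.\<close>

lemma infsum_int_eq_limit:
  fixes f :: "int \<Rightarrow> complex"
  assumes f: "f summable_on UNIV" and q: "q > (0::nat)"
    and lim: "(\<lambda>M. \<Sum>m\<in>{int q * (-int M)..<int q * int M}. f m) \<longlonglongrightarrow> S"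
  shows "infsum f UNIV = S"
proof -
  have "filterlim (\<lambda>M. {int q * (-int M)..<int q * int M}) (finite_subsets_at_top UNIV) sequentially"
    unfolding filterlim_finite_subsets_at_top
  proof (intro allI impI)
    fix X :: "int set" assume X: "finite X \<and> X \<subseteq> UNIV"
    define B where "B = (\<Sum>x\<in>X. \<bar>x\<bar>) + 1"
    have B: "\<bar>x\<bar> < B" if "x \<in> X" for x
      using member_le_sum[OF that, of abs] X by (simp add: B_def)
    show "\<forall>\<^sub>F M in sequentially. finite {int q * (-int M)..<int q * int M} \<and>
        X \<subseteq> {int q * (-int M)..<int q * int M} \<and> {int q * (-int M)..<int q * int M} \<subseteq> UNIV"
      using eventually_ge_at_top[of "nat B"]
    proof eventually_elim
      case (elim M)
      have "1 * int M \<le> int q * int M" by (rule mult_right_mono) (use q in auto)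
      with elim have "B \<le> int q * int M" by simp
      moreover have "int q * (-int M) = - (int q * int M)" by simp
      ultimately have "x \<in> {int q * (-int M)..<int q * int M}" if "x \<in> X" for x
        using B[OF that] by auto
      then show ?case by auto
    qed
  qed
  from filterlim_compose[OF infsum_tendsto[OF f] this] lim show ?thesis
    by (rule LIMSEQ_unique)
qed

lemma not_Ints_of_Im: "Im w \<noteq> 0 \<Longrightarrow> w \<notin> \<int>"
  by (auto elim!: Ints_cases)

text \<open>With \<open>x = q * l * z + m\<close> and \<open>x'\<close> likewise,
  \<open>1 / (x * x')\<close> is \<open>(1 / x - 1 / x') / (x' - x)\<close>, where
  \<open>x' - x = q * l * (z' - z)\<close> does not involve \<open>m\<close>. The row is absolutely
  summable, so the two parts may be evaluated along symmetric windows. The second factor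
  \<open>q\<close> comes from the partial fractions of \<open>char_cot\<close>.\<close>

lemma char_kernel_row:
  assumes D: "dirichlet_char q \<eta>" and z: "Im z > 0" "Im z' > 0" "z \<noteq> z'" and l: "l \<noteq> 0"
  shows "(\<Sum>\<^sub>\<infinity>m\<in>UNIV. \<eta> m * lattice_kernel (of_nat q * z) (of_nat q * z') (l, m)) =
    of_real pi / (of_nat q ^ 2 * of_int l * (z' - z)) *
    (char_cot q \<eta> (of_int l * z) - char_cot q \<eta> (of_int l * z'))"
proof (rule infsum_int_eq_limit)
  show q: "q > 0" by (rule dirichlet_charD(1)[OF D])
  let ?h = "lattice_kernel (of_nat q * z) (of_nat q * z')"
  have "tame ?h" by (rule tame_lattice_kernel) (use q z in auto)
  then have row: "(\<lambda>m. ?h (l, m)) summable_on UNIV" unfolding tame_def by blast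
  show "(\<lambda>m. \<eta> m * ?h (l, m)) summable_on UNIV"
  proof (rule summable_on_norm_bound)
    show "(\<lambda>m. norm (?h (l, m))) summable_on UNIV"
      using row by (simp add: summable_on_iff_abs_summable_on_complex)
    show "norm (\<eta> m * ?h (l, m)) \<le> norm (?h (l, m))" for m
      using mult_right_mono[OF dirichlet_char_norm_le_1[OF D, of m] norm_ge_zero[of "?h (l, m)"]]
      by (simp add: norm_mult)
  qed
  have nonint: "of_int l * y + of_int b / of_nat q \<notin> \<int>" if "Im y > 0" for y b
  proof (rule not_Ints_of_Im)
    have "Im (of_int l * y + of_int b / of_nat q) = of_int l * Im y"
      by (simp add: Im_divide_of_nat)
    then show "Im (of_int l * y + of_int b / of_nat q) \<noteq> 0" using l that by simp
  qed
  let ?K = "1 / (of_nat q * of_int l * (z' - z))"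
  have K: "?h (l, m) = ?K * (1 / (of_nat q * (of_int l * z) + of_int m) - 1 / (of_nat q * (of_int l * z') + of_int m))" for m
  proof -
    have nz: "of_nat q * (of_int l * y) + of_int m \<noteq> 0" if "Im y > 0" for y
    proof
      assume "of_nat q * (of_int l * y) + of_int m = 0"
      then have "Im (of_nat q * (of_int l * y) + of_int m) = 0" by simp
      then show False using q l that by simp
    qed
    have "?h (l, m) = 1 / ((of_nat q * (of_int l * z) + of_int m) * (of_nat q * (of_int l * z') + of_int m))"
      by (simp add: lattice_kernel_def linear_form_def mult_ac)
    also have "\<dots> = ?K * (1 / (of_nat q * (of_int l * z) + of_int m) - 1 / (of_nat q * (of_int l * z') + of_int m))"
    proof -
      define x x' where "x = of_nat q * (of_int l * z) + of_int m" and "x' = of_nat q * (of_int l * z') + of_int m"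
      have "x' - x = of_nat q * of_int l * (z' - z)" by (simp add: x_def x'_def algebra_simps)
      moreover have "x' - x \<noteq> 0" using calculation q l z by simp
      moreover have "x \<noteq> 0" "x' \<noteq> 0" unfolding x_def x'_def by (rule nz[OF z(1)], rule nz[OF z(2)])
      ultimately show ?thesis unfolding x_def[symmetric] x'_def[symmetric]
        by (simp add: divide_simps)
    qed
    finally show ?thesis .
  qed
  have "(\<lambda>M. ?K * ((\<Sum>m\<in>{int q * (-int M)..<int q * int M}. \<eta> m * (1 / (of_nat q * (of_int l * z) + of_int m)))
      - (\<Sum>m\<in>{int q * (-int M)..<int q * int M}. \<eta> m * (1 / (of_nat q * (of_int l * z') + of_int m)))))
    \<longlonglongrightarrow> ?K * (of_real pi / of_nat q * char_cot q \<eta> (of_int l * z) - of_real pi / of_nat q * char_cot q \<eta> (of_int l * z'))"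
    by (intro tendsto_mult_left tendsto_diff char_cot_partial_fractions[OF D] nonint z)
  also have "?K * (of_real pi / of_nat q * char_cot q \<eta> (of_int l * z) - of_real pi / of_nat q * char_cot q \<eta> (of_int l * z')) =
     of_real pi / (of_nat q ^ 2 * of_int l * (z' - z)) * (char_cot q \<eta> (of_int l * z) - char_cot q \<eta> (of_int l * z'))"
  proof -
    have "?K * (of_real pi / of_nat q * x) = of_real pi / (of_nat q ^ 2 * of_int l * (z' - z)) * x" for x
      by (simp add: power2_eq_square mult_ac)
    then show ?thesis by (simp only: right_diff_distrib[symmetric])
  qed
  also have "(\<lambda>M. ?K * ((\<Sum>m\<in>{int q * (-int M)..<int q * int M}. \<eta> m * (1 / (of_nat q * (of_int l * z) + of_int m)))
      - (\<Sum>m\<in>{int q * (-int M)..<int q * int M}. \<eta> m * (1 / (of_nat q * (of_int l * z') + of_int m))))) =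
     (\<lambda>M. \<Sum>m\<in>{int q * (-int M)..<int q * int M}. \<eta> m * ?h (l, m))"
  proof
    fix M :: nat
    have "\<eta> m * ?h (l, m) = ?K * (\<eta> m * (1 / (of_nat q * (of_int l * z) + of_int m)) -
        \<eta> m * (1 / (of_nat q * (of_int l * z') + of_int m)))" for m
      by (simp only: K right_diff_distrib mult.left_commute)
    then show "?K * ((\<Sum>m\<in>{int q * (-int M)..<int q * int M}. \<eta> m * (1 / (of_nat q * (of_int l * z) + of_int m)))
      - (\<Sum>m\<in>{int q * (-int M)..<int q * int M}. \<eta> m * (1 / (of_nat q * (of_int l * z') + of_int m)))) =
      (\<Sum>m\<in>{int q * (-int M)..<int q * int M}. \<eta> m * ?h (l, m))"
      by (simp only: sum_subtractf[symmetric] sum_distrib_left)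
  qed
  finally show "(\<lambda>M. \<Sum>m\<in>{int q * (-int M)..<int q * int M}. \<eta> m * ?h (l, m)) \<longlonglongrightarrow>
    of_real pi / (of_nat q ^ 2 * of_int l * (z' - z)) * (char_cot q \<eta> (of_int l * z) - char_cot q \<eta> (of_int l * z'))" .
qed

section \<open>The double series as a series of cotangent sums\<close>

lemma has_sum_diff:
  fixes f g :: "'a \<Rightarrow> 'b::topological_ab_group_add"
  assumes "(f has_sum a) A" "(g has_sum b) A"
  shows "((\<lambda>x. f x - g x) has_sum (a - b)) A"
proof -
  have "((\<lambda>x. - g x) has_sum - b) A" using assms(2) by (simp add: has_sum_uminus)
  from has_sum_add[OF assms(1) this] show ?thesis by simp
qed

text \<open>Both sides are rational functions of \<open>X = exp (\<i> * pi * u)\<close>. The left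
  one is the value of the geometric series in \<open>e u\<close> when that converges.\<close>

lemma e_ratio_eq_cot:
  assumes "e u \<noteq> 1"
  shows "e u / (1 - e u) = \<i> / 2 * cot (of_real pi * u) - 1 / 2"
proof -
  define X where "X = exp (\<i> * (of_real pi * u))"
  have X: "X \<noteq> 0" "e u = X * X"
    by (simp_all add: X_def e_def mult_exp_exp mult_ac)
  have c: "cos (of_real pi * u) = (X + 1 / X) / 2"
    and s: "sin (of_real pi * u) = (X - 1 / X) / (2 * \<i>)"
    by (simp_all add: X_def cos_exp_eq sin_exp_eq exp_minus inverse_eq_divide)
  have "X * X - 1 \<noteq> 0" "1 - X * X \<noteq> 0" using assms X by auto
  then show ?thesis using X(1)
    unfolding cot_def c s X(2) by (simp add: field_simps)
qed

text \<open>The constants 1/2 of the individual cotangents cancel because the character has mean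
  zero. Residues with \<open>\<eta> b = 0\<close> carry no condition, which admits
  \<open>w = 0\<close>.\<close>

lemma char_cot_eq_sum_ratio:
  assumes P: "primitive_dirichlet_char q \<eta>" and q: "q > 1"
    and ne: "\<And>b. b \<in> {0..<int q} \<Longrightarrow> \<eta> b \<noteq> 0 \<Longrightarrow> e (w + of_int b / of_nat q) \<noteq> 1"
  shows "\<i> / (2 * \<tau>) * char_cot q \<eta> w =
    (\<Sum>b\<in>{0..<int q}. \<eta> b / \<tau> * (e (w + of_int b / of_nat q) / (1 - e (w + of_int b / of_nat q))))"
proof -
  let ?u = "\<lambda>b::int. w + of_int b / of_nat q"
  have "(\<Sum>b\<in>{0..<int q}. \<eta> b / \<tau> * (e (?u b) / (1 - e (?u b)))) =
      (\<Sum>b\<in>{0..<int q}. \<i> / (2 * \<tau>) * (\<eta> b * cot (of_real pi * ?u b)) - \<eta> b * (1 / (2 * \<tau>)))"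
  proof (rule sum.cong)
    fix b assume b: "b \<in> {0..<int q}"
    show "\<eta> b / \<tau> * (e (?u b) / (1 - e (?u b))) =
        \<i> / (2 * \<tau>) * (\<eta> b * cot (of_real pi * ?u b)) - \<eta> b * (1 / (2 * \<tau>))"
    proof (cases "\<eta> b = 0")
      case False
      show ?thesis unfolding e_ratio_eq_cot[OF ne[OF b False]]
        by (simp add: right_diff_distrib mult_ac)
    qed simp
  qed simp
  also have "\<dots> = \<i> / (2 * \<tau>) * char_cot q \<eta> w - (\<Sum>b\<in>{0..<int q}. \<eta> b) * (1 / (2 * \<tau>))"
    by (simp only: sum_subtractf char_cot_def sum_distrib_left sum_distrib_right)
  also have "\<dots> = \<i> / (2 * \<tau>) * char_cot q \<eta> w"
    by (simp only: sum_primitive_char[OF P q]) simp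
  finally show ?thesis by simp
qed

text \<open>Separability writes the conjugate character as a combination of additive characters, so
  the series becomes finitely many geometric series in \<open>e (w + b / q)\<close>, of modulus
  below 1.\<close>

lemma char_series_has_sum:
  assumes P: "primitive_dirichlet_char q \<eta>" and q: "q > 1" and w: "Im w > 0"
  shows "((\<lambda>k. cnj (\<eta> (int k)) * e (of_nat k * w)) has_sum
    \<i> / (2 * gauss_sum q \<eta>) * char_cot q \<eta> w) {1..}"
proof -
  let ?\<tau> = "gauss_sum q \<eta>" and ?u = "\<lambda>b. w + of_int b / of_nat q"
  have \<tau>: "?\<tau> \<noteq> 0" by (rule gauss_sum_nonzero(1)[OF P])
  have norm: "norm (e (?u b)) < 1" for b :: int
    using w by (simp add: norm_e Im_divide_of_nat)
  have ne: "e (?u b) \<noteq> 1" for b :: int using norm[of b] by auto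
  have "((\<lambda>k. \<Sum>b\<in>{0..<int q}. \<eta> b / ?\<tau> * e (?u b) ^ k) has_sum
      (\<Sum>b\<in>{0..<int q}. \<eta> b / ?\<tau> * (e (?u b) / (1 - e (?u b))))) {1..}"
    by (intro has_sum_sum has_sum_cmult_right has_sum_geometric_from_1 norm) simp
  also have "(\<Sum>b\<in>{0..<int q}. \<eta> b / ?\<tau> * (e (?u b) / (1 - e (?u b)))) = \<i> / (2 * ?\<tau>) * char_cot q \<eta> w"
    by (rule char_cot_eq_sum_ratio[symmetric, OF P q ne])
  also have "(\<lambda>k. \<Sum>b\<in>{0..<int q}. \<eta> b / ?\<tau> * e (?u b) ^ k) = (\<lambda>k. cnj (\<eta> (int k)) * e (of_nat k * w))"
  proof
    fix k :: nat
    have pow: "e (?u b) ^ k = add_char q (b * int k) * e (of_nat k * w)" for b :: int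
      unfolding e_of_nat_mult[symmetric] add_char_def e_add[symmetric]
      by (simp add: distrib_left mult_ac add_ac)
    have "cnj (\<eta> (int k)) = (\<Sum>b\<in>{0..<int q}. \<eta> b * add_char q (b * int k)) / ?\<tau>"
      using gauss_sum_separable[OF P, of "int k"] \<tau> by simp
    then show "(\<Sum>b\<in>{0..<int q}. \<eta> b / ?\<tau> * e (?u b) ^ k) = cnj (\<eta> (int k)) * e (of_nat k * w)"
      by (simp add: pow sum_divide_distrib sum_distrib_left mult_ac)
  qed
  finally show ?thesis .
qed

text \<open>From \<open>(k - 1) * (l - 1) \<ge> 0\<close> follows
  \<open>k * l + 1 \<ge> k + l\<close>, whence a product of two geometric series, divided by
  \<open>x\<close>, is a majorant.\<close>

lemma summable_on_power_mult:
  assumes x: "0 < x" "x < (1::real)"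
  shows "(\<lambda>(k, l). x ^ (k * l)) summable_on ({1::nat..} \<times> {1::nat..})"
proof (rule summable_on_comparison_test)
  have geo: "((\<lambda>n. x ^ n) has_sum (x / (1 - x))) {1..}"
    by (rule has_sum_geometric_from_1) (use x in simp)
  have "(\<lambda>v. x ^ fst v * x ^ snd v) summable_on ({1::nat..} \<times> {1::nat..})"
  proof (rule summable_on_SigmaI[where g = "\<lambda>k. x ^ k * (x / (1 - x))"])
    show "((\<lambda>l. x ^ fst (k, l) * x ^ snd (k, l)) has_sum x ^ k * (x / (1 - x))) {1..}" for k
      using has_sum_cmult_right[OF geo, of "x ^ k"] by simp
    show "(\<lambda>k. x ^ k * (x / (1 - x))) summable_on {1..}"
      by (rule summable_on_cmult_left[OF has_sum_imp_summable[OF geo]])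
  qed (use x in simp)
  then show "(\<lambda>v. x ^ fst v * x ^ snd v * (1 / x)) summable_on ({1::nat..} \<times> {1::nat..})"
    by (rule summable_on_cmult_left)
  fix v assume v: "v \<in> {1::nat..} \<times> {1::nat..}"
  obtain k l where kl: "v = (Suc k, Suc l)"
    using v by (metis SigmaE atLeast_iff One_nat_def Suc_le_D)
  have "x ^ (Suc k * Suc l + 1) \<le> x ^ (Suc k + Suc l)"
    by (rule power_decreasing) (use x in auto)
  then have "x ^ (Suc k * Suc l) * x \<le> x ^ Suc k * x ^ Suc l"
    by (simp only: power_add power_one_right)
  then show "(case v of (k, l) \<Rightarrow> x ^ (k * l)) \<le> x ^ fst v * x ^ snd v * (1 / x)"
    using x(1) by (simp only: kl fst_conv snd_conv prod.case pos_le_divide_eq mult_1_right times_divide_eq_right)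
  show "0 \<le> (case v of (k, l) \<Rightarrow> x ^ (k * l))" using x by (simp add: case_prod_unfold)
qed

text \<open>\<open>eis_f\<close> has the sum over \<open>l\<close> inside. Absolute convergence
  allows the exchange, and the sum over \<open>k\<close> is then the character series at
  \<open>l * z\<close>.\<close>

lemma eis_f_has_sum:
  assumes D: "dirichlet_char r \<eta>1" and P: "primitive_dirichlet_char q \<eta>2" and q: "q > 1" and z: "Im z > 0"
  shows "((\<lambda>l. \<eta>1 (int l) / of_nat l * (\<i> / (2 * gauss_sum q \<eta>2) * char_cot q \<eta>2 (of_nat l * z)))
    has_sum eis_f \<eta>1 \<eta>2 z) {1..}"
proof -
  have D2: "dirichlet_char q \<eta>2" using P by (simp add: primitive_dirichlet_char_def)
  define F where "F k l = \<eta>1 (int l) * conj_char \<eta>2 (int k) / of_nat l * e (of_nat k * of_nat l * z)" for k l :: nat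
  have x: "0 < norm (e z)" "norm (e z) < 1" using z by (simp_all add: norm_e)
  have "(\<lambda>(k, l). F k l) summable_on ({1..} \<times> {1..})"
  proof (rule summable_on_norm_bound[OF summable_on_power_mult[OF x]])
    fix v assume v: "v \<in> {1::nat..} \<times> {1::nat..}"
    obtain k l where kl: "v = (k, l)" "l \<ge> 1" using v by auto
    have "norm (\<eta>1 (int l)) * norm (\<eta>2 (int k)) / real l \<le> 1 * 1 / 1"
      by (intro frac_le mult_mono dirichlet_char_norm_le_1[OF D] dirichlet_char_norm_le_1[OF D2])
         (use kl in auto)
    moreover have "norm (e (of_nat k * of_nat l * z)) = norm (e z) ^ (k * l)"
      using e_of_nat_mult[of "k * l" z] by (simp add: norm_power)
    moreover have "norm (F k l) = norm (\<eta>1 (int l)) * norm (\<eta>2 (int k)) / real l * norm (e (of_nat k * of_nat l * z))"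
      by (simp add: F_def conj_char_def norm_mult norm_divide)
    ultimately have "norm (F k l) \<le> 1 * norm (e z) ^ (k * l)"
      by (simp only: mult_right_mono zero_le_power norm_ge_zero div_by_1 mult_1_right)
    then show "norm (case v of (k, l) \<Rightarrow> F k l) \<le> (case v of (k, l) \<Rightarrow> norm (e z) ^ (k * l))"
      by (simp add: kl)
  qed
  then have "((\<lambda>(k, l). F k l) has_sum eis_f \<eta>1 \<eta>2 z) ({1..} \<times> {1..})"
    unfolding eis_f_def F_def[symmetric] by (simp add: infsum_Sigma'_banach)
  from iffD1[OF has_sum_swap this]
  have swapped: "((\<lambda>(l, k). F k l) has_sum eis_f \<eta>1 \<eta>2 z) ({1..} \<times> {1..})" by simp
  show ?thesis
  proof (rule has_sum_Sigma'[OF swapped])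
    fix l :: nat assume l: "l \<in> {1..}"
    have "((\<lambda>k. \<eta>1 (int l) / of_nat l * (cnj (\<eta>2 (int k)) * e (of_nat k * (of_nat l * z)))) has_sum
       \<eta>1 (int l) / of_nat l * (\<i> / (2 * gauss_sum q \<eta>2) * char_cot q \<eta>2 (of_nat l * z))) {1..}"
      by (intro has_sum_cmult_right char_series_has_sum[OF P q]) (use z l in simp)
    then show "((\<lambda>k. case (l, k) of (l, k) \<Rightarrow> F k l) has_sum
       \<eta>1 (int l) / of_nat l * (\<i> / (2 * gauss_sum q \<eta>2) * char_cot q \<eta>2 (of_nat l * z))) {1..}"
      by (simp add: F_def conj_char_def mult_ac)
  qed
qed

lemma has_sum_int_even:
  fixes G :: "int \<Rightarrow> 'a::real_normed_algebra_1"
  assumes G: "((\<lambda>n. G (int n)) has_sum s) {1..}" and "G 0 = 0" and even: "\<And>n. G (- n) = G n"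
  shows "(G has_sum 2 * s) UNIV"
proof -
  have pos: "(G has_sum s) {1..}"
    using G by (subst has_sum_reindex_bij_witness[of "{1..}" int nat "{1::nat..}" "\<lambda>n. G (int n)" G s s]) auto
  have neg: "(G has_sum s) {..-1}"
    using pos by (subst has_sum_reindex_bij_witness[of "{..-1}" uminus uminus "{1..}" G G s s]) (auto simp: even)
  have "(G has_sum s + s) ({1..} \<union> {..-1})"
    by (rule has_sum_Un_disjoint[OF pos neg]) auto
  then have "(G has_sum G 0 + (s + s)) (insert 0 ({1..} \<union> {..-1}))"
    by (intro has_sum_insert) auto
  moreover have "insert 0 ({1..} \<union> {..-1}) = (UNIV :: int set)" by auto
  ultimately show ?thesis using assms(2) by (simp add: mult_2)
qed

text \<open>The cotangent is odd and the summand is periodic in \<open>b\<close>, so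
  \<open>b\<close> may be replaced by \<open>- b\<close>. Thus the cotangent sum of an even
  character is odd in \<open>w\<close>, and that of an odd one is even.\<close>

lemma char_cot_uminus:
  assumes D: "dirichlet_char q \<eta>"
  shows "char_cot q \<eta> (- w) = - \<eta> (-1) * char_cot q \<eta> w"
proof -
  have q: "q > 0" by (rule dirichlet_charD(1)[OF D])
  let ?F = "\<lambda>b::int. \<eta> b * cot (of_real pi * (- w + of_int b / of_nat q))"
  have cot_per: "cot (of_real pi * (u + 1)) = cot (of_real pi * u)" for u :: complex
    by (simp add: cot_def distrib_left sin_add cos_add)
  have per: "?F (n + int q) = ?F n" for n
  proof -
    have "- w + of_int (n + int q) / of_nat q = (- w + of_int n / of_nat q) + 1"
      using q by (simp add: field_simps)
    then show ?thesis by (simp only: cot_per dirichlet_charD(3)[OF D])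
  qed
  have "char_cot q \<eta> (- w) = (\<Sum>b\<in>{0..<int q}. ?F b)" by (simp only: char_cot_def)
  also have "\<dots> = (\<Sum>b\<in>{0..<int q}. ?F (- b))"
  proof (rule sum_periodic_reindex[symmetric])
    show "?F (n mod int q) = ?F n" for n by (rule periodic_mod[where f = ?F, OF per])
    show "[x = y] (mod int q)" if "[- x = - y] (mod int q)" for x y
      using that by (simp add: cong_minus_minus_iff)
  qed (use q in simp)
  also have "\<dots> = (\<Sum>b\<in>{0..<int q}. - \<eta> (-1) * (\<eta> b * cot (of_real pi * (w + of_int b / of_nat q))))"
  proof (rule sum.cong)
    fix b :: int
    have "of_real pi * (- w + of_int (- b) / of_nat q) = - (of_real pi * (w + of_int b / of_nat q))"
      by (simp add: algebra_simps)
    then have "cot (of_real pi * (- w + of_int (- b) / of_nat q)) = - cot (of_real pi * (w + of_int b / of_nat q))"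
      by (simp only: cot_def sin_minus cos_minus divide_minus_right)
    moreover have "\<eta> (- b) = \<eta> (-1) * \<eta> b" using dirichlet_charD(2)[OF D, of "-1" b] by simp
    ultimately show "?F (- b) = - \<eta> (-1) * (\<eta> b * cot (of_real pi * (w + of_int b / of_nat q)))"
      by simp
  qed simp
  also have "\<dots> = - \<eta> (-1) * char_cot q \<eta> w" by (simp only: char_cot_def sum_distrib_left)
  finally show ?thesis .
qed

lemma dirichlet_char_periodic_multiple:
  assumes "dirichlet_char q \<eta>" "int q dvd N"
  shows "\<eta> (n + N) = \<eta> n"
  by (rule dirichlet_char_cong[OF assms(1)]) (use assms(2) in \<open>simp add: cong_iff_dvd_diff\<close>)

lemma sum_primitive_char_multiple:
  assumes P: "primitive_dirichlet_char q \<eta>" and q: "q > 1"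
  shows "(\<Sum>b\<in>{0..<int q * k}. \<eta> b) = 0"
proof -
  have D: "dirichlet_char q \<eta>" using P by (simp add: primitive_dirichlet_char_def)
  have "\<eta> (int q * n + b) = \<eta> b" for n b
    by (rule dirichlet_char_cong[OF D]) (simp add: cong_def)
  then show ?thesis
    using sum_blocks[of "int q" \<eta> 0 k] sum_primitive_char[OF P q] q by simp
qed

text \<open>Row \<open>l\<close> of the lattice sum is a constant times the difference of the terms
  of index \<open>l\<close> in the two cotangent series; rows \<open>l\<close> and
  \<open>- l\<close> agree by parity, and row 0 vanishes since \<open>\<eta>1 0 = 0\<close>. The
  modulus \<open>q1 * q2\<close> is a common period of both characters.\<close>

lemma eis_f_diff:
  assumes P1: "primitive_dirichlet_char q1 \<eta>1" and P2: "primitive_dirichlet_char q2 \<eta>2"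
    and q: "q1 > 1" "q2 > 1" and par: "\<eta>1 (-1) * \<eta>2 (-1) = 1"
    and z: "Im z > 0" "Im z' > 0"
  shows "eis_f \<eta>1 \<eta>2 z - eis_f \<eta>1 \<eta>2 z' =
    \<i> * of_nat q2 ^ 2 / (4 * of_real pi * gauss_sum q2 \<eta>2) * (z' - z) *
    twisted_sum (int q1 * int q2) (\<lambda>v. \<eta>1 (fst v) * \<eta>2 (snd v)) (lattice_kernel (of_nat q2 * z) (of_nat q2 * z'))"
proof (cases "z = z'")
  case False
  have D1: "dirichlet_char q1 \<eta>1" and D2: "dirichlet_char q2 \<eta>2"
    using P1 P2 by (simp_all add: primitive_dirichlet_char_def)
  let ?h = "lattice_kernel (of_nat q2 * z) (of_nat q2 * z')" and ?\<tau> = "gauss_sum q2 \<eta>2"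
  \<comment> \<open>Chosen so that \<open>K * c\<close>, with \<open>c\<close> the constant of
    \<open>eis_f_has_sum\<close>, is the constant of \<open>char_kernel_row\<close> without its
    \<open>1 / l\<close>. The factor in the claim is \<open>1 / (2 * K)\<close>, the 2 accounting
    for both signs of \<open>l\<close>.\<close>
  define K where "K = 2 * of_real pi * ?\<tau> / (\<i> * of_nat q2 ^ 2 * (z' - z))"
  have \<tau>: "?\<tau> \<noteq> 0" by (rule gauss_sum_nonzero(1)[OF P2])
  define c where "c = \<i> / (2 * ?\<tau>)"
  define G where "G l = \<eta>1 l * (\<Sum>\<^sub>\<infinity>m\<in>UNIV. \<eta>2 m * ?h (l, m))" for l
  have G: "G l = K * (\<eta>1 l / of_int l * (c * char_cot q2 \<eta>2 (of_int l * z)) -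
      \<eta>1 l / of_int l * (c * char_cot q2 \<eta>2 (of_int l * z')))" if "l \<noteq> 0" for l
  proof -
    have Kc: "K * c = of_real pi / (of_nat q2 ^ 2 * (z' - z))"
      using \<tau> q False by (simp add: K_def c_def field_simps)
    have "G l = of_real pi / (of_nat q2 ^ 2 * (z' - z)) * (\<eta>1 l / of_int l *
        (char_cot q2 \<eta>2 (of_int l * z) - char_cot q2 \<eta>2 (of_int l * z')))"
      unfolding G_def char_kernel_row[OF D2 z False that] by (simp add: mult_ac)
    then show ?thesis unfolding Kc[symmetric] by (simp only: right_diff_distrib mult_ac)
  qed
  have "(G has_sum 2 * (K * (eis_f \<eta>1 \<eta>2 z - eis_f \<eta>1 \<eta>2 z'))) UNIV"
  proof (rule has_sum_int_even)
    have "((\<lambda>l. K * (\<eta>1 (int l) / of_nat l * (c * char_cot q2 \<eta>2 (of_nat l * z)) -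
        \<eta>1 (int l) / of_nat l * (c * char_cot q2 \<eta>2 (of_nat l * z')))) has_sum
        K * (eis_f \<eta>1 \<eta>2 z - eis_f \<eta>1 \<eta>2 z')) {1..}"
      unfolding c_def
      by (intro has_sum_cmult_right has_sum_diff eis_f_has_sum[OF D1 P2 q(2)] z)
    also have "?this \<longleftrightarrow> ((\<lambda>n. G (int n)) has_sum K * (eis_f \<eta>1 \<eta>2 z - eis_f \<eta>1 \<eta>2 z')) {1..}"
      by (rule has_sum_cong) (simp add: G)
    finally show "((\<lambda>n. G (int n)) has_sum K * (eis_f \<eta>1 \<eta>2 z - eis_f \<eta>1 \<eta>2 z')) {1..}" .
    show "G 0 = 0" using dirichlet_char_0[OF D1 q(1)] by (simp add: G_def)
    show "G (- l) = G l" for l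
    proof (cases "l = 0")
      case l: False
      have flip: "\<eta>1 (- l) / of_int (- l) * (c * char_cot q2 \<eta>2 (of_int (- l) * y)) =
          \<eta>1 l / of_int l * (c * char_cot q2 \<eta>2 (of_int l * y))" for y
      proof -
        have "\<eta>1 (- l) = \<eta>1 (-1) * \<eta>1 l" using dirichlet_charD(2)[OF D1, of "-1" l] by simp
        moreover have "char_cot q2 \<eta>2 (of_int (- l) * y) = - \<eta>2 (-1) * char_cot q2 \<eta>2 (of_int l * y)"
          using char_cot_uminus[OF D2, of "of_int l * y"] by simp
        ultimately have "\<eta>1 (- l) / of_int (- l) * (c * char_cot q2 \<eta>2 (of_int (- l) * y)) =
            (\<eta>1 (-1) * \<eta>2 (-1)) * (\<eta>1 l / of_int l * (c * char_cot q2 \<eta>2 (of_int l * y)))"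
          by simp
        then show ?thesis by (simp only: par mult_1)
      qed
      have "- l \<noteq> 0" using l by simp
      then show ?thesis by (simp only: G[OF \<open>- l \<noteq> 0\<close>] G[OF l] flip)
    qed simp
  qed
  then have "twisted_sum (int q1 * int q2) (\<lambda>v. \<eta>1 (fst v) * \<eta>2 (snd v)) ?h = 2 * (K * (eis_f \<eta>1 \<eta>2 z - eis_f \<eta>1 \<eta>2 z'))"
    unfolding G_def
  proof (rule twisted_sum_iterated[rotated -1])
    show "tame ?h" by (rule tame_lattice_kernel) (use q z in auto)
    show "(\<Sum>j\<in>{0..<int q1 * int q2}. \<eta>2 j) = 0"
      using sum_primitive_char_multiple[OF P2 q(2), of "int q1"] by (simp only: mult.commute)
  qed (use q in \<open>simp_all add: dirichlet_char_periodic_multiple[OF D1] dirichlet_char_periodic_multiple[OF D2]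
         dirichlet_char_norm_le_1[OF D2]\<close>)
  moreover have "\<i> * of_nat q2 ^ 2 / (4 * of_real pi * ?\<tau>) * (z' - z) * (2 * (K * x)) = x" for x
    using \<tau> q False by (simp add: K_def field_simps)
  ultimately show ?thesis by (simp only:)
qed simp

section \<open>Behaviour on the imaginary axis\<close>

text \<open>Full periods contribute zero; at most \<open>q\<close> terms of norm at most 1
  remain.\<close>

lemma sum_char_bounded:
  assumes P: "primitive_dirichlet_char q \<eta>" and q: "q > 1"
  shows "norm (\<Sum>k<n. \<eta> (int (Suc k))) \<le> real q"
proof -
  have D: "dirichlet_char q \<eta>" using P by (simp add: primitive_dirichlet_char_def)
  define d where "d = int (Suc n) div int q"
  have d: "0 \<le> int q * d" "int q * d \<le> int (Suc n)" "int (Suc n) - int q * d \<le> int q"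
  proof -
    have eq: "int q * d + int (Suc n) mod int q = int (Suc n)" unfolding d_def by (rule mult_div_mod_eq)
    have "0 \<le> int (Suc n) mod int q" "int (Suc n) mod int q < int q" using q by simp_all
    then show "int q * d \<le> int (Suc n)" "int (Suc n) - int q * d \<le> int q" using eq by linarith+
    have "d \<ge> 0" unfolding d_def using q by (simp add: pos_imp_zdiv_nonneg_iff)
    then show "0 \<le> int q * d" by simp
  qed
  have "(\<Sum>k<n. \<eta> (int (Suc k))) = (\<Sum>b\<in>{1..<int (Suc n)}. \<eta> b)"
    by (rule sum.reindex_bij_witness[of _ "\<lambda>b. nat b - 1" "\<lambda>k. int (Suc k)"]) auto
  also have "\<dots> = (\<Sum>b\<in>insert 0 {1..<int (Suc n)}. \<eta> b)"
    using dirichlet_char_0[OF D q] by simp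
  also have "insert 0 {1..<int (Suc n)} = {0..<int (Suc n)}" by auto
  also have "{0..<int (Suc n)} = {0..<int q * d} \<union> {int q * d..<int (Suc n)}"
    by (rule ivl_disj_un_two(3)[symmetric, OF d(1,2)])
  also have "(\<Sum>b\<in>{0..<int q * d} \<union> {int q * d..<int (Suc n)}. \<eta> b) =
      (\<Sum>b\<in>{0..<int q * d}. \<eta> b) + (\<Sum>b\<in>{int q * d..<int (Suc n)}. \<eta> b)"
    by (rule sum.union_disjoint) auto
  finally have eq: "(\<Sum>k<n. \<eta> (int (Suc k))) = (\<Sum>b\<in>{int q * d..<int (Suc n)}. \<eta> b)"
    by (simp add: sum_primitive_char_multiple[OF P q])
  have "norm (\<Sum>b\<in>{int q * d..<int (Suc n)}. \<eta> b) \<le> of_nat (card {int q * d..<int (Suc n)}) * 1"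
    by (rule sum_norm_bound) (rule dirichlet_char_norm_le_1[OF D])
  also have "\<dots> \<le> real q" using d(3) by simp
  finally show ?thesis by (simp only: eq)
qed

lemma power_mult_one_minus_le:
  fixes x :: real
  assumes "0 \<le> x" "x \<le> 1"
  shows "x ^ n * (1 - x) \<le> 1 / real (Suc n)"
proof -
  have "real (Suc n) * x ^ n = (\<Sum>i<Suc n. x ^ n)" by simp
  also have "\<dots> \<le> (\<Sum>i<Suc n. x ^ i)"
    by (intro sum_mono power_decreasing) (use assms in auto)
  finally have "real (Suc n) * x ^ n * (1 - x) \<le> (\<Sum>i<Suc n. x ^ i) * (1 - x)"
    using assms by (intro mult_right_mono) auto
  also have "\<dots> = 1 - x ^ Suc n" by (simp only: one_diff_power_eq mult.commute)
  also have "\<dots> \<le> 1" using assms by simp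
  finally show ?thesis by (simp add: field_simps)
qed

lemma sum_by_parts:
  fixes a v :: "nat \<Rightarrow> 'a::comm_ring"
  shows "(\<Sum>n<N. a n * v n) = (\<Sum>n<N. a n) * v N + (\<Sum>n<N. (\<Sum>k<Suc n. a k) * (v n - v (Suc n)))"
  by (induction N) (simp_all add: algebra_simps)

text \<open>
  After partial summation the series is dominated by a multiple of \<open>\<Sum>n. 1 / n\<^sup>2\<close> uniformly in \<open>x\<close>,
  because \<open>x ^ n * (1 - x) \<le> 1 / (n + 1)\<close>.
\<close>

lemma Abel_continuity:
  fixes a :: "nat \<Rightarrow> complex" and R :: "real \<Rightarrow> complex"
  assumes a: "\<And>n. norm (\<Sum>k<n. a k) \<le> B"
    and R: "\<And>x y. x \<in> {0..1} \<Longrightarrow> y \<in> {0..1} \<Longrightarrow> norm (R x - R y) \<le> L * \<bar>x - y\<bar>" and R0: "R 0 = 0"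
  shows "\<exists>F. continuous_on {0..1} F \<and> (\<forall>x\<in>{0..1}. (\<lambda>n. a n * (R (x ^ Suc n) / of_nat (Suc n))) sums F x)"
proof -
  have L: "L \<ge> 0" using order_trans[OF norm_ge_zero R[of 0 1]] by simp
  have B: "B \<ge> 0" using order_trans[OF norm_ge_zero a[of 0]] .
  have bound: "norm (R x) \<le> L" if "x \<in> {0..1}" for x
  proof -
    have "norm (R x) \<le> L * \<bar>x\<bar>" using R[OF that, of 0] R0 by simp
    also have "\<dots> \<le> L * 1" by (rule mult_left_mono) (use that L in auto)
    finally show ?thesis by simp
  qed
  have pow: "x ^ n \<in> {0..1}" if "x \<in> {0..1}" for x :: real and n
    using that by (auto simp: power_le_one)
  define v where "v x n = R (x ^ Suc n) / of_nat (Suc n)" for x n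
  define g where "g n x = (\<Sum>k<Suc n. a k) * (v x n - v x (Suc n))" for n x
  have v_diff: "norm (v x n - v x (Suc n)) \<le> 2 * L / real (Suc n) ^ 2" if x: "x \<in> {0..1}" for x n
  proof -
    let ?y = "x ^ Suc n" and ?y' = "x ^ Suc (Suc n)" and ?s = "of_nat (Suc n) :: complex"
    have "(1::complex) + of_nat n \<noteq> 0" "(2::complex) + of_nat n \<noteq> 0"
      using of_nat_eq_0_iff[of "Suc n", where 'a = complex] of_nat_eq_0_iff[of "Suc (Suc n)", where 'a = complex] by simp_all
    \<comment> \<open>The change of the argument of \<open>R\<close> at a fixed denominator is
      separated from the change of the denominator, \<open>1 / s - 1 / (s + 1)\<close>. Each part is
      of order \<open>1 / s ^ 2\<close>.\<close>
    then have "v x n - v x (Suc n) = (R ?y - R ?y') / ?s + R ?y' / (?s * (?s + 1))"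
      unfolding v_def by (simp add: divide_simps) (simp add: algebra_simps)
    then have "norm (v x n - v x (Suc n)) \<le> norm ((R ?y - R ?y') / ?s) + norm (R ?y' / (?s * (?s + 1)))"
      by (simp only: norm_triangle_ineq)
    also have "norm ((R ?y - R ?y') / ?s) \<le> L / real (Suc n) ^ 2"
    proof -
      have "?y - ?y' = ?y * (1 - x)" by (simp add: algebra_simps)
      moreover have "?y * (1 - x) \<ge> 0" using x by simp
      ultimately have "\<bar>?y - ?y'\<bar> = ?y * (1 - x)" by (simp only: abs_of_nonneg)
      also have "\<dots> = x * (x ^ n * (1 - x))" by simp
      also have "\<dots> \<le> 1 * (1 / real (Suc n))"
        using x by (intro mult_mono power_mult_one_minus_le) auto
      finally have "L * \<bar>?y - ?y'\<bar> \<le> L * (1 / real (Suc n))" using L by (intro mult_left_mono) auto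
      with R[OF pow[OF x] pow[OF x], of "Suc n" "Suc (Suc n)"]
      have "norm (R ?y - R ?y') \<le> L * (1 / real (Suc n))" by linarith
      then have "norm (R ?y - R ?y') / real (Suc n) \<le> L * (1 / real (Suc n)) / real (Suc n)"
        by (rule divide_right_mono) simp
      then show ?thesis by (simp add: norm_divide power2_eq_square del: of_nat_Suc)
    qed
    also have "norm (R ?y' / (?s * (?s + 1))) \<le> L / real (Suc n) ^ 2"
    proof -
      have "?s + 1 = of_nat (Suc (Suc n))" by simp
      then have "norm (R ?y' / (?s * (?s + 1))) = norm (R ?y') / (real (Suc n) * real (Suc (Suc n)))"
        by (simp only: norm_divide norm_mult norm_of_nat)
      also have "\<dots> \<le> L / (real (Suc n) * real (Suc n))"
        by (intro frac_le bound pow x L mult_left_mono) auto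
      finally show ?thesis by (simp only: power2_eq_square)
    qed
    finally show ?thesis by simp
  qed
  have g_bound: "norm (g n x) \<le> B * (2 * L) * (1 / real (Suc n) ^ 2)" if "x \<in> {0..1}" for n x
    using mult_mono[OF a[of "Suc n"] v_diff[OF that, of n] B norm_ge_zero] unfolding g_def norm_mult by simp
  have "summable (\<lambda>n. 1 / real n ^ 2)" using inverse_power_summable[of 2, where 'a = real] by (simp add: inverse_eq_divide)
  then have "summable (\<lambda>n. 1 / real (Suc n) ^ 2)" by (subst summable_Suc_iff)
  then have summ: "summable (\<lambda>n. B * (2 * L) * (1 / real (Suc n) ^ 2))" by (rule summable_mult)
  define F where "F x = (\<Sum>n. g n x)" for x
  have unif: "uniform_limit {0..1} (\<lambda>N x. \<Sum>n<N. g n x) F sequentially"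
    unfolding F_def by (rule Weierstrass_m_test[OF g_bound summ])
  have "continuous_on {0..1} R"
  proof (rule continuous_onI)
    fix x \<epsilon> :: real assume x: "x \<in> {0..1}" "\<epsilon> > 0"
    show "\<exists>d>0. \<forall>x'\<in>{0..1}. dist x' x < d \<longrightarrow> dist (R x') (R x) \<le> \<epsilon>"
    proof (intro exI[of _ "\<epsilon> / (L + 1)"] conjI ballI impI)
      show "\<epsilon> / (L + 1) > 0" using L x by simp
      fix x' assume x': "x' \<in> {0..1}" "dist x' x < \<epsilon> / (L + 1)"
      have "dist (R x') (R x) \<le> L * \<bar>x' - x\<bar>" using R[OF x'(1) x(1)] by (simp add: dist_norm)
      also have "\<dots> \<le> (L + 1) * \<bar>x' - x\<bar>" by (rule mult_right_mono) auto
      also have "\<dots> \<le> \<epsilon>" using x'(2) L by (simp add: dist_real_def pos_less_divide_eq mult.commute)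
      finally show "dist (R x') (R x) \<le> \<epsilon>" .
    qed
  qed
  then have cont: "continuous_on {0..1} (\<lambda>x. R (x ^ n))" for n
    by (rule continuous_on_compose2) (use pow in \<open>auto intro!: continuous_intros\<close>)
  have "continuous_on {0..1} (g n)" for n
    unfolding g_def v_def
    by (intro continuous_on_mult continuous_on_diff continuous_on_divide continuous_on_const cont)
       (simp_all del: of_nat_Suc)
  then have ev: "\<forall>\<^sub>F N in sequentially. continuous_on {0..1} (\<lambda>x. \<Sum>n<N. g n x)"
    by (intro always_eventually allI continuous_on_sum)
  have contF: "continuous_on {0..1} F"
    by (rule uniform_limit_theorem[OF ev unif]) simp
  have sums: "(\<lambda>n. a n * (R (x ^ Suc n) / of_nat (Suc n))) sums F x" if x: "x \<in> {0..1}" for x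
  proof -
    have "summable (\<lambda>n. g n x)" by (rule summable_comparison_test'[OF summ]) (use g_bound[OF x] in auto)
    then have "(\<lambda>N. \<Sum>n<N. g n x) \<longlonglongrightarrow> F x" unfolding F_def by (rule summable_LIMSEQ)
    moreover have "(\<lambda>N. (\<Sum>n<N. a n) * v x N) \<longlonglongrightarrow> 0"
    proof (rule Lim_null_comparison)
      show "\<forall>\<^sub>F N in sequentially. norm ((\<Sum>n<N. a n) * v x N) \<le> B * L / real (Suc N)"
      proof (intro always_eventually allI)
        fix N
        have "norm (v x N) \<le> L / real (Suc N)"
          unfolding v_def norm_divide norm_of_nat by (intro divide_right_mono bound pow x) simp
        then have "norm (\<Sum>n<N. a n) * norm (v x N) \<le> B * (L / real (Suc N))"
          by (intro mult_mono a B norm_ge_zero)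
        then show "norm ((\<Sum>n<N. a n) * v x N) \<le> B * L / real (Suc N)" by (simp add: norm_mult)
      qed
      show "(\<lambda>N. B * L / real (Suc N)) \<longlonglongrightarrow> 0"
        using LIMSEQ_Suc[OF lim_const_over_n[of "B * L"]] by simp
    qed
    ultimately have "(\<lambda>N. (\<Sum>n<N. a n) * v x N + (\<Sum>n<N. g n x)) \<longlonglongrightarrow> 0 + F x"
      by (intro tendsto_add)
    moreover have "(\<Sum>n<N. a n) * v x N + (\<Sum>n<N. g n x) = (\<Sum>n<N. a n * v x n)" for N
      unfolding g_def by (rule sum_by_parts[symmetric])
    ultimately show ?thesis unfolding sums_def v_def[symmetric] by (simp only: add_0)
  qed
  show ?thesis by (intro exI[of _ F] conjI ballI contF sums)
qed

text \<open>\<open>dirichlet_L\<close> is a \<open>suminf\<close> and is informative only after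
  convergence is known; \<open>Abel_continuity\<close> with the embedding of the reals as
  \<open>R\<close>, at \<open>x = 1\<close>, supplies it.\<close>

lemma dirichlet_L_1_sums:
  assumes P: "primitive_dirichlet_char q \<eta>" and q: "q > 1"
  shows "(\<lambda>n. \<eta> (int (Suc n)) / of_nat (Suc n)) sums dirichlet_L 1 \<eta>"
proof -
  obtain F where "\<forall>x\<in>{0..1}. (\<lambda>n. \<eta> (int (Suc n)) * (of_real (x ^ Suc n) / of_nat (Suc n))) sums F x"
    using Abel_continuity[OF sum_char_bounded[OF P q], of of_real 1] by (auto simp flip: of_real_diff)
  then have "(\<lambda>n. \<eta> (int (Suc n)) * (of_real (1 ^ Suc n) / of_nat (Suc n))) sums F 1" by (rule bspec) simp
  then have "summable (\<lambda>n. \<eta> (int (Suc n)) / of_nat (Suc n))" by (simp add: sums_iff)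
  then show ?thesis by (simp add: dirichlet_L_def sums_iff)
qed

text \<open>The cotangent sum on the imaginary axis in the variable
  \<open>x = exp (- 2 * pi * t)\<close>, extended to \<open>x = 0\<close>, the cusp at infinity, and
  \<open>x = 1\<close>, the cusp 0. For \<open>q > 1\<close> the vanishing denominator at
  \<open>x = 1\<close>, \<open>b = 0\<close> meets the coefficient
  \<open>\<eta> 0 = 0\<close>.\<close>

definition char_ratio :: "nat \<Rightarrow> (int \<Rightarrow> complex) \<Rightarrow> real \<Rightarrow> complex" where
  "char_ratio q \<eta> x = (\<Sum>b\<in>{0..<int q}. \<eta> b / gauss_sum q \<eta> *
     (of_real x * add_char q b / (1 - of_real x * add_char q b)))"

lemma norm_add_char [simp]: "norm (add_char q b) = 1"
  by (simp add: add_char_def norm_e Im_divide_of_nat)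

lemma add_char_neq_1:
  assumes "b \<in> {0..<int q}" "b \<noteq> 0" shows "add_char q b \<noteq> 1"
proof
  assume "add_char q b = 1"
  then have "(of_int b / of_nat q :: complex) \<in> \<int>" by (simp add: add_char_def e_eq_1_iff)
  then obtain t :: int where "(of_int b / of_nat q :: complex) = of_int t" by (auto elim: Ints_cases)
  then have "(of_int b :: complex) = of_int (t * int q)" using assms by (simp add: field_simps)
  then have "b = t * int q" by (simp only: of_int_eq_iff)
  then have "int q dvd b" by simp
  then show False using assms zdvd_imp_le[of "int q" b] by auto
qed

text \<open>For a root of unity other than 1, the segment joining it to 0 misses 1 and, being
  compact, keeps a positive distance \<open>c\<close> from it. The residue \<open>b = 0\<close> has
  weight zero.\<close>

lemma char_ratio_Lipschitz:
  assumes P: "primitive_dirichlet_char q \<eta>" and q: "q > 1"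
  shows "\<exists>L. \<forall>x\<in>{0..1}. \<forall>y\<in>{0..1}. norm (char_ratio q \<eta> x - char_ratio q \<eta> y) \<le> L * \<bar>x - y\<bar>"
proof -
  have D: "dirichlet_char q \<eta>" using P by (simp add: primitive_dirichlet_char_def)
  define \<phi> where "\<phi> b x = \<eta> b / gauss_sum q \<eta> * (of_real x * add_char q b / (1 - of_real x * add_char q b))"
    for b x
  have "\<exists>L. \<forall>x\<in>{0..1}. \<forall>y\<in>{0..1}. norm (\<phi> b x - \<phi> b y) \<le> L * \<bar>x - y\<bar>" if b: "b \<in> {0..<int q}" for b
  proof (cases "b = 0")
    case True
    then have "\<phi> b x = 0" for x using dirichlet_char_0[OF D q] by (simp add: \<phi>_def)
    then show ?thesis by (intro exI[of _ 0]) simp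
  next
    case False
    let ?z = "add_char q b" and ?C = "\<eta> b / gauss_sum q \<eta>"
    have nz: "1 - of_real x * ?z \<noteq> 0" if x: "x \<in> {0..1}" for x
    proof
      assume eq: "1 - of_real x * ?z = 0"
      then have "norm (of_real x * ?z) = 1" by (metis eq_iff_diff_eq_0 norm_one)
      then have "x = 1" using x by (simp add: norm_mult)
      then show False using eq add_char_neq_1[OF b False] by simp
    qed
    have "\<exists>x0\<in>{0..1}. \<forall>x\<in>{0..1}. norm (1 - of_real x0 * ?z) \<le> norm (1 - of_real x * ?z)"
      by (rule continuous_attains_inf) (auto intro!: continuous_intros)
    then obtain x0 where x0: "x0 \<in> {0..1}" "\<And>x. x \<in> {0..1} \<Longrightarrow> norm (1 - of_real x0 * ?z) \<le> norm (1 - of_real x * ?z)"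
      by blast
    define c where "c = norm (1 - of_real x0 * ?z)"
    have c: "c > 0" using nz[OF x0(1)] by (simp add: c_def)
    show ?thesis
    proof (intro exI ballI)
      fix x y :: real assume x: "x \<in> {0..1}" and y: "y \<in> {0..1}"
      have "\<phi> b x - \<phi> b y = ?C * (of_real (x - y) * ?z) / ((1 - of_real x * ?z) * (1 - of_real y * ?z))"
        using nz[OF x] nz[OF y] unfolding \<phi>_def right_diff_distrib[symmetric] times_divide_eq_right[symmetric]
        by (intro arg_cong2[where f = "(*)"] refl) (simp add: divide_simps, simp add: algebra_simps)
      then have "norm (\<phi> b x - \<phi> b y) = norm ?C * \<bar>x - y\<bar> / (norm (1 - of_real x * ?z) * norm (1 - of_real y * ?z))"
        by (simp only: norm_divide norm_mult norm_of_real norm_add_char mult_1_right)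
      also have "\<dots> \<le> norm ?C * \<bar>x - y\<bar> / (c * c)"
        by (intro divide_left_mono mult_mono mult_pos_pos)
           (use x0(2)[OF x] x0(2)[OF y] nz[OF x] nz[OF y] c in \<open>simp_all add: c_def\<close>)
      finally show "norm (\<phi> b x - \<phi> b y) \<le> (norm ?C / (c * c)) * \<bar>x - y\<bar>" by simp
    qed
  qed
  then obtain L where L: "\<And>b x y. b \<in> {0..<int q} \<Longrightarrow> x \<in> {0..1} \<Longrightarrow> y \<in> {0..1} \<Longrightarrow>
      norm (\<phi> b x - \<phi> b y) \<le> L b * \<bar>x - y\<bar>" by metis
  show ?thesis
  proof (intro exI ballI)
    fix x y :: real assume xy: "x \<in> {0..1}" "y \<in> {0..1}"
    have "char_ratio q \<eta> x - char_ratio q \<eta> y = (\<Sum>b\<in>{0..<int q}. \<phi> b x - \<phi> b y)"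
      by (simp only: char_ratio_def \<phi>_def sum_subtractf)
    also have "norm \<dots> \<le> (\<Sum>b\<in>{0..<int q}. L b * \<bar>x - y\<bar>)"
      by (rule sum_norm_le) (rule L[OF _ xy])
    finally show "norm (char_ratio q \<eta> x - char_ratio q \<eta> y) \<le> (\<Sum>b\<in>{0..<int q}. L b) * \<bar>x - y\<bar>"
      by (simp only: sum_distrib_right)
  qed
qed

text \<open>On the axis the term of index \<open>l\<close> depends on \<open>t\<close> only through
  \<open>x ^ l\<close>, the shape treated by \<open>Abel_continuity\<close>. Continuity of
  \<open>F\<close> up to both endpoints gives the limits at the cusps: \<open>F 0\<close> at
  infinity and \<open>F 1\<close> at 0.\<close>

lemma eis_f_imaginary_axis:
  assumes P1: "primitive_dirichlet_char q1 \<eta>1" and P2: "primitive_dirichlet_char q2 \<eta>2"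
    and q: "q1 > 1" "q2 > 1"
  shows "\<exists>F. continuous_on {0..1} F \<and> (\<forall>t>0. eis_f \<eta>1 \<eta>2 (\<i> * of_real t) = F (exp (- 2 * pi * t))) \<and>
    F 0 = 0 \<and> F 1 = dirichlet_L 1 \<eta>1 * (\<i> / (2 * gauss_sum q2 \<eta>2) * char_cot q2 \<eta>2 0)"
proof -
  have D1: "dirichlet_char q1 \<eta>1" and D2: "dirichlet_char q2 \<eta>2"
    using P1 P2 by (simp_all add: primitive_dirichlet_char_def)
  let ?R = "char_ratio q2 \<eta>2"
  obtain L where L: "\<And>x y. x \<in> {0..1} \<Longrightarrow> y \<in> {0..1} \<Longrightarrow> norm (?R x - ?R y) \<le> L * \<bar>x - y\<bar>"
    using char_ratio_Lipschitz[OF P2 q(2)] by blast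
  have R0: "?R 0 = 0" by (simp add: char_ratio_def)
  then obtain F where F: "continuous_on {0..1} F"
    "\<And>x. x \<in> {0..1} \<Longrightarrow> (\<lambda>n. \<eta>1 (int (Suc n)) * (?R (x ^ Suc n) / of_nat (Suc n))) sums F x"
    using Abel_continuity[OF sum_char_bounded[OF P1 q(1)] L] by blast
  \<comment> \<open>The case \<open>t = 0\<close> is included, as it evaluates \<open>?R 1\<close>
    and thereby \<open>F 1\<close>.\<close>
  have ratio: "\<i> / (2 * gauss_sum q2 \<eta>2) * char_cot q2 \<eta>2 (\<i> * of_real t) = ?R (exp (- 2 * pi * t))" if "t \<ge> 0" for t
  proof -
    have exp: "e (\<i> * of_real t + of_int b / of_nat q2) = of_real (exp (- 2 * pi * t)) * add_char q2 b" for b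
    proof -
      have "2 * of_real pi * \<i> * (\<i> * of_real t) = complex_of_real (- 2 * pi * t)"
        by (simp add: mult_ac)
      then have "e (\<i> * of_real t) = of_real (exp (- 2 * pi * t))"
        unfolding e_def by (simp only: exp_of_real)
      then show ?thesis by (simp only: e_add add_char_def)
    qed
    have ne: "e (\<i> * of_real t + of_int b / of_nat q2) \<noteq> 1" if b: "b \<in> {0..<int q2}" "\<eta>2 b \<noteq> 0" for b
    proof
      assume eq: "e (\<i> * of_real t + of_int b / of_nat q2) = 1"
      then have "norm (complex_of_real (exp (- 2 * pi * t)) * add_char q2 b) = 1" by (simp only: exp norm_one)
      then have "exp (- 2 * pi * t) = 1" by (simp add: norm_mult)
      then have "add_char q2 b = 1" using eq by (simp only: exp) simp
      moreover have "b \<noteq> 0" using b(2) dirichlet_char_0[OF D2 q(2)] by auto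
      ultimately show False using add_char_neq_1[OF b(1)] by blast
    qed
    have "\<i> / (2 * gauss_sum q2 \<eta>2) * char_cot q2 \<eta>2 (\<i> * of_real t) =
      (\<Sum>b\<in>{0..<int q2}. \<eta>2 b / gauss_sum q2 \<eta>2 *
        (e (\<i> * of_real t + of_int b / of_nat q2) / (1 - e (\<i> * of_real t + of_int b / of_nat q2))))"
      by (rule char_cot_eq_sum_ratio[OF P2 q(2) ne])
    then show ?thesis by (simp only: exp char_ratio_def)
  qed
  have eis: "eis_f \<eta>1 \<eta>2 (\<i> * of_real t) = F (exp (- 2 * pi * t))" if t: "t > 0" for t
  proof -
    have "((\<lambda>l. \<eta>1 (int l) / of_nat l * (\<i> / (2 * gauss_sum q2 \<eta>2) * char_cot q2 \<eta>2 (of_nat l * (\<i> * of_real t))))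
        has_sum eis_f \<eta>1 \<eta>2 (\<i> * of_real t)) {1..}"
      by (rule eis_f_has_sum[OF D1 P2 q(2)]) (use t in simp)
    also have "?this \<longleftrightarrow> ((\<lambda>n. \<eta>1 (int (Suc n)) * (?R (exp (- 2 * pi * t) ^ Suc n) / of_nat (Suc n)))
        has_sum eis_f \<eta>1 \<eta>2 (\<i> * of_real t)) UNIV"
    proof (rule has_sum_reindex_bij_witness[of _ Suc "\<lambda>n. n - 1"])
      fix l :: nat assume l: "l \<in> {1..}"
      have "of_nat l * (\<i> * complex_of_real t) = \<i> * of_real (real l * t)" by simp
      moreover have "exp (- 2 * pi * (real l * t)) = exp (- 2 * pi * t) ^ l"
        by (simp add: exp_of_nat_mult[symmetric] mult_ac)
      moreover have "real l * t \<ge> 0" using t by simp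
      ultimately have "\<i> / (2 * gauss_sum q2 \<eta>2) * char_cot q2 \<eta>2 (of_nat l * (\<i> * of_real t)) = ?R (exp (- 2 * pi * t) ^ l)"
        using ratio[of "real l * t"] by (simp only:)
      moreover have "Suc (l - 1) = l" using l by simp
      ultimately show "\<eta>1 (int (Suc (l - 1))) * (?R (exp (- 2 * pi * t) ^ Suc (l - 1)) / of_nat (Suc (l - 1))) =
          \<eta>1 (int l) / of_nat l * (\<i> / (2 * gauss_sum q2 \<eta>2) * char_cot q2 \<eta>2 (of_nat l * (\<i> * of_real t)))"
        by (simp only: times_divide_eq_left times_divide_eq_right)
    qed auto
    finally have "(\<lambda>n. \<eta>1 (int (Suc n)) * (?R (exp (- 2 * pi * t) ^ Suc n) / of_nat (Suc n))) sums eis_f \<eta>1 \<eta>2 (\<i> * of_real t)"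
      by (rule has_sum_imp_sums)
    moreover have "exp (- 2 * pi * t) \<in> {0..1}" using t by simp
    ultimately show ?thesis using F(2) sums_unique2 by blast
  qed
  have F1: "F 1 = dirichlet_L 1 \<eta>1 * (\<i> / (2 * gauss_sum q2 \<eta>2) * char_cot q2 \<eta>2 0)"
  proof (rule sums_unique2)
    show "(\<lambda>n. \<eta>1 (int (Suc n)) * (?R (1 ^ Suc n) / of_nat (Suc n))) sums F 1" by (rule F(2)) simp
    have "(\<lambda>n. \<eta>1 (int (Suc n)) / of_nat (Suc n) * ?R 1) sums (dirichlet_L 1 \<eta>1 * ?R 1)"
      by (rule sums_mult2[OF dirichlet_L_1_sums[OF P1 q(1)]])
    moreover have "\<eta>1 (int (Suc n)) / of_nat (Suc n) * ?R 1 = \<eta>1 (int (Suc n)) * (?R (1 ^ Suc n) / of_nat (Suc n))" for n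
      by simp
    ultimately have "(\<lambda>n. \<eta>1 (int (Suc n)) * (?R (1 ^ Suc n) / of_nat (Suc n))) sums (dirichlet_L 1 \<eta>1 * ?R 1)"
      by (simp only:)
    moreover have "?R 1 = \<i> / (2 * gauss_sum q2 \<eta>2) * char_cot q2 \<eta>2 0" using ratio[of 0] by simp
    ultimately show "(\<lambda>n. \<eta>1 (int (Suc n)) * (?R (1 ^ Suc n) / of_nat (Suc n))) sums
        (dirichlet_L 1 \<eta>1 * (\<i> / (2 * gauss_sum q2 \<eta>2) * char_cot q2 \<eta>2 0))"
      by (simp only:)
  qed
  have "F 0 = 0"
  proof (rule sums_unique2)
    show "(\<lambda>n. \<eta>1 (int (Suc n)) * (?R (0 ^ Suc n) / of_nat (Suc n))) sums F 0" by (rule F(2)) simp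
    show "(\<lambda>n. \<eta>1 (int (Suc n)) * (?R (0 ^ Suc n) / of_nat (Suc n))) sums 0" by (simp add: R0)
  qed
  with F(1) eis F1 show ?thesis by blast
qed

lemma char_cot_0_even:
  assumes "dirichlet_char q \<eta>" "even_char \<eta>" shows "char_cot q \<eta> 0 = 0"
  using char_cot_uminus[OF assms(1), of 0] assms(2) by (simp add: even_char_def)

text \<open>Partial fractions at \<open>w = 0\<close> give the symmetric sum of
  \<open>\<eta> m / m\<close>. Since \<open>\<eta>\<close> and \<open>1 / m\<close> are both odd,
  the two halves coincide and the series of the L-function is met twice.\<close>

lemma char_cot_0_odd:
  assumes P: "primitive_dirichlet_char q \<eta>" and q: "q > 1" and odd: "odd_char \<eta>"
  shows "of_real pi / of_nat q * char_cot q \<eta> 0 = 2 * dirichlet_L 1 \<eta>"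
proof (rule LIMSEQ_unique)
  have D: "dirichlet_char q \<eta>" using P by (simp add: primitive_dirichlet_char_def)
  have \<eta>0: "\<eta> 0 = 0" by (rule dirichlet_char_0[OF D q])
  show "(\<lambda>M. \<Sum>m\<in>{int q * (-int M)..<int q * int M}. \<eta> m * (1 / (of_nat q * 0 + of_int m)))
      \<longlonglongrightarrow> of_real pi / of_nat q * char_cot q \<eta> 0"
  proof (rule char_cot_partial_fractions[OF D])
    fix b assume b: "b \<in> {0..<int q}" "\<eta> b \<noteq> 0"
    then have "b \<noteq> 0" using \<eta>0 by auto
    then have "e (of_int b / of_nat q) \<noteq> 1" using add_char_neq_1[OF b(1)] by (simp add: add_char_def)
    then show "0 + of_int b / of_nat q \<notin> (\<int>::complex set)" by (simp add: e_eq_1_iff)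
  qed
  let ?f = "\<lambda>m. \<eta> m * (1 / (of_nat q * 0 + of_int m))"
  have "(\<lambda>n. \<Sum>k<n. \<eta> (int (Suc k)) / of_nat (Suc k)) \<longlonglongrightarrow> dirichlet_L 1 \<eta>"
    using dirichlet_L_1_sums[OF P q] by (simp only: sums_def)
  moreover have "filterlim (\<lambda>M. q * M) sequentially sequentially"
    by (rule filterlim_subseq) (use q in \<open>simp add: strict_mono_def\<close>)
  ultimately have "(\<lambda>M. \<Sum>k<q * M. \<eta> (int (Suc k)) / of_nat (Suc k)) \<longlonglongrightarrow> dirichlet_L 1 \<eta>"
    by (rule filterlim_compose)
  then have "(\<lambda>M. 2 * (\<Sum>k<q * M. \<eta> (int (Suc k)) / of_nat (Suc k))) \<longlonglongrightarrow> 2 * dirichlet_L 1 \<eta>"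
    by (rule tendsto_mult_left)
  moreover have "2 * (\<Sum>k<q * M. \<eta> (int (Suc k)) / of_nat (Suc k)) = (\<Sum>m\<in>{int q * (-int M)..<int q * int M}. ?f m)" for M
  proof -
    let ?N = "int q * int M"
    have leN: "int (Suc k) \<le> ?N" if "k < q * M" for k
    proof -
      have "int (Suc k) \<le> int (q * M)" using that by (simp only: of_nat_le_iff Suc_le_eq)
      then show ?thesis by (simp only: of_nat_mult)
    qed
    \<comment> \<open>The window contains \<open>- ?N\<close> but not \<open>?N\<close>; as
      \<open>\<eta>\<close> vanishes there, \<open>?N\<close> can be added, and the halves match
      exactly.\<close>
    have N0: "\<eta> ?N = 0"
      using dirichlet_char_cong[OF D, of ?N 0] \<eta>0 by (simp add: cong_def)
    have "(\<Sum>m\<in>{int q * (-int M)..<?N}. ?f m) = (\<Sum>m\<in>{-?N..<0} \<union> {0..<?N}. ?f m)"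
      by (intro sum.cong) auto
    also have "\<dots> = (\<Sum>m\<in>{-?N..<0}. ?f m) + (\<Sum>m\<in>{0..<?N}. ?f m)"
      by (rule sum.union_disjoint) auto
    also have "(\<Sum>m\<in>{0..<?N}. ?f m) = (\<Sum>m\<in>insert ?N {0..<?N}. ?f m)"
      using N0 by simp
    also have "insert ?N {0..<?N} = insert 0 {1..?N}"
    proof -
      have "insert N {0..<N} = insert 0 {1..N}" if "N \<ge> 0" for N :: int using that by auto
      then show ?thesis by simp
    qed
    also have "(\<Sum>m\<in>insert 0 {1..?N}. ?f m) = (\<Sum>m\<in>{1..?N}. ?f m)" using \<eta>0 by simp
    also have "(\<Sum>m\<in>{1..?N}. ?f m) = (\<Sum>k<q * M. \<eta> (int (Suc k)) / of_nat (Suc k))"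
    proof (rule sum.reindex_bij_witness[of _ "\<lambda>k. int (Suc k)" "\<lambda>m. nat m - 1"])
      fix m assume m: "m \<in> {1..?N}"
      have "nat m \<le> q * M" using m by (simp add: nat_le_iff)
      moreover have "nat m \<ge> 1" using m by (simp add: le_nat_iff)
      ultimately show "nat m - 1 \<in> {..<q * M}" unfolding lessThan_iff by linarith
      have "Suc (nat m - 1) = nat m" using m by simp
      then show "\<eta> (int (Suc (nat m - 1))) / of_nat (Suc (nat m - 1)) = ?f m" using m by simp
    next
      fix k assume "k \<in> {..<q * M}"
      then show "int (Suc k) \<in> {1..?N}" using leN by simp
    qed auto
    also have "(\<Sum>m\<in>{-?N..<0}. ?f m) = (\<Sum>k<q * M. \<eta> (int (Suc k)) / of_nat (Suc k))"
    proof (rule sum.reindex_bij_witness[of _ "\<lambda>k. - int (Suc k)" "\<lambda>m. nat (- m) - 1"])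
      fix m assume m: "m \<in> {-?N..<0}"
      have "nat (- m) \<le> q * M" using m by (simp add: nat_le_iff)
      moreover have "nat (- m) \<ge> 1" using m by (simp add: le_nat_iff)
      ultimately show "nat (- m) - 1 \<in> {..<q * M}" unfolding lessThan_iff by linarith
      have s: "Suc (nat (- m) - 1) = nat (- m)" using m by simp
      have "\<eta> (- m) = - \<eta> m" using dirichlet_charD(2)[OF D, of "-1" m] odd by (simp add: odd_char_def)
      then show "\<eta> (int (Suc (nat (- m) - 1))) / of_nat (Suc (nat (- m) - 1)) = ?f m"
        unfolding s using m by (simp add: of_nat_nat)
    next
      fix k assume "k \<in> {..<q * M}"
      then have "int (Suc k) \<le> ?N" using leN by simp
      then show "- int (Suc k) \<in> {-?N..<0}" unfolding atLeastLessThan_iff by linarith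
    qed auto
    finally show ?thesis by simp
  qed
  ultimately show "(\<lambda>M. \<Sum>m\<in>{int q * (-int M)..<int q * int M}. ?f m) \<longlonglongrightarrow> 2 * dirichlet_L 1 \<eta>"
    by (simp only:)
qed

section \<open>Transformation laws and reciprocity\<close>

lemma mat2_nth [simp]:
  "mat2 a b c d $ 1 $ 1 = a" "mat2 a b c d $ 1 $ 2 = b"
  "mat2 a b c d $ 2 $ 1 = c" "mat2 a b c d $ 2 $ 2 = d"
  by (simp_all add: mat2_def vector_2)

lemma det_mat2 [simp]: "det (mat2 a b c d) = a * d - b * c"
  by (simp add: det_2)

lemma moebius_denominator_nonzero:
  assumes det: "a * d - b * c = (1::int)" and z: "Im z > 0"
  shows "of_int c * z + of_int d \<noteq> 0"
proof
  assume eq: "of_int c * z + of_int d = 0"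
  then have "Im (of_int c * z + of_int d) = 0" by simp
  then have "c = 0" using z by simp
  moreover from this eq have "d = 0" by simp
  ultimately show False using det by simp
qed

lemma moebius_diff:
  assumes det: "a * d - b * c = (1::int)" and z: "Im z > 0" and w: "Im w > 0"
  shows "moebius_action (mat2 a b c d) w - moebius_action (mat2 a b c d) z =
    (w - z) / ((of_int c * z + of_int d) * (of_int c * w + of_int d))"
proof -
  have det': "of_int a * of_int d - of_int b * of_int c = (1::complex)"
    using arg_cong[OF det, of "of_int :: int \<Rightarrow> complex"] by simp
  have num: "(of_int a * w + of_int b) * (of_int c * z + of_int d) - (of_int a * z + of_int b) * (of_int c * w + of_int d)
      = (of_int a * of_int d - of_int b * of_int c) * (w - z)"
    by (simp add: algebra_simps)
  show ?thesis
    unfolding moebius_action_def mat2_nth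
      diff_frac_eq[OF moebius_denominator_nonzero[OF det w] moebius_denominator_nonzero[OF det z]]
      num det' mult_1 by (simp only: mult.commute)
qed

lemma Im_moebius_pos:
  assumes det: "a * d - b * c = (1::int)" and z: "Im z > 0"
  shows "Im (moebius_action (mat2 a b c d) z) > 0"
proof -
  let ?i = "of_int a * z + of_int b" and ?j = "of_int c * z + of_int d"
  have "(Re ?j)\<^sup>2 + (Im ?j)\<^sup>2 > 0"
    using moebius_denominator_nonzero[OF det z] by (simp only: complex_neq_0)
  moreover have "Im ?i * Re ?j - Re ?i * Im ?j = Im z"
  proof -
    have "Im ?i * Re ?j - Re ?i * Im ?j = real_of_int (a * d - b * c) * Im z"
      by (simp add: algebra_simps)
    then show ?thesis by (simp only: det of_int_1 mult_1)
  qed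
  ultimately show ?thesis
    unfolding moebius_action_def mat2_nth Im_divide using z by (simp only: divide_pos_pos)
qed

text \<open>Clearing the denominator \<open>j y\<close>, the form
  \<open>q2 * \<gamma> y * l + m\<close> becomes the form at \<open>q2 * y\<close> in
  \<open>(a * l + c * q1 * m, b * q2 * l + d * m)\<close>. This substitution \<open>?T\<close> is
  the transpose of \<open>\<gamma>\<close> conjugated by a diagonal matrix; it is integral because
  \<open>q2\<close> divides the lower left entry.\<close>

lemma eis_f_moebius_diff:
  assumes P1: "primitive_dirichlet_char q1 \<eta>1" and P2: "primitive_dirichlet_char q2 \<eta>2"
    and q: "q1 > 1" "q2 > 1" and par: "\<eta>1 (-1) * \<eta>2 (-1) = 1"
    and det: "a * d - b * (c * int q1 * int q2) = 1"
    and z: "Im z > 0" "Im z' > 0"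
  defines "\<gamma> \<equiv> mat2 a b (c * int q1 * int q2) d"
  shows "eis_f \<eta>1 \<eta>2 (moebius_action \<gamma> z) - eis_f \<eta>1 \<eta>2 (moebius_action \<gamma> z') =
    psi_char \<eta>1 \<eta>2 \<gamma> * (eis_f \<eta>1 \<eta>2 z - eis_f \<eta>1 \<eta>2 z')"
proof -
  have D1: "dirichlet_char q1 \<eta>1" and D2: "dirichlet_char q2 \<eta>2"
    using P1 P2 by (simp_all add: primitive_dirichlet_char_def)
  define j where "j y = of_int (c * int q1 * int q2) * y + of_int d" for y :: complex
  have j: "j z \<noteq> 0" "j z' \<noteq> 0"
    unfolding j_def using moebius_denominator_nonzero[OF det] z by blast+
  let ?T = "lin2 a (c * int q1) (b * int q2) d" and ?X = "\<lambda>v. \<eta>1 (fst v) * \<eta>2 (snd v)"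
  let ?N = "int q1 * int q2" and ?K = "\<i> * of_nat q2 ^ 2 / (4 * of_real pi * gauss_sum q2 \<eta>2)"
  let ?h = "lattice_kernel (of_nat q2 * z) (of_nat q2 * z')"
  let ?\<psi> = "\<eta>1 d * cnj (\<eta>2 d)"
  have lin: "linear_form (of_nat q2 * moebius_action \<gamma> y) v = linear_form (of_nat q2 * y) (?T v) / j y"
    if "j y \<noteq> 0" for y v
  proof -
    have num: "of_nat q2 * (of_int a * y + of_int b) * of_int (fst v) + of_int (snd v) * j y =
        of_nat q2 * y * of_int (fst (?T v)) + of_int (snd (?T v))"
      by (simp add: j_def lin2_def algebra_simps)
    have "of_nat q2 * ((of_int a * y + of_int b) / j y) * of_int (fst v) + of_int (snd v) =
        (of_nat q2 * (of_int a * y + of_int b) * of_int (fst v) + of_int (snd v) * j y) / j y"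
    proof -
      have "x * (A / w) * l + m = (x * A * l + m * w) / w" if "w \<noteq> 0" for x A w l m :: complex
        using that by (simp add: add_divide_distrib)
      then show ?thesis using that by blast
    qed
    then show ?thesis
      unfolding num by (simp only: \<gamma>_def moebius_action_def mat2_nth j_def[symmetric] linear_form_def)
  qed
  have kernel: "lattice_kernel (of_nat q2 * moebius_action \<gamma> z) (of_nat q2 * moebius_action \<gamma> z') v =
      (j z * j z') * ?h (?T v)" for v
    unfolding lattice_kernel_def lin[OF j(1)] lin[OF j(2)] by simp
  have ad1: "[d * a = 1] (mod int q1)" and ad2: "[a * d = 1] (mod int q2)"
  proof -
    have "d * a - 1 = int q1 * (b * c * int q2)" "a * d - 1 = int q2 * (b * c * int q1)"
      using det by (simp_all add: algebra_simps)
    then show "[d * a = 1] (mod int q1)" "[a * d = 1] (mod int q2)" by (simp_all add: cong_iff_dvd_diff)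
  qed
  \<comment> \<open>Modulo \<open>q1\<close> the first coordinate of \<open>?T v\<close> is
    \<open>a * l\<close>, modulo \<open>q2\<close> the second is \<open>d * m\<close>; since
    \<open>a * d\<close> is 1 for both moduli, \<open>\<eta>1 d\<close> and
    \<open>cnj (\<eta>2 d)\<close> undo these factors.\<close>
  have chars: "?X v = ?\<psi> * ?X (?T v)" for v
  proof -
    have "\<eta>1 (a * fst v + c * int q1 * snd v) = \<eta>1 (a * fst v)"
      by (rule dirichlet_char_cong[OF D1]) (simp add: cong_iff_dvd_diff)
    then have "\<eta>1 d * \<eta>1 (fst (?T v)) = \<eta>1 (d * a) * \<eta>1 (fst v)"
      by (simp add: lin2_def dirichlet_charD(2)[OF D1])
    also have "\<eta>1 (d * a) = 1" using dirichlet_char_cong[OF D1 ad1] dirichlet_char_1[OF D1] by simp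
    finally have e1: "\<eta>1 d * \<eta>1 (fst (?T v)) = \<eta>1 (fst v)" by simp
    have "\<eta>2 (b * int q2 * fst v + d * snd v) = \<eta>2 (d * snd v)"
      by (rule dirichlet_char_cong[OF D2]) (simp add: cong_iff_dvd_diff)
    moreover have "cnj (\<eta>2 d) = \<eta>2 a" using dirichlet_char_inverse[OF D2 ad2] by simp
    ultimately have "cnj (\<eta>2 d) * \<eta>2 (snd (?T v)) = \<eta>2 (a * d) * \<eta>2 (snd v)"
      by (simp add: lin2_def dirichlet_charD(2)[OF D2])
    also have "\<eta>2 (a * d) = 1" using dirichlet_char_cong[OF D2 ad2] dirichlet_char_1[OF D2] by simp
    finally have e2: "cnj (\<eta>2 d) * \<eta>2 (snd (?T v)) = \<eta>2 (snd v)" by simp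
    have "?\<psi> * ?X (?T v) = (\<eta>1 d * \<eta>1 (fst (?T v))) * (cnj (\<eta>2 d) * \<eta>2 (snd (?T v)))"
      by (simp add: mult_ac)
    then show ?thesis by (simp only: e1 e2)
  qed
  have tw: "twisted_sum ?N ?X (lattice_kernel (of_nat q2 * moebius_action \<gamma> z) (of_nat q2 * moebius_action \<gamma> z')) =
      ?\<psi> * (j z * j z') * twisted_sum ?N ?X ?h"
  proof (rule twisted_sum_lin2[where a = a and b = "c * int q1" and c = "b * int q2" and d = d])
    show "a * d - c * int q1 * (b * int q2) = 1" using det by (simp add: mult_ac)
    show "tame ?h" by (rule tame_lattice_kernel) (use q z in auto)
    show "lattice_kernel (of_nat q2 * moebius_action \<gamma> z) (of_nat q2 * moebius_action \<gamma> z') v =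
      (j z * j z') * ?h (?T v)" for v by (rule kernel)
    show "?X v = ?\<psi> * ?X (?T v)" for v by (rule chars)
  qed (use q in \<open>simp_all add: dirichlet_char_periodic_multiple[OF D1] dirichlet_char_periodic_multiple[OF D2]\<close>)
  have Im: "Im (moebius_action \<gamma> z) > 0" "Im (moebius_action \<gamma> z') > 0"
    unfolding \<gamma>_def by (rule Im_moebius_pos[OF det z(1)], rule Im_moebius_pos[OF det z(2)])
  have diff: "moebius_action \<gamma> z' - moebius_action \<gamma> z = (z' - z) / (j z * j z')"
    unfolding \<gamma>_def j_def by (rule moebius_diff[OF det z])
  have "eis_f \<eta>1 \<eta>2 (moebius_action \<gamma> z) - eis_f \<eta>1 \<eta>2 (moebius_action \<gamma> z') =
      ?K * ((z' - z) / (j z * j z')) * (?\<psi> * (j z * j z') * twisted_sum ?N ?X ?h)"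
    by (simp only: eis_f_diff[OF P1 P2 q par Im] tw diff)
  also have "\<dots> = ?\<psi> * (?K * (z' - z) * twisted_sum ?N ?X ?h)"
  proof -
    have cancel: "k * (x / w) * (p * w * t) = p * (k * x * t)" if "w \<noteq> 0" for k x w p t :: complex
      using that by simp
    have "j z * j z' \<noteq> 0" using j by simp
    from cancel[OF this] show ?thesis .
  qed
  also have "\<dots> = ?\<psi> * (eis_f \<eta>1 \<eta>2 z - eis_f \<eta>1 \<eta>2 z')"
    by (simp only: eis_f_diff[OF P1 P2 q par z])
  finally show ?thesis by (simp add: psi_char_def conj_char_def \<gamma>_def)
qed

text \<open>The difference identity makes the expression constant on the upper half-plane, so the
  definite description denotes it and may be evaluated at a convenient point.\<close>

lemma eis_phi_eq:
  assumes P1: "primitive_dirichlet_char q1 \<eta>1" and P2: "primitive_dirichlet_char q2 \<eta>2"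
    and q: "q1 > 1" "q2 > 1" and par: "\<eta>1 (-1) * \<eta>2 (-1) = 1"
    and det: "a * d - b * (c * int q1 * int q2) = 1" and z: "Im z > 0"
  defines "\<gamma> \<equiv> mat2 a b (c * int q1 * int q2) d"
  shows "eis_phi \<eta>1 \<eta>2 \<gamma> = eis_f \<eta>1 \<eta>2 (moebius_action \<gamma> z) - psi_char \<eta>1 \<eta>2 \<gamma> * eis_f \<eta>1 \<eta>2 z"
  unfolding eis_phi_def
proof (rule the_equality)
  show "\<forall>y. Im y > 0 \<longrightarrow> eis_f \<eta>1 \<eta>2 (moebius_action \<gamma> y) - psi_char \<eta>1 \<eta>2 \<gamma> * eis_f \<eta>1 \<eta>2 y =
      eis_f \<eta>1 \<eta>2 (moebius_action \<gamma> z) - psi_char \<eta>1 \<eta>2 \<gamma> * eis_f \<eta>1 \<eta>2 z"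
  proof (intro allI impI)
    fix y :: complex assume y: "Im y > 0"
    have "eis_f \<eta>1 \<eta>2 (moebius_action \<gamma> y) - eis_f \<eta>1 \<eta>2 (moebius_action \<gamma> z) =
        psi_char \<eta>1 \<eta>2 \<gamma> * (eis_f \<eta>1 \<eta>2 y - eis_f \<eta>1 \<eta>2 z)"
      unfolding \<gamma>_def by (rule eis_f_moebius_diff[OF P1 P2 q par det y z])
    moreover have "A - X = B - Y" if "A - B = p * (x - y)" "X = p * x" "Y = p * y"
      for A B X Y p x y :: complex
      using that by (simp add: algebra_simps)
    ultimately show "eis_f \<eta>1 \<eta>2 (moebius_action \<gamma> y) - psi_char \<eta>1 \<eta>2 \<gamma> * eis_f \<eta>1 \<eta>2 y =
      eis_f \<eta>1 \<eta>2 (moebius_action \<gamma> z) - psi_char \<eta>1 \<eta>2 \<gamma> * eis_f \<eta>1 \<eta>2 z" by blast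
  qed
qed (use z in blast)

text \<open>Here \<open>q2 * W z * l + m = (q1 * z * m - l) / (q1 * z)\<close>: the rotation taking
  \<open>(l, m)\<close> to \<open>(m, - l)\<close> exchanges the two characters and their moduli,
  with sign \<open>\<eta>1 (-1)\<close>.\<close>

lemma eis_f_fricke_diff:
  assumes P1: "primitive_dirichlet_char q1 \<eta>1" and P2: "primitive_dirichlet_char q2 \<eta>2"
    and q: "q1 > 1" "q2 > 1" and par: "\<eta>1 (-1) * \<eta>2 (-1) = 1"
    and z: "Im z > 0" "Im z' > 0"
  defines "W \<equiv> \<lambda>y. - 1 / (of_nat q1 * of_nat q2 * y)"
  shows "eis_f \<eta>1 \<eta>2 (W z) - eis_f \<eta>1 \<eta>2 (W z') =
    \<eta>1 (-1) * gauss_sum q2 (conj_char \<eta>2) / gauss_sum q1 (conj_char \<eta>1) *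
    (eis_f \<eta>2 \<eta>1 z - eis_f \<eta>2 \<eta>1 z')"
proof -
  have D1: "dirichlet_char q1 \<eta>1" and D2: "dirichlet_char q2 \<eta>2"
    using P1 P2 by (simp_all add: primitive_dirichlet_char_def)
  have par': "\<eta>2 (-1) * \<eta>1 (-1) = 1" using par by (simp add: mult.commute)
  have nz: "z \<noteq> 0" "z' \<noteq> 0" using z by auto
  let ?T = "lin2 0 1 (-1) 0"
  let ?X = "\<lambda>v. \<eta>1 (fst v) * \<eta>2 (snd v)" and ?X' = "\<lambda>v. \<eta>2 (fst v) * \<eta>1 (snd v)"
  let ?N = "int q1 * int q2" and ?N' = "int q2 * int q1"
  let ?h = "lattice_kernel (of_nat q1 * z) (of_nat q1 * z')"
  let ?\<tau>1 = "gauss_sum q1 \<eta>1" and ?\<tau>2 = "gauss_sum q2 \<eta>2"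
  let ?\<tau>1' = "gauss_sum q1 (conj_char \<eta>1)" and ?\<tau>2' = "gauss_sum q2 (conj_char \<eta>2)"
  have lin: "linear_form (of_nat q2 * W y) v = linear_form (of_nat q1 * y) (?T v) / (of_nat q1 * y)"
    if "y \<noteq> 0" for y v
    using that q unfolding W_def linear_form_def lin2_def by (simp add: field_simps)
  have kernel: "lattice_kernel (of_nat q2 * W z) (of_nat q2 * W z') v = (of_nat q1 ^ 2 * z * z') * ?h (?T v)" for v
    unfolding lattice_kernel_def lin[OF nz(1)] lin[OF nz(2)] by (simp add: power2_eq_square)
  have chars: "?X v = \<eta>1 (-1) * ?X' (?T v)" for v
  proof -
    have "\<eta>1 (- fst v) = \<eta>1 (-1) * \<eta>1 (fst v)" using dirichlet_charD(2)[OF D1, of "-1" "fst v"] by simp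
    then have "\<eta>1 (-1) * ?X' (?T v) = (\<eta>1 (-1) * \<eta>1 (-1)) * ?X v" by (simp add: lin2_def mult_ac)
    then show ?thesis by (simp only: dirichlet_char_minus_1[OF D1] mult_1)
  qed
  have tw: "twisted_sum ?N ?X (lattice_kernel (of_nat q2 * W z) (of_nat q2 * W z')) =
      \<eta>1 (-1) * (of_nat q1 ^ 2 * z * z') * twisted_sum ?N ?X' ?h"
  proof (rule twisted_sum_lin2[where a = 0 and b = 1 and c = "-1" and d = 0])
    show "tame ?h" by (rule tame_lattice_kernel) (use q z in auto)
    show "lattice_kernel (of_nat q2 * W z) (of_nat q2 * W z') v = (of_nat q1 ^ 2 * z * z') * ?h (?T v)" for v
      by (rule kernel)
    show "?X v = \<eta>1 (-1) * ?X' (?T v)" for v by (rule chars)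
  qed (use q in \<open>simp_all add: dirichlet_char_periodic_multiple[OF D1] dirichlet_char_periodic_multiple[OF D2]\<close>)
  have Im: "Im (W y) > 0" if "Im y > 0" for y
  proof -
    let ?u = "complex_of_real (real q1 * real q2) * y"
    have u: "Im ?u > 0" using that q by simp
    then have "(Re ?u)\<^sup>2 + (Im ?u)\<^sup>2 > 0" by (intro add_nonneg_pos zero_le_power2 zero_less_power)
    moreover have "Im (- 1 / ?u) = Im ?u / ((Re ?u)\<^sup>2 + (Im ?u)\<^sup>2)" by (subst Im_divide) simp
    ultimately have "Im (- 1 / ?u) > 0" using u by (simp only: divide_pos_pos)
    then show ?thesis by (simp add: W_def)
  qed
  have diff: "W z' - W z = (z' - z) / (of_nat q1 * of_nat q2 * z * z')"
    using nz q unfolding W_def by (simp add: field_simps)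
  have g1: "?\<tau>1 * ?\<tau>1' = \<eta>1 (-1) * of_nat q1" and g2: "?\<tau>2 * ?\<tau>2' = \<eta>2 (-1) * of_nat q2"
    by (rule gauss_sum_mult_conj[OF P1], rule gauss_sum_mult_conj[OF P2])
  note \<tau> = gauss_sum_nonzero[OF P1] gauss_sum_nonzero[OF P2]
  \<comment> \<open>The two instances of \<open>eis_f_diff\<close> bring in the Gauss sums of the
    characters themselves. By equal parity their ratio can be traded for that of the conjugate
    characters, the normalisation of \<open>dedekind_S\<close>.\<close>
  have ratio: "?\<tau>2' / ?\<tau>1' = of_nat q2 * ?\<tau>1 / (of_nat q1 * ?\<tau>2)"
  proof -
    have "\<eta>2 (-1) = (\<eta>1 (-1) * \<eta>1 (-1)) * \<eta>2 (-1)"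
      by (simp only: dirichlet_char_minus_1[OF D1] mult_1)
    also have "\<dots> = \<eta>1 (-1) * (\<eta>1 (-1) * \<eta>2 (-1))" by (rule mult.assoc)
    also have "\<dots> = \<eta>1 (-1)" by (simp only: par mult_1_right)
    finally have par_eq: "\<eta>2 (-1) = \<eta>1 (-1)" .
    have "?\<tau>2' * (of_nat q1 * ?\<tau>2) = (?\<tau>2 * ?\<tau>2') * of_nat q1" by (simp only: mult_ac)
    also have "\<dots> = (?\<tau>1 * ?\<tau>1') * of_nat q2" by (simp only: g1 g2 par_eq mult_ac)
    also have "\<dots> = of_nat q2 * ?\<tau>1 * ?\<tau>1'" by (simp only: mult_ac)
    finally show ?thesis using \<tau> q by (subst frac_eq_eq) simp_all
  qed
  have "eis_f \<eta>1 \<eta>2 (W z) - eis_f \<eta>1 \<eta>2 (W z') = \<i> * of_nat q2 ^ 2 / (4 * of_real pi * ?\<tau>2) *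
      ((z' - z) / (of_nat q1 * of_nat q2 * z * z')) * (\<eta>1 (-1) * (of_nat q1 ^ 2 * z * z') * twisted_sum ?N ?X' ?h)"
    by (simp only: eis_f_diff[OF P1 P2 q par Im[OF z(1)] Im[OF z(2)]] tw diff)
  also have "\<dots> = \<eta>1 (-1) * (of_nat q2 * ?\<tau>1 / (of_nat q1 * ?\<tau>2)) *
      (\<i> * of_nat q1 ^ 2 / (4 * of_real pi * ?\<tau>1) * (z' - z) * twisted_sum ?N ?X' ?h)"
    using nz q \<tau> by (simp add: power2_eq_square divide_simps)
  also have "twisted_sum ?N ?X' ?h = twisted_sum ?N' ?X' ?h" by (simp only: mult.commute)
  also have "\<i> * of_nat q1 ^ 2 / (4 * of_real pi * ?\<tau>1) * (z' - z) * twisted_sum ?N' ?X' ?h =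
      eis_f \<eta>2 \<eta>1 z - eis_f \<eta>2 \<eta>1 z'"
    by (simp only: eis_f_diff[OF P2 P1 q(2,1) par' z])
  finally show ?thesis by (simp only: ratio[symmetric] times_divide_eq_right)
qed

text \<open>By the difference form \<open>K\<close> does not depend on the point. As the point goes
  up the imaginary axis its image under the involution tends to 0, so \<open>K\<close> is the
  boundary value \<open>F 1\<close> minus a multiple of \<open>G 0 = 0\<close>.\<close>

lemma eis_f_fricke:
  assumes P1: "primitive_dirichlet_char q1 \<eta>1" and P2: "primitive_dirichlet_char q2 \<eta>2"
    and q: "q1 > 1" "q2 > 1" and par: "\<eta>1 (-1) * \<eta>2 (-1) = 1"
    and z: "Im z > 0"
  shows "eis_f \<eta>1 \<eta>2 (- 1 / (of_nat q1 * of_nat q2 * z)) =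
    \<eta>1 (-1) * gauss_sum q2 (conj_char \<eta>2) / gauss_sum q1 (conj_char \<eta>1) * eis_f \<eta>2 \<eta>1 z +
    dirichlet_L 1 \<eta>1 * (\<i> / (2 * gauss_sum q2 \<eta>2) * char_cot q2 \<eta>2 0)"
proof -
  define C where "C = \<eta>1 (-1) * gauss_sum q2 (conj_char \<eta>2) / gauss_sum q1 (conj_char \<eta>1)"
  define K where "K = eis_f \<eta>1 \<eta>2 (- 1 / (of_nat q1 * of_nat q2 * z)) - C * eis_f \<eta>2 \<eta>1 z"
  obtain F where F: "continuous_on {0..1} F" "\<And>t. t > 0 \<Longrightarrow> eis_f \<eta>1 \<eta>2 (\<i> * of_real t) = F (exp (- 2 * pi * t))"
    "F 1 = dirichlet_L 1 \<eta>1 * (\<i> / (2 * gauss_sum q2 \<eta>2) * char_cot q2 \<eta>2 0)"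
    using eis_f_imaginary_axis[OF P1 P2 q] by blast
  obtain G where G: "continuous_on {0..1} G" "\<And>t. t > 0 \<Longrightarrow> eis_f \<eta>2 \<eta>1 (\<i> * of_real t) = G (exp (- 2 * pi * t))"
    "G 0 = 0"
    using eis_f_imaginary_axis[OF P2 P1 q(2,1)] by blast
  \<comment> \<open>The values of \<open>exp (- 2 * pi * t)\<close> at
    \<open>t = 1 / (n + 1)\<close> and, for \<open>y\<close>, at
    \<open>t = (n + 1) / (q1 * q2)\<close>; the Fricke involution interchanges these two points of
    the axis.\<close>
  define x where "x n = exp (- 2 * pi * (1 / real (Suc n)))" for n
  define y where "y n = exp (- 2 * pi * (real (Suc n) / (real q1 * real q2)))" for n
  have K: "K = F (x n) - C * G (y n)" for n
  proof -
    let ?t = "1 / real (Suc n)" and ?s = "real (Suc n) / (real q1 * real q2)"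
    have s: "?s > 0" "?t > 0" using q by simp_all
    have W: "- 1 / (of_nat q1 * of_nat q2 * (\<i> * complex_of_real ?s)) = \<i> * of_real ?t"
      using q by (simp add: field_simps del: of_nat_Suc)
    have "Im (\<i> * complex_of_real ?s) > 0" using s(1) by simp
    from eis_f_fricke_diff[OF P1 P2 q par z this]
    have "K = eis_f \<eta>1 \<eta>2 (\<i> * of_real ?t) - C * eis_f \<eta>2 \<eta>1 (\<i> * complex_of_real ?s)"
      unfolding W C_def[symmetric] K_def by (simp add: algebra_simps)
    then show ?thesis using F(2)[OF s(2)] G(2)[OF s(1)] by (simp only: x_def y_def)
  qed
  have lim: "(\<lambda>n. f (u n)) \<longlonglongrightarrow> f l"
    if "continuous_on {0..1} f" "u \<longlonglongrightarrow> l" "l \<in> {0..1}" "\<And>n. u n \<in> {0..1}" for f :: "real \<Rightarrow> complex" and u l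
    by (rule continuous_on_tendsto_compose[OF that(1,2,3)]) (use that(4) in simp)
  have "x \<longlonglongrightarrow> 1"
  proof -
    have "(\<lambda>n. exp (- 2 * pi * (1 / real (Suc n)))) \<longlonglongrightarrow> exp (- 2 * pi * 0)"
      by (intro tendsto_exp tendsto_mult_left LIMSEQ_Suc[OF lim_1_over_n])
    then show ?thesis by (simp add: x_def[abs_def])
  qed
  then have "(\<lambda>n. F (x n)) \<longlonglongrightarrow> F 1" by (rule lim[OF F(1)]) (simp_all add: x_def)
  moreover have "y \<longlonglongrightarrow> 0"
  proof -
    define r where "r = exp (- 2 * pi / (real q1 * real q2))"
    have "r > 0" "r < 1" using q by (simp_all add: r_def)
    then have "(\<lambda>n. r ^ Suc n) \<longlonglongrightarrow> 0" by (intro LIMSEQ_Suc LIMSEQ_power_zero) simp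
    moreover have "y = (\<lambda>n. r ^ Suc n)"
      unfolding y_def r_def by (subst exp_of_nat_mult[symmetric]) (simp add: mult_ac)
    ultimately show ?thesis by (simp only:)
  qed
  then have "(\<lambda>n. G (y n)) \<longlonglongrightarrow> G 0" by (rule lim[OF G(1)]) (use q in \<open>simp_all add: y_def\<close>)
  ultimately have "(\<lambda>n. F (x n) - C * G (y n)) \<longlonglongrightarrow> F 1 - C * G 0"
    by (intro tendsto_diff tendsto_mult_left)
  then have "K = F 1" using G(3) LIMSEQ_unique[OF tendsto_const[of K]] by (simp flip: K)
  then show ?thesis unfolding F(3)[symmetric] C_def[symmetric] K_def diff_eq_eq by (simp only: add.commute)
qed

theorem theorem1p3:
  fixes q1 q2 :: nat and \<chi>1 \<chi>2 :: "int \<Rightarrow> complex"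
    and a b c d :: int and \<gamma> \<gamma>' :: "int^2^2"
  assumes "primitive_dirichlet_char q1 \<chi>1" and "primitive_dirichlet_char q2 \<chi>2"
    and "q1 > 1" and "q2 > 1"
    and "\<chi>1 (-1) * \<chi>2 (-1) = 1"
    and "\<gamma> = mat2 a b (c * int q1 * int q2) d"
    and "\<gamma> \<in> Gamma0 (q1 * q2)"
    and "\<gamma>' = mat2 d (- c) (- b * int q1 * int q2) a"
  shows "\<gamma>' \<in> Gamma0 (q1 * q2) \<and>
    (even_char \<chi>1 \<and> even_char \<chi>2 \<longrightarrow>
       dedekind_S q1 \<chi>1 \<chi>2 \<gamma> = dedekind_S q2 \<chi>2 \<chi>1 \<gamma>') \<and>
    (odd_char \<chi>1 \<and> odd_char \<chi>2 \<longrightarrow>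
       dedekind_S q1 \<chi>1 \<chi>2 \<gamma> =
         - dedekind_S q2 \<chi>2 \<chi>1 \<gamma>' +
         (1 - psi_char \<chi>1 \<chi>2 \<gamma>) *
           (gauss_sum q1 (conj_char \<chi>1) * gauss_sum q2 (conj_char \<chi>2) / (of_real pi * \<i>)\<^sup>2) *
           dirichlet_L 1 \<chi>1 * dirichlet_L 1 \<chi>2)"
proof -
  note P1 = assms(1) and P2 = assms(2) and q = assms(3,4) and par = assms(5)
  have D1: "dirichlet_char q1 \<chi>1" and D2: "dirichlet_char q2 \<chi>2"
    using P1 P2 by (simp_all add: primitive_dirichlet_char_def)
  have det: "a * d - b * (c * int q1 * int q2) = 1"
    using assms(7) by (simp add: assms(6) Gamma0_def)
  have par': "\<chi>2 (-1) * \<chi>1 (-1) = 1" using par by (simp add: mult.commute)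
  have \<gamma>': "\<gamma>' = mat2 d (- c) (- b * int q2 * int q1) a" by (simp add: assms(8) mult_ac)
  have det': "d * a - (- c) * (- b * int q2 * int q1) = 1" using det by (simp add: mult_ac)
  have mem: "\<gamma>' \<in> Gamma0 (q1 * q2)"
    unfolding Gamma0_def \<gamma>' using det' by (simp add: mult_ac)
  let ?\<tau>1 = "gauss_sum q1 (conj_char \<chi>1)" and ?\<tau>2 = "gauss_sum q2 (conj_char \<chi>2)"
  let ?N = "of_nat q1 * of_nat q2 :: complex" and ?\<psi> = "psi_char \<chi>1 \<chi>2 \<gamma>"
  define C where "C = \<chi>1 (-1) * ?\<tau>2 / ?\<tau>1"
  define K where "K = dirichlet_L 1 \<chi>1 * (\<i> / (2 * gauss_sum q2 \<chi>2) * char_cot q2 \<chi>2 0)"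
  note \<tau> = gauss_sum_nonzero[OF P1] gauss_sum_nonzero[OF P2]
  have ad: "[a * d = 1] (mod int q2)" "[d * a = 1] (mod int q1)"
  proof -
    have "a * d - 1 = int q2 * (b * c * int q1)" "d * a - 1 = int q1 * (b * c * int q2)"
      using det by (simp_all add: algebra_simps)
    then show "[a * d = 1] (mod int q2)" "[d * a = 1] (mod int q1)" by (simp_all add: cong_iff_dvd_diff)
  qed
  \<comment> \<open>The lower right entry of \<open>\<gamma>'\<close> is \<open>a\<close>, inverse
    to \<open>d\<close> for both moduli; inversion conjugates the values, which compensates the
    exchange of the characters.\<close>
  have psi: "psi_char \<chi>2 \<chi>1 \<gamma>' = ?\<psi>"
    using dirichlet_char_inverse[OF D2 ad(1)] dirichlet_char_inverse[OF D1 ad(2)]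
    by (simp add: psi_char_def conj_char_def \<gamma>' assms(6) mult.commute)
  text \<open>The Fricke involution \<open>W z = -1 / (q1 q2 z)\<close> satisfies \<open>\<gamma> (W z) = W (\<gamma>' z)\<close>.\<close>
  have phi: "eis_phi \<chi>1 \<chi>2 \<gamma> = C * eis_phi \<chi>2 \<chi>1 \<gamma>' + (1 - ?\<psi>) * K"
  proof -
    define z where "z = \<i>"
    define z' where "z' = moebius_action \<gamma>' z"
    have z: "Im z > 0" by (simp add: z_def)
    have z': "Im z' > 0" unfolding z'_def \<gamma>' by (rule Im_moebius_pos[OF det' z])
    have fz: "eis_f \<chi>1 \<chi>2 (- 1 / (?N * z)) = C * eis_f \<chi>2 \<chi>1 z + K"
      unfolding C_def K_def by (rule eis_f_fricke[OF P1 P2 q par z])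
    have fz': "eis_f \<chi>1 \<chi>2 (- 1 / (?N * z')) = C * eis_f \<chi>2 \<chi>1 z' + K"
      unfolding C_def K_def by (rule eis_f_fricke[OF P1 P2 q par z'])
    have W: "Im (- 1 / (?N * z)) > 0"
    proof -
      have "- 1 / (?N * z) = \<i> * of_real (1 / (real q1 * real q2))"
        using q by (simp add: z_def field_simps)
      then show ?thesis using q by simp
    qed
    have Wz: "moebius_action \<gamma> (- 1 / (?N * z)) = - 1 / (?N * z')"
    proof -
      have nz: "z \<noteq> 0" "?N \<noteq> 0" using z q by auto
      let ?n = "of_int d * z + of_int (- c)" and ?m = "of_int (- b * int q2 * int q1) * z + of_int a"
      have m: "?m \<noteq> 0" by (rule moebius_denominator_nonzero[OF det' z])
      have z'_eq: "z' = ?n / ?m" by (simp add: z'_def moebius_action_def \<gamma>')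
      have "of_int a * (- 1 / (?N * z)) + of_int b = - ?m / (?N * z)"
        using nz by (simp add: field_simps)
      moreover have "of_int (c * int q1 * int q2) * (- 1 / (?N * z)) + of_int d = ?n / z"
        using nz by (simp add: field_simps)
      ultimately have "moebius_action \<gamma> (- 1 / (?N * z)) = (- ?m / (?N * z)) / (?n / z)"
        by (simp only: moebius_action_def assms(6) mat2_nth)
      also have "\<dots> = - 1 / (?N * (?n / ?m))" using nz m by simp
      finally show ?thesis by (simp only: z'_eq)
    qed
    have "eis_phi \<chi>1 \<chi>2 \<gamma> = eis_f \<chi>1 \<chi>2 (moebius_action \<gamma> (- 1 / (?N * z))) - ?\<psi> * eis_f \<chi>1 \<chi>2 (- 1 / (?N * z))"
      unfolding assms(6) by (rule eis_phi_eq[OF P1 P2 q par det W])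
    also have "\<dots> = (C * eis_f \<chi>2 \<chi>1 z' + K) - ?\<psi> * (C * eis_f \<chi>2 \<chi>1 z + K)"
      by (simp only: Wz fz fz')
    \<comment> \<open>The constant \<open>K\<close> enters once from the transformed point and once,
      with weight \<open>?\<psi>\<close>, from the original one.\<close>
    also have "\<dots> = C * (eis_f \<chi>2 \<chi>1 z' - psi_char \<chi>2 \<chi>1 \<gamma>' * eis_f \<chi>2 \<chi>1 z) + (1 - ?\<psi>) * K"
      unfolding psi by (simp add: algebra_simps)
    also have "eis_f \<chi>2 \<chi>1 z' - psi_char \<chi>2 \<chi>1 \<gamma>' * eis_f \<chi>2 \<chi>1 z = eis_phi \<chi>2 \<chi>1 \<gamma>'"
      unfolding z'_def \<gamma>' by (rule eis_phi_eq[OF P2 P1 q(2,1) par' det' z, symmetric])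
    finally show ?thesis .
  qed
  have even: "dedekind_S q1 \<chi>1 \<chi>2 \<gamma> = dedekind_S q2 \<chi>2 \<chi>1 \<gamma>'" if "even_char \<chi>1" "even_char \<chi>2"
  proof -
    have "K = 0" using char_cot_0_even[OF D2 that(2)] by (simp add: K_def)
    moreover have "C = ?\<tau>2 / ?\<tau>1" using that(1) by (simp add: C_def even_char_def)
    ultimately show ?thesis using \<tau> by (simp add: dedekind_S_def phi)
  qed
  have odd: "dedekind_S q1 \<chi>1 \<chi>2 \<gamma> = - dedekind_S q2 \<chi>2 \<chi>1 \<gamma>' +
      (1 - ?\<psi>) * (?\<tau>1 * ?\<tau>2 / (of_real pi * \<i>)\<^sup>2) * dirichlet_L 1 \<chi>1 * dirichlet_L 1 \<chi>2"
    if "odd_char \<chi>1" "odd_char \<chi>2"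
  proof -
    have C: "C = - ?\<tau>2 / ?\<tau>1" using that(1) by (simp add: C_def odd_char_def)
    have g: "gauss_sum q2 \<chi>2 * ?\<tau>2 = - of_nat q2"
      using gauss_sum_mult_conj[OF P2] that(2) by (simp add: odd_char_def)
    have cot: "char_cot q2 \<chi>2 0 = 2 * dirichlet_L 1 \<chi>2 * of_nat q2 / of_real pi"
      using char_cot_0_odd[OF P2 q(2) that(2)] q by (simp add: field_simps)
    \<comment> \<open>For an odd character the product of the two Gauss sums is \<open>- q2\<close>;
      the \<open>q2\<close> comes from \<open>char_cot q2 \<chi>2 0\<close>. With
      \<open>- \<i> = 1 / \<i>\<close> this produces the denominator \<open>pi * \<i>\<close> of
      \<open>K\<close>.\<close>
    have inv: "of_nat q2 / gauss_sum q2 \<chi>2 = - ?\<tau>2"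
      using g \<tau>(3) by (simp add: field_simps)
    have "K = dirichlet_L 1 \<chi>1 * (\<i> * (of_nat q2 / gauss_sum q2 \<chi>2) * dirichlet_L 1 \<chi>2 / of_real pi)"
      unfolding K_def cot by simp
    then have K: "K = ?\<tau>2 / (of_real pi * \<i>) * dirichlet_L 1 \<chi>1 * dirichlet_L 1 \<chi>2"
      unfolding inv by (simp add: field_simps)
    show ?thesis
      using \<tau> unfolding dedekind_S_def phi C K by (simp add: field_simps power2_eq_square)
  qed
  show ?thesis using mem even odd by blast
qed

end
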